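(* Let $d\ge1$, $p\in(2,\infty)$, $r\in\left(\frac{dp}{p-2},\infty\right)$, $\sigma>0$, $W>0$, $\psi>0$, $C_{\mathrm{top}}>0$, let $T$ be a positive integer, $\Delta t=1/T$ and $\tau=\sigma\sqrt{\Delta t}$. Let $f_0\in L^{r^*}(\mathbb R^d)$ and let $U:C^1_0\to\mathbb R$ be continuously Fréchet differentiable and bounded from below. Consider the problem of minimizing $E:Q_T\times\mathcal U_T\times\mathcal V_T\to\mathbb R$, $$E(f,u,v)=\Delta t\sum_{k=1}^{T-1}\left(C_{\mathrm{top}}\|u_k\|_{L^r}^p+\|v_k\|_V^p\right)+U(f_T),$$ subject to the constraint $$f_1=\eta_\tau\star f_0,\qquad f_{k+1}=G(f_k,u_k,v_k),\quad k=1,\dots,T-1.$$ If $(f,u,v)$ is a minimizer of $E$ subject to this constraint, then there is $\lambda:\{1,\dots,T\}\to(C^1_0)^*$ such that $(f,u,v,\lambda)$ is a critical point of the Lagrangian $$\mathcal L(f,u,v,\lambda)=\Delta t\sum_{k=1}^{T-1}\left(C_{\mathrm{top}}\|u_k\|_{L^r}^p+\|v_k\|_V^p\right)+U(f_T)+\sum_{k=2}^T\left(\lambda_k\mid f_k-G(f_{k-1},u_{k-1},v_{k-1})\right)+\left(\lambda_1\mid f_1-\eta_\tau\star f_0\right).$$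
   Context: $r^*=r/(r-1)$. $C^1_0=C^1_0(\mathbb R^d)$ is the closure of the compactly supported functions in the Banach space of $C^1$ functions on $\mathbb R^d$ that are bounded with their first derivatives, with norm $\|h\|_{C^1}=\max_{|\alpha|\le1}\sup_x|\partial_\alpha h(x)|$. $(\lambda\mid h)$ is the pairing of a dual vector with a vector. $V$ is a fixed Hilbert space of vector fields on $\mathbb R^d$ continuously embedded in the space $C^1(\mathbb R^d,\mathbb R^d)$ of vector fields bounded with their first derivatives. $Q_T$ is the space of tuples $(f_1,\dots,f_T)$ in $C^1_0$; $\mathcal U_T$ and $\mathcal V_T$ are identified with the spaces of tuples $(u_1,\dots,u_{T-1})$ in $L^r(\mathbb R^d)$ and $(v_1,\dots,v_{T-1})$ in $V$ (functions of $t\in[0,1]$ equal to $u_i$, resp. $v_i$, on $[i\Delta t,(i+1)\Delta t)$ for $i=1,\dots,T-1$ and zero on $[0,\Delta t)$). $\eta_\tau(x)=\frac{\exp(-|x|^2/2\tau^2)}{(2\pi)^{d/2}\tau^d}$ and $\star$ is convolution. $I(\xi)=W\xi^2(\xi-1)^2(\xi-1/2)\mathbf 1_{[0,1]}(\xi)$, $\chi(z)=\sqrt{|z|^2+\psi^2}$ for $z\in\mathbb R^d$, and $G:C^1_0\times L^r(\mathbb R^d)\times V\to C^1_0$ is $$G(f',u',v')=\eta_\tau\star f'+\eta_\tau\star\left(\chi(\nabla f')u'-\nabla f'^Tv'+I(f')\right).$$ A critical point of $\mathcal L$ is a point of $Q_T\times\mathcal U_T\times\mathcal V_T\times((C^1_0)^*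 )^T$ at which all partial Fréchet derivatives of $\mathcal L$ vanish. *)

theory Defs
  imports "HOL-Analysis.Analysis" "HOL-Library.Function_Algebras"
begin

section \<open>Bounded \<open>C\<^sup>1\<close> functions and \<open>C\<^sup>1\<^sub>0\<close>\<close>

definition pderiv_at :: "'d::finite \<Rightarrow> (real^'d \<Rightarrow> 'b::real_normed_vector) \<Rightarrow> real^'d \<Rightarrow> 'b" where
  "pderiv_at i h x = frechet_derivative h (at x) (axis i 1)"

definition C1_bounded :: "(real^'d::finite \<Rightarrow> 'b::real_normed_vector) set" where
  "C1_bounded = {h. (\<forall>x. h differentiable (at x)) \<and> (\<forall>i. continuous_on UNIV (pderiv_at i h))
      \<and> bounded (range h) \<and> (\<forall>i. bounded (range (pderiv_at i h)))}"

lemma pderiv_at_add: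
  "f differentiable (at x) \<Longrightarrow> g differentiable (at x) \<Longrightarrow>
    pderiv_at i (\<lambda>x. f x + g x) x = pderiv_at i f x + pderiv_at i g x"
  unfolding pderiv_at_def frechet_derivative_works
  by (drule (1) has_derivative_add) (drule frechet_derivative_at, drule fun_cong, erule sym)

lemma pderiv_at_scaleR:
  "f differentiable (at x) \<Longrightarrow> pderiv_at i (\<lambda>x. c *\<^sub>R f x) x = c *\<^sub>R pderiv_at i f x"
  unfolding pderiv_at_def frechet_derivative_works
  by (drule has_derivative_scaleR_right[where r = c])
    (drule frechet_derivative_at, drule fun_cong, erule sym)

lemma pderiv_at_zero: "pderiv_at i (\<lambda>x. 0) x = 0"
  by (simp add: pderiv_at_def)

lemma C1_bounded_zero: "(\<lambda>x. 0) \<in> C1_bounded"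
proof -
  have "pderiv_at i (\<lambda>x. 0::'b) = (\<lambda>x::real^'a. 0)" for i
    by (rule ext) (rule pderiv_at_zero)
  then show ?thesis
    by (auto simp: C1_bounded_def image_constant_conv)
qed

lemma C1_bounded_add:
  assumes "f \<in> C1_bounded" "g \<in> C1_bounded"
  shows "(\<lambda>x. f x + g x) \<in> C1_bounded"
proof -
  have "pderiv_at i (\<lambda>x. f x + g x) = (\<lambda>x. pderiv_at i f x + pderiv_at i g x)" for i
    using assms by (intro ext pderiv_at_add) (auto simp: C1_bounded_def)
  then show ?thesis
    using assms by (auto simp: C1_bounded_def intro!: continuous_on_add bounded_plus_comp)
qed

lemma C1_bounded_scaleR:
  assumes "f \<in> C1_bounded"
  shows "(\<lambda>x. c *\<^sub>R f x) \<in> C1_bounded"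
proof -
  have "pderiv_at i (\<lambda>x. c *\<^sub>R f x) = (\<lambda>x. c *\<^sub>R pderiv_at i f x)" for i
    using assms by (intro ext pderiv_at_scaleR) (auto simp: C1_bounded_def)
  then show ?thesis
    using assms by (auto simp: C1_bounded_def intro!: continuous_intros bounded_scaleR_comp)
qed

lemma C1_bounded_uminus: "f \<in> C1_bounded \<Longrightarrow> (\<lambda>x. - f x) \<in> C1_bounded"
  using C1_bounded_scaleR[of f "-1"] by simp

lemma C1_bounded_diff:
  "f \<in> C1_bounded \<Longrightarrow> g \<in> C1_bounded \<Longrightarrow> (\<lambda>x. f x - g x) \<in> C1_bounded"
  using C1_bounded_add[OF _ C1_bounded_uminus, of f g] by simp

typedef (overloaded) ('d, 'b) c1b =
  "C1_bounded :: (real^'d::finite \<Rightarrow> 'b::real_normed_vector) set"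
  morphisms c1b_apply Abs_c1b
  using C1_bounded_zero by blast

instantiation c1b :: (finite, real_normed_vector) real_vector
begin

definition zero_c1b :: "('a, 'b) c1b" where "0 = Abs_c1b (\<lambda>x. 0)"
definition plus_c1b :: "('a, 'b) c1b \<Rightarrow> ('a, 'b) c1b \<Rightarrow> ('a, 'b) c1b" where
  "f + g = Abs_c1b (\<lambda>x. c1b_apply f x + c1b_apply g x)"
definition scaleR_c1b :: "real \<Rightarrow> ('a, 'b) c1b \<Rightarrow> ('a, 'b) c1b" where
  "c *\<^sub>R f = Abs_c1b (\<lambda>x. c *\<^sub>R c1b_apply f x)"
definition uminus_c1b :: "('a, 'b) c1b \<Rightarrow> ('a, 'b) c1b" where
  "- f = Abs_c1b (\<lambda>x. - c1b_apply f x)"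
definition minus_c1b :: "('a, 'b) c1b \<Rightarrow> ('a, 'b) c1b \<Rightarrow> ('a, 'b) c1b" where
  "f - g = Abs_c1b (\<lambda>x. c1b_apply f x - c1b_apply g x)"

lemma c1b_apply_zero: "c1b_apply (0 :: ('a, 'b) c1b) x = 0"
  by (simp add: zero_c1b_def Abs_c1b_inverse C1_bounded_zero)
lemma c1b_apply_add: "c1b_apply (f + g) x = c1b_apply (f :: ('a, 'b) c1b) x + c1b_apply g x"
  by (simp add: plus_c1b_def Abs_c1b_inverse C1_bounded_add c1b_apply)
lemma c1b_apply_scaleR: "c1b_apply (c *\<^sub>R f) x = c *\<^sub>R c1b_apply (f :: ('a, 'b) c1b) x"
  by (simp add: scaleR_c1b_def Abs_c1b_inverse C1_bounded_scaleR c1b_apply)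
lemma c1b_apply_uminus: "c1b_apply (- f) x = - c1b_apply (f :: ('a, 'b) c1b) x"
  by (simp add: uminus_c1b_def Abs_c1b_inverse C1_bounded_uminus c1b_apply)
lemma c1b_apply_diff: "c1b_apply (f - g) x = c1b_apply (f :: ('a, 'b) c1b) x - c1b_apply g x"
  by (simp add: minus_c1b_def Abs_c1b_inverse C1_bounded_diff c1b_apply)

lemma c1b_eqI: "(\<And>x. c1b_apply f x = c1b_apply g x) \<Longrightarrow> f = (g :: ('a, 'b) c1b)"
  by (auto simp: c1b_apply_inject[symmetric])

instance
  by standard
    (rule c1b_eqI; simp add: c1b_apply_zero c1b_apply_add c1b_apply_scaleR c1b_apply_uminus
      c1b_apply_diff algebra_simps)+

end

instantiation c1b :: (finite, real_normed_vector) real_normed_vector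
begin

definition norm_c1b :: "('a, 'b) c1b \<Rightarrow> real" where
  "norm h = Max (insert (SUP x. norm (c1b_apply h x))
                   (range (\<lambda>i. SUP x. norm (pderiv_at i (c1b_apply h) x))))"
definition dist_c1b :: "('a, 'b) c1b \<Rightarrow> ('a, 'b) c1b \<Rightarrow> real" where
  "dist_c1b f g = norm (f - g)"
definition sgn_c1b :: "('a, 'b) c1b \<Rightarrow> ('a, 'b) c1b" where
  "sgn_c1b f = f /\<^sub>R norm f"
definition uniformity_c1b :: "(('a, 'b) c1b \<times> ('a, 'b) c1b) filter" where
  "uniformity_c1b = (INF e\<in>{0 <..}. principal {(x, y). dist x y < e})"
definition open_c1b :: "('a, 'b) c1b set \<Rightarrow> bool" where
  "open_c1b S = (\<forall>x\<in>S. \<forall>\<^sub>F (x', y) in uniformity. x' = x \<longrightarrow> y \<in> S)"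

lemma bdd_above_c1b:
  fixes h :: "('a, 'b) c1b"
  shows "bdd_above (range (\<lambda>x. norm (c1b_apply h x)))"
    and "bdd_above (range (\<lambda>x. norm (pderiv_at i (c1b_apply h) x)))"
  using c1b_apply[of h] by (auto simp: C1_bounded_def bounded_iff bdd_above_def)

lemma norm_c1b_le_iff:
  fixes h :: "('a, 'b) c1b"
  shows "norm h \<le> c \<longleftrightarrow>
    (\<forall>x. norm (c1b_apply h x) \<le> c) \<and> (\<forall>i x. norm (pderiv_at i (c1b_apply h) x) \<le> c)"
  by (simp add: norm_c1b_def cSUP_le_iff bdd_above_c1b)

lemma norm_c1b_bounds:
  fixes h :: "('a, 'b) c1b"
  shows "norm (c1b_apply h x) \<le> norm h" and "norm (pderiv_at i (c1b_apply h) x) \<le> norm h"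
  using norm_c1b_le_iff[of h "norm h"] by auto

lemma c1b_differentiable: "c1b_apply (h :: ('a, 'b) c1b) differentiable (at x)"
  using c1b_apply[of h] by (simp add: C1_bounded_def)

lemma pderiv_at_c1b_add:
  "pderiv_at i (c1b_apply (f + g :: ('a, 'b) c1b)) x =
    pderiv_at i (c1b_apply f) x + pderiv_at i (c1b_apply g) x"
proof -
  have *: "c1b_apply (f + g) = (\<lambda>x. c1b_apply f x + c1b_apply g x)"
    by (rule ext) (rule c1b_apply_add)
  show ?thesis unfolding * by (intro pderiv_at_add c1b_differentiable)
qed

lemma pderiv_at_c1b_scaleR:
  "pderiv_at i (c1b_apply (c *\<^sub>R f :: ('a, 'b) c1b)) x = c *\<^sub>R pderiv_at i (c1b_apply f) x"
proof -
  have *: "c1b_apply (c *\<^sub>R f) = (\<lambda>x. c *\<^sub>R c1b_apply f x)"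
    by (rule ext) (rule c1b_apply_scaleR)
  show ?thesis unfolding * by (intro pderiv_at_scaleR c1b_differentiable)
qed

instance
proof
  fix f g :: "('a, 'b) c1b" and c :: real
  have nonneg: "0 \<le> norm h" for h :: "('a, 'b) c1b"
    using norm_c1b_bounds(1)[of h undefined] norm_ge_zero order_trans by blast
  show "norm f = 0 \<longleftrightarrow> f = 0"
  proof
    assume "norm f = 0"
    then show "f = 0"
      using norm_c1b_bounds(1)[of f] by (intro c1b_eqI) (simp add: c1b_apply_zero)
  next
    assume "f = 0"
    then have "c1b_apply f = (\<lambda>x. 0)"
      by (auto simp: c1b_apply_zero)
    then have "norm f \<le> 0"
      by (simp add: norm_c1b_le_iff pderiv_at_zero)
    then show "norm f = 0"
      using nonneg[of f] by simp
  qed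
  show "norm (f + g) \<le> norm f + norm g"
    unfolding norm_c1b_le_iff
    unfolding c1b_apply_add pderiv_at_c1b_add
    by (intro conjI allI norm_triangle_mono norm_c1b_bounds)
  have le: "norm (a *\<^sub>R h) \<le> \<bar>a\<bar> * norm h" for a :: real and h :: "('a, 'b) c1b"
    unfolding norm_c1b_le_iff
    unfolding c1b_apply_scaleR pderiv_at_c1b_scaleR norm_scaleR
    by (intro conjI allI mult_left_mono norm_c1b_bounds abs_ge_zero)
  show "norm (c *\<^sub>R f) = \<bar>c\<bar> * norm f"
  proof (cases "c = 0")
    case True
    then show ?thesis using le[of 0 f] nonneg[of "0 *\<^sub>R f"] by simp
  next
    case False
    have "norm f \<le> \<bar>inverse c\<bar> * norm (c *\<^sub>R f)"
      using le[of "inverse c" "c *\<^sub>R f"] False by simp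
    then have "\<bar>c\<bar> * norm f \<le> norm (c *\<^sub>R f)"
      using False by (simp add: field_simps)
    then show ?thesis using le[of c f] by simp
  qed
qed (rule dist_c1b_def sgn_c1b_def open_c1b_def uniformity_c1b_def)+

end

definition C10_space :: "('d::finite, real) c1b set" where
  "C10_space = closure {h. compact (closure {x. c1b_apply h x \<noteq> 0})}"

lemma compact_support_subspace:
  "subspace {h :: ('d::finite, 'b::real_normed_vector) c1b. compact (closure {x. c1b_apply h x \<noteq> 0})}"
proof (rule subspaceI; clarify)
  show "compact (closure {x. c1b_apply (0 :: ('d, 'b) c1b) x \<noteq> 0})"
    by (simp add: c1b_apply_zero)
next
  fix f g :: "('d, 'b) c1b"
  assume "compact (closure {x. c1b_apply f x \<noteq> 0})" "compact (closure {x. c1b_apply g x \<noteq> 0})"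
  then have "bounded ({x. c1b_apply f x \<noteq> 0} \<union> {x. c1b_apply g x \<noteq> 0})"
    by simp
  then have "bounded {x. c1b_apply (f + g) x \<noteq> 0}"
    by (rule bounded_subset) (auto simp: c1b_apply_add)
  then show "compact (closure {x. c1b_apply (f + g) x \<noteq> 0})"
    by simp
next
  fix c :: real and f :: "('d, 'b) c1b"
  assume "compact (closure {x. c1b_apply f x \<noteq> 0})"
  then have "bounded {x. c1b_apply f x \<noteq> 0}"
    by simp
  then have "bounded {x. c1b_apply (c *\<^sub>R f) x \<noteq> 0}"
    by (rule bounded_subset) (auto simp: c1b_apply_scaleR)
  then show "compact (closure {x. c1b_apply (c *\<^sub>R f) x \<noteq> 0})"
    by simp
qed

lemma subspace_closure:
  assumes "subspace (S :: 'x::real_normed_vector set)"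
  shows "subspace (closure S)"
proof (rule subspaceI)
  show "0 \<in> closure S"
    using assms closure_subset subspace_0 by blast
next
  fix x y assume "x \<in> closure S" "y \<in> closure S"
  then obtain X Y where "\<And>n. X n \<in> S" "X \<longlonglongrightarrow> x" "\<And>n. Y n \<in> S" "Y \<longlonglongrightarrow> y"
    unfolding closure_sequential by blast
  then show "x + y \<in> closure S"
    unfolding closure_sequential
    by (intro exI[of _ "\<lambda>n. X n + Y n"]) (auto intro!: tendsto_add subspace_add assms)
next
  fix c x assume "x \<in> closure S"
  then obtain X where "\<And>n. X n \<in> S" "X \<longlonglongrightarrow> x"
    unfolding closure_sequential by blast
  then show "c *\<^sub>R x \<in> closure S"
    unfolding closure_sequential
    by (intro exI[of _ "\<lambda>n. c *\<^sub>R X n"])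
      (auto intro!: tendsto_scaleR tendsto_const subspace_scale assms)
qed

lemma C10_space_subspace: "subspace (C10_space :: ('d::finite, real) c1b set)"
  unfolding C10_space_def by (intro subspace_closure compact_support_subspace)

typedef (overloaded) 'd c10 = "C10_space :: ('d::finite, real) c1b set"
  morphisms c1b_of_c10 Abs_c10
  using subspace_0[OF C10_space_subspace] by blast

instantiation c10 :: (finite) real_vector
begin

definition zero_c10 :: "'a c10" where "0 = Abs_c10 0"
definition plus_c10 :: "'a c10 \<Rightarrow> 'a c10 \<Rightarrow> 'a c10" where
  "f + g = Abs_c10 (c1b_of_c10 f + c1b_of_c10 g)"
definition scaleR_c10 :: "real \<Rightarrow> 'a c10 \<Rightarrow> 'a c10" where
  "c *\<^sub>R f = Abs_c10 (c *\<^sub>R c1b_of_c10 f)"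
definition uminus_c10 :: "'a c10 \<Rightarrow> 'a c10" where
  "- f = Abs_c10 (- c1b_of_c10 f)"
definition minus_c10 :: "'a c10 \<Rightarrow> 'a c10 \<Rightarrow> 'a c10" where
  "f - g = Abs_c10 (c1b_of_c10 f - c1b_of_c10 g)"

lemma c1b_of_c10_zero: "c1b_of_c10 (0 :: 'a c10) = 0"
  by (simp add: zero_c10_def Abs_c10_inverse subspace_0 C10_space_subspace)
lemma c1b_of_c10_add: "c1b_of_c10 (f + g :: 'a c10) = c1b_of_c10 f + c1b_of_c10 g"
  by (simp add: plus_c10_def Abs_c10_inverse subspace_add C10_space_subspace c1b_of_c10)
lemma c1b_of_c10_scaleR: "c1b_of_c10 (c *\<^sub>R f :: 'a c10) = c *\<^sub>R c1b_of_c10 f"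
  by (simp add: scaleR_c10_def Abs_c10_inverse subspace_scale C10_space_subspace c1b_of_c10)
lemma c1b_of_c10_uminus: "c1b_of_c10 (- f :: 'a c10) = - c1b_of_c10 f"
  by (simp add: uminus_c10_def Abs_c10_inverse subspace_neg C10_space_subspace c1b_of_c10)
lemma c1b_of_c10_diff: "c1b_of_c10 (f - g :: 'a c10) = c1b_of_c10 f - c1b_of_c10 g"
  by (simp add: minus_c10_def Abs_c10_inverse subspace_diff C10_space_subspace c1b_of_c10)

instance
  by standard
    (simp_all add: c1b_of_c10_inject[symmetric] c1b_of_c10_zero c1b_of_c10_add c1b_of_c10_scaleR
      c1b_of_c10_uminus c1b_of_c10_diff algebra_simps)

end

instantiation c10 :: (finite) real_normed_vector
begin

definition norm_c10 :: "'a c10 \<Rightarrow> real" where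
  "norm_c10 f = norm (c1b_of_c10 f)"
definition dist_c10 :: "'a c10 \<Rightarrow> 'a c10 \<Rightarrow> real" where
  "dist_c10 f g = norm (f - g)"
definition sgn_c10 :: "'a c10 \<Rightarrow> 'a c10" where
  "sgn_c10 f = f /\<^sub>R norm f"
definition uniformity_c10 :: "('a c10 \<times> 'a c10) filter" where
  "uniformity_c10 = (INF e\<in>{0 <..}. principal {(x, y). dist x y < e})"
definition open_c10 :: "'a c10 set \<Rightarrow> bool" where
  "open_c10 S = (\<forall>x\<in>S. \<forall>\<^sub>F (x', y) in uniformity. x' = x \<longrightarrow> y \<in> S)"

instance
proof
  fix f g :: "'a c10" and c :: real
  show "norm f = 0 \<longleftrightarrow> f = 0"
    by (simp add: norm_c10_def c1b_of_c10_inject[symmetric] c1b_of_c10_zero)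
  show "norm (f + g) \<le> norm f + norm g"
    by (simp add: norm_c10_def c1b_of_c10_add norm_triangle_ineq)
  show "norm (c *\<^sub>R f) = \<bar>c\<bar> * norm f"
    by (simp add: norm_c10_def c1b_of_c10_scaleR)
qed (rule dist_c10_def sgn_c10_def open_c10_def uniformity_c10_def)+

end

definition c10_apply :: "'d::finite c10 \<Rightarrow> real^'d \<Rightarrow> real" where
  "c10_apply f = c1b_apply (c1b_of_c10 f)"

(* Meaningful only when g underlies an element of C^1_0.  This is the case for the functions it is
   applied to below: Gaussian convolutions of elements of L^s (1 < s < infinity) or C_0. *)
definition to_c10 :: "(real^'d::finite \<Rightarrow> real) \<Rightarrow> 'd c10" where
  "to_c10 g = Abs_c10 (Abs_c1b g)"

lemma to_c10_apply: "to_c10 (c10_apply f) = f"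
  by (simp add: to_c10_def c10_apply_def c1b_apply_inverse c1b_of_c10_inverse)


section \<open>\<open>L\<^sup>r\<close> spaces and tuples\<close>

(* An element of L^r is represented by a Borel function; Lr_norm is then a seminorm whose
   kernel is equality almost everywhere, and everything below depends only on the class. *)
definition Lr_space :: "real \<Rightarrow> (real^'d::finite \<Rightarrow> real) set" where
  "Lr_space r = {u \<in> borel_measurable lborel. integrable lborel (\<lambda>x. \<bar>u x\<bar> powr r)}"

definition Lr_norm :: "real \<Rightarrow> (real^'d::finite \<Rightarrow> real) \<Rightarrow> real" where
  "Lr_norm r u = (LINT x|lborel. \<bar>u x\<bar> powr r) powr (1 / r)"

(* Tuples (w 1, ..., w n) in X; entries outside {1..n} are set to 0 so that w is determined by
   its components.  tuple_norm is the sum norm, equivalent to every other product norm and to the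
   norm of the corresponding step functions of time. *)
definition tuples :: "nat \<Rightarrow> 'x::zero set \<Rightarrow> (nat \<Rightarrow> 'x) set" where
  "tuples n X = {w. (\<forall>k\<in>{1..n}. w k \<in> X) \<and> (\<forall>k. k \<notin> {1..n} \<longrightarrow> w k = 0)}"

definition tuple_norm :: "nat \<Rightarrow> ('x \<Rightarrow> real) \<Rightarrow> (nat \<Rightarrow> 'x) \<Rightarrow> real" where
  "tuple_norm n N w = (\<Sum>k=1..n. N (w k))"

definition Q_space :: "nat \<Rightarrow> (nat \<Rightarrow> 'd::finite c10) set" where
  "Q_space T = tuples T UNIV"

definition U_space :: "real \<Rightarrow> nat \<Rightarrow> (nat \<Rightarrow> real^'d::finite \<Rightarrow> real) set" where
  "U_space r T = tuples (T - 1) (Lr_space r)"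

definition V_space :: "nat \<Rightarrow> (nat \<Rightarrow> 'v::real_normed_vector) set" where
  "V_space T = tuples (T - 1) UNIV"

definition Q_dual_space :: "nat \<Rightarrow> (nat \<Rightarrow> ('d::finite c10 \<Rightarrow>\<^sub>L real)) set" where
  "Q_dual_space T = tuples T UNIV"


section \<open>Frechet derivatives on a space given by a carrier and a (semi)norm\<close>

instantiation "fun" :: (type, real_vector) real_vector
begin

definition scaleR_fun :: "real \<Rightarrow> ('a \<Rightarrow> 'b) \<Rightarrow> 'a \<Rightarrow> 'b" where
  "c *\<^sub>R f = (\<lambda>x. c *\<^sub>R f x)"

instance
  by standard (simp_all add: scaleR_fun_def fun_eq_iff algebra_simps)

end

(* The exponent r of L^r and the length of tuples are terms, so these spaces are not types and
   has_derivative does not apply to them directly; see has_frechet_derivative_on_UNIV. *)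
definition has_frechet_derivative_on ::
    "('x::real_vector \<Rightarrow> real) \<Rightarrow> ('x \<Rightarrow> real) \<Rightarrow> 'x \<Rightarrow> 'x set \<Rightarrow> ('x \<Rightarrow> real) \<Rightarrow> bool" where
  "has_frechet_derivative_on F D x X N \<longleftrightarrow>
     (\<forall>h\<in>X. \<forall>k\<in>X. D (h + k) = D h + D k) \<and>
     (\<forall>c. \<forall>h\<in>X. D (c *\<^sub>R h) = c * D h) \<and>
     (\<exists>B. \<forall>h\<in>X. \<bar>D h\<bar> \<le> B * N h) \<and>
     (\<forall>e>0. \<exists>d>0. \<forall>h\<in>X. N h < d \<longrightarrow> \<bar>F (x + h) - F x - D h\<bar> \<le> e * N h)"

lemma has_frechet_derivative_on_UNIV:
  fixes F :: "'x::real_normed_vector \<Rightarrow> real"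
  shows "has_frechet_derivative_on F D x UNIV norm \<longleftrightarrow> (F has_derivative D) (at x)"
proof -
  have "bounded_linear D \<longleftrightarrow> (\<forall>h k. D (h + k) = D h + D k) \<and> (\<forall>c h. D (c *\<^sub>R h) = c * D h) \<and>
      (\<exists>B. \<forall>h. \<bar>D h\<bar> \<le> B * norm h)"
    unfolding bounded_linear_def bounded_linear_axioms_def linear_iff
    by (simp add: mult.commute[of "norm _"])
  moreover have "(\<forall>y. norm (y - x) < d \<longrightarrow> \<bar>F y - F x - D (y - x)\<bar> \<le> e * norm (y - x)) \<longleftrightarrow>
      (\<forall>h. norm h < d \<longrightarrow> \<bar>F (x + h) - F x - D h\<bar> \<le> e * norm h)" (is "?L \<longleftrightarrow> ?R") for e d
  proof
    assume ?L
    then show ?R by (metis add_diff_cancel_left')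
  next
    assume ?R
    show ?L
    proof (intro allI impI)
      fix y assume "norm (y - x) < d"
      then have "\<bar>F (x + (y - x)) - F x - D (y - x)\<bar> \<le> e * norm (y - x)"
        using \<open>?R\<close> by blast
      then show "\<bar>F y - F x - D (y - x)\<bar> \<le> e * norm (y - x)" by simp
    qed
  qed
  ultimately show ?thesis
    unfolding has_frechet_derivative_on_def has_derivative_at_alt by simp
qed

definition continuously_differentiable :: "('x::real_normed_vector \<Rightarrow> real) \<Rightarrow> bool" where
  "continuously_differentiable F \<longleftrightarrow>
     (\<exists>F' :: 'x \<Rightarrow> ('x \<Rightarrow>\<^sub>L real). (\<forall>x. (F has_derivative blinfun_apply (F' x)) (at x))
        \<and> continuous_on UNIV F')"


section \<open>The constrained problem\<close>

definition convolve :: "(real^'d::finite \<Rightarrow> real) \<Rightarrow> (real^'d \<Rightarrow> real) \<Rightarrow> real^'d \<Rightarrow> real"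
    (infixr "\<star>" 75) where
  "(g \<star> h) x = (LINT y|lborel. g (x - y) * h y)"

definition gauss_kernel :: "real \<Rightarrow> real^'d::finite \<Rightarrow> real" where
  "gauss_kernel tau x = exp (- ((norm x)^2 / (2 * tau^2))) /
     ((2 * pi) powr (real CARD('d) / 2) * tau ^ CARD('d))"

definition I_fun :: "real \<Rightarrow> real \<Rightarrow> real" where
  "I_fun W \<xi> = W * \<xi>^2 * (\<xi> - 1)^2 * (\<xi> - 1/2) * indicator {0..1} \<xi>"

definition chi :: "real \<Rightarrow> real^'d::finite \<Rightarrow> real" where
  "chi psi z = sqrt ((norm z)^2 + psi^2)"

definition grad :: "'d::finite c10 \<Rightarrow> real^'d \<Rightarrow> real^'d" where
  "grad f x = (\<chi> i. pderiv_at i (c10_apply f) x)"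

(* emb realizes the elements of the abstract Hilbert space 'v as C^1 vector fields. *)
definition G_map ::
    "real \<Rightarrow> real \<Rightarrow> real \<Rightarrow> ('v \<Rightarrow> ('d::finite, real^'d) c1b) \<Rightarrow>
     'd c10 \<Rightarrow> (real^'d \<Rightarrow> real) \<Rightarrow> 'v \<Rightarrow> 'd c10" where
  "G_map W psi tau emb f u v = to_c10 (\<lambda>x.
     (gauss_kernel tau \<star> c10_apply f) x +
     (gauss_kernel tau \<star> (\<lambda>y. chi psi (grad f y) * u y - grad f y \<bullet> c1b_apply (emb v) y
                                 + I_fun W (c10_apply f y))) x)"

definition energy ::
    "real \<Rightarrow> real \<Rightarrow> real \<Rightarrow> nat \<Rightarrow> ('d::finite c10 \<Rightarrow> real) \<Rightarrow>
     (nat \<Rightarrow> 'd c10) \<Rightarrow> (nat \<Rightarrow> real^'d \<Rightarrow> real) \<Rightarrow> (nat \<Rightarrow> 'v::real_normed_vector) \<Rightarrow> real" where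
  "energy p r Ctop T U f u v =
     1 / real T * (\<Sum>k=1..T-1. Ctop * Lr_norm r (u k) powr p + norm (v k) powr p) + U (f T)"

definition feasible ::
    "real \<Rightarrow> real \<Rightarrow> real \<Rightarrow> real \<Rightarrow> nat \<Rightarrow> (real^'d::finite \<Rightarrow> real) \<Rightarrow>
     ('v::real_normed_vector \<Rightarrow> ('d, real^'d) c1b) \<Rightarrow>
     (nat \<Rightarrow> 'd c10) \<Rightarrow> (nat \<Rightarrow> real^'d \<Rightarrow> real) \<Rightarrow> (nat \<Rightarrow> 'v) \<Rightarrow> bool" where
  "feasible r W psi tau T f0 emb f u v \<longleftrightarrow>
     f \<in> Q_space T \<and> u \<in> U_space r T \<and> v \<in> V_space T \<and>
     f 1 = to_c10 (gauss_kernel tau \<star> f0) \<and>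
     (\<forall>k\<in>{1..T-1}. f (k + 1) = G_map W psi tau emb (f k) (u k) (v k))"

definition constrained_minimizer ::
    "real \<Rightarrow> real \<Rightarrow> real \<Rightarrow> real \<Rightarrow> real \<Rightarrow> real \<Rightarrow> nat \<Rightarrow>
     (real^'d::finite \<Rightarrow> real) \<Rightarrow> ('d c10 \<Rightarrow> real) \<Rightarrow>
     ('v::real_normed_vector \<Rightarrow> ('d, real^'d) c1b) \<Rightarrow>
     (nat \<Rightarrow> 'd c10) \<Rightarrow> (nat \<Rightarrow> real^'d \<Rightarrow> real) \<Rightarrow> (nat \<Rightarrow> 'v) \<Rightarrow> bool" where
  "constrained_minimizer p r Ctop W psi tau T f0 U emb f u v \<longleftrightarrow>
     feasible r W psi tau T f0 emb f u v \<and>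
     (\<forall>f' u' v'. feasible r W psi tau T f0 emb f' u' v' \<longrightarrow>
        energy p r Ctop T U f u v \<le> energy p r Ctop T U f' u' v')"

definition lagrangian ::
    "real \<Rightarrow> real \<Rightarrow> real \<Rightarrow> real \<Rightarrow> real \<Rightarrow> real \<Rightarrow> nat \<Rightarrow>
     (real^'d::finite \<Rightarrow> real) \<Rightarrow> ('d c10 \<Rightarrow> real) \<Rightarrow>
     ('v::real_normed_vector \<Rightarrow> ('d, real^'d) c1b) \<Rightarrow>
     (nat \<Rightarrow> 'd c10) \<Rightarrow> (nat \<Rightarrow> real^'d \<Rightarrow> real) \<Rightarrow> (nat \<Rightarrow> 'v) \<Rightarrow>
     (nat \<Rightarrow> ('d c10 \<Rightarrow>\<^sub>L real)) \<Rightarrow> real" where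
  "lagrangian p r Ctop W psi tau T f0 U emb f u v l =
     1 / real T * (\<Sum>k=1..T-1. Ctop * Lr_norm r (u k) powr p + norm (v k) powr p) + U (f T)
     + (\<Sum>k=2..T. blinfun_apply (l k) (f k - G_map W psi tau emb (f (k-1)) (u (k-1)) (v (k-1))))
     + blinfun_apply (l 1) (f 1 - to_c10 (gauss_kernel tau \<star> f0))"

definition critical_point ::
    "real \<Rightarrow> nat \<Rightarrow>
     ((nat \<Rightarrow> 'd::finite c10) \<Rightarrow> (nat \<Rightarrow> real^'d \<Rightarrow> real) \<Rightarrow> (nat \<Rightarrow> 'v::real_normed_vector) \<Rightarrow>
        (nat \<Rightarrow> ('d c10 \<Rightarrow>\<^sub>L real)) \<Rightarrow> real) \<Rightarrow>
     (nat \<Rightarrow> 'd c10) \<Rightarrow> (nat \<Rightarrow> real^'d \<Rightarrow> real) \<Rightarrow> (nat \<Rightarrow> 'v) \<Rightarrow>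
     (nat \<Rightarrow> ('d c10 \<Rightarrow>\<^sub>L real)) \<Rightarrow> bool" where
  "critical_point r T L f u v l \<longleftrightarrow>
     f \<in> Q_space T \<and> u \<in> U_space r T \<and> v \<in> V_space T \<and> l \<in> Q_dual_space T \<and>
     has_frechet_derivative_on (\<lambda>f'. L f' u v l) (\<lambda>_. 0) f (Q_space T) (tuple_norm T norm) \<and>
     has_frechet_derivative_on (\<lambda>u'. L f u' v l) (\<lambda>_. 0) u (U_space r T) (tuple_norm (T - 1) (Lr_norm r)) \<and>
     has_frechet_derivative_on (\<lambda>v'. L f u v' l) (\<lambda>_. 0) v (V_space T) (tuple_norm (T - 1) norm) \<and>
     has_frechet_derivative_on (\<lambda>l'. L f u v l') (\<lambda>_. 0) l (Q_dual_space T) (tuple_norm T norm)"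

end

theory Submission
  imports Defs "HOL-Probability.Distributions"
begin

(* The multiplier is minus the derivative of the value function: with J_T = U and
   J_k(x) = J_(k+1)(G(x, u_k, v_k)) put lambda_k = - DJ_k(f_k). The chain rule for J_k is the adjoint
   recursion, that is, stationarity of the Lagrangian in f. Changing one control at time j and
   following the recursion afterwards shows that cost + J_(j+1) o G is minimal at (u_j, v_j), and its
   derivative there is that of the Lagrangian in (u_j, v_j).

   This needs G to be Frechet differentiable in f (in u and v it is affine) and, on L^r, the
   differentiability of ||u||^p. The former holds because the Gaussian is a kernel whose values,
   gradient and first-order Taylor remainder are all dominated by one integrable majorant M, so that
   the C^1 norm of a Gaussian convolution of g is at most sup (M * |g|). *)

section \<open>Functions vanishing at infinity in \<open>C\<^sup>1\<close>\<close>

text \<open>The controls determine the states, so the constraint is eliminated by running the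
  recursion; what remains is analytic. The density convolved in \<open>G\<close> contains
  \<open>grad f\<close>, which the \<open>C^1\<close> norm controls only in size: one derivative of
  \<open>f\<close> is lost, and the Gaussian gives it back, since a smoothed density is estimated in
  \<open>C^1\<close> by the size of the density alone. The density is also of mixed type:
  \<open>chi psi (grad f) * u\<close> has only the integrability of \<open>u\<close>, whereas the
  terms with the vector field and with \<open>I_fun\<close> are bounded and vanish at infinity. One
  class, \<open>conv_dom\<close>, holds both kinds; it is defined by size and decay of the
  convolution with \<open>M\<close>, and the decay is what puts results into \<open>C^1_0\<close>.
  Differentiability of \<open>G\<close> then reduces to pointwise quadratic bounds:
  \<open>psi > 0\<close> limits the curvature of \<open>chi psi\<close>, and the double zeros of the
  polynomial in \<open>I_fun\<close> at \<open>0\<close> and \<open>1\<close> make its truncation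
  harmless. Elements of \<open>L^r\<close> are representatives, so derivatives there are taken along
  a carrier with a seminorm, by chain rules with an affine inner map or a real outer
  function.\<close>

lemma C1_boundedI:
  fixes F :: "real^'d::finite \<Rightarrow> real" and D :: "real^'d \<Rightarrow> real^'d"
  assumes "\<And>x. (F has_derivative (\<lambda>h. D x \<bullet> h)) (at x)"
    and "continuous_on UNIV D" and "bounded (range F)" and "bounded (range D)"
  shows "F \<in> C1_bounded" and "pderiv_at i F x = D x $ i"
proof -
  have eq: "pderiv_at i F = (\<lambda>x. D x $ i)" for i
    by (simp add: pderiv_at_def fun_eq_iff inner_axis flip: frechet_derivative_at[OF assms(1)])
  have "bounded (range (\<lambda>x. D x $ i))" for i
    using bounded_linear_image[OF assms(4) bounded_linear_vec_nth[of i]] by (simp add: image_image)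
  then show "F \<in> C1_bounded"
    using assms by (auto simp: C1_bounded_def eq differentiable_def intro!: continuous_intros)
  show "pderiv_at i F x = D x $ i" by (simp add: eq)
qed

lemma has_derivative_pderiv_at:
  fixes f :: "real^'d::finite \<Rightarrow> real"
  assumes "f differentiable (at x)"
  shows "(f has_derivative (\<lambda>h. (\<chi> i. pderiv_at i f x) \<bullet> h)) (at x)"
proof -
  let ?D = "frechet_derivative f (at x)"
  have D: "(f has_derivative ?D) (at x)"
    using assms frechet_derivative_works by blast
  interpret bounded_linear ?D
    using D by (rule has_derivative_bounded_linear)
  have "?D h = (\<chi> i. pderiv_at i f x) \<bullet> h" for h
  proof -
    have "?D h = ?D (\<Sum>i\<in>UNIV. (h $ i) *\<^sub>R axis i 1)"
      by (simp add: basis_expansion flip: scalar_mult_eq_scaleR)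
    also have "\<dots> = (\<Sum>i\<in>UNIV. h $ i * pderiv_at i f x)"
      by (simp add: sum scaleR pderiv_at_def)
    finally show ?thesis
      by (simp add: inner_vec_def mult.commute)
  qed
  then have "?D = (\<lambda>h. (\<chi> i. pderiv_at i f x) \<bullet> h)" by auto
  with D show ?thesis by simp
qed

text \<open>The \<open>C^1\<close> norm is a maximum over partial derivatives, so the Euclidean
  length is bounded through the sum of its components; this is where the dimension enters all later
  constants.\<close>

lemma norm_grad_le:
  fixes f :: "'d::finite c10"
  shows "norm (grad f x) \<le> real CARD('d) * norm f"
proof -
  have "norm (grad f x) \<le> (\<Sum>i\<in>UNIV. \<bar>grad f x $ i\<bar>)"
    by (rule norm_le_l1_cart)
  also have "\<dots> \<le> (\<Sum>i\<in>(UNIV::'d set). norm f)"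
    using norm_c1b_bounds(2)[of _ "c1b_of_c10 f" x]
    by (intro sum_mono) (simp add: grad_def c10_apply_def norm_c10_def)
  finally show ?thesis by simp
qed

lemma continuous_c1b_apply: "continuous_on UNIV (c1b_apply h)"
  using c1b_differentiable[of h]
  by (auto intro!: differentiable_imp_continuous_on differentiable_at_withinI simp: differentiable_on_def)

text \<open>Squaring removes the kink of the positive part: at \<open>0\<close> the difference
  quotient is at most \<open>\<bar>h\<bar>\<close>. The cutoff below is \<open>C^1\<close> for this
  reason.\<close>

lemma has_derivative_max_0_power2:
  "((\<lambda>s::real. (max 0 s)\<^sup>2) has_real_derivative 2 * max 0 s) (at s)"
proof (cases s "0::real" rule: linorder_cases)
  case less
  have "((\<lambda>s::real. 0) has_real_derivative 2 * max 0 s) (at s)"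
    using less by simp
  then show ?thesis
    by (rule has_field_derivative_transform_within_open[where S = "{..<0}"])
      (use less in \<open>auto simp: max_def\<close>)
next
  case greater
  have "((\<lambda>s::real. s\<^sup>2) has_real_derivative 2 * max 0 s) (at s)"
    using greater by (auto intro!: derivative_eq_intros)
  then show ?thesis
    by (rule has_field_derivative_transform_within_open[where S = "{0<..}"])
      (use greater in \<open>auto simp: max_def\<close>)
next
  case equal
  have "((\<lambda>h::real. (max 0 h)\<^sup>2 / h) \<longlongrightarrow> 0) (at 0)"
  proof (rule Lim_null_comparison)
    show "\<forall>\<^sub>F h in at (0::real). norm ((max 0 h)\<^sup>2 / h) \<le> \<bar>h\<bar>"
      by (auto simp: max_def power2_eq_square intro!: always_eventually)
    show "((\<lambda>h::real. \<bar>h\<bar>) \<longlongrightarrow> 0) (at 0)"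
      by (auto intro!: tendsto_eq_intros)
  qed
  then show ?thesis
    using equal by (simp add: DERIV_def)
qed

text \<open>The cutoff is the square of the positive part of \<open>1 - |x|\<^sup>2 / R\<^sup>2\<close>: it is \<open>C\<^sup>1\<close>,
  supported in the ball of radius \<open>R\<close>, has gradient of order \<open>1 / R\<close>, and is within
  \<open>2 R\<^sub>0\<^sup>2 / R\<^sup>2\<close> of \<open>1\<close> where the function is not yet small.\<close>

lemma C10_space_if_vanishing:
  fixes h :: "('d::finite, real) c1b"
  assumes 0: "(c1b_apply h \<longlongrightarrow> 0) at_infinity"
    and 1: "\<And>i. (pderiv_at i (c1b_apply h) \<longlongrightarrow> 0) at_infinity"
  shows "h \<in> C10_space"
  unfolding C10_space_def closure_approachable
proof safe
  fix e :: real assume e: "e > 0"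
  let ?h = "c1b_apply h" and ?B = "norm h"
  let ?D = "\<lambda>x. \<chi> i. pderiv_at i ?h x"
  have "\<forall>\<^sub>F x in at_infinity. norm (pderiv_at i ?h x) \<le> e/4" for i
    using e by (intro eventually_mono[OF tendstoD[OF 1[of i], of "e/4"]]) auto
  then have "\<forall>\<^sub>F x in at_infinity. \<forall>i. norm (pderiv_at i ?h x) \<le> e/4"
    by (rule eventually_all_finite)
  moreover have "\<forall>\<^sub>F x in at_infinity. norm (?h x) \<le> e/4"
    using e tendstoD[OF 0, of "e/4"] by (auto elim!: eventually_mono)
  ultimately have "\<forall>\<^sub>F x in at_infinity. norm (?h x) \<le> e/4 \<and> (\<forall>i. norm (pderiv_at i ?h x) \<le> e/4)"
    by eventually_elim simp
  then obtain R0 where R0: "norm (?h x) \<le> e/4" "norm (pderiv_at i ?h x) \<le> e/4"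
    if "R0 \<le> norm x" for x i
    unfolding eventually_at_infinity by blast
  \<comment> \<open>The two quotients serve the two error terms: the first makes
    \<open>2 * R0^2 / R * ?B\<close> at most \<open>e / 4\<close>, the second does the same for
    \<open>?B * (4 / R)\<close>, which comes from the gradient of the cutoff.
    \<open>R \<ge> 1\<close> allows \<open>R^2\<close> to be replaced by \<open>R\<close>.\<close>
  define R where "R = max 1 (max (8 * R0\<^sup>2 * ?B / e) (16 * ?B / e))"
  have R: "R \<ge> 1" "8 * R0\<^sup>2 * ?B \<le> e * R" "16 * ?B \<le> e * R"
    using e by (auto simp: R_def field_simps max_def)
  have RR: "R \<le> R\<^sup>2" using R by (simp add: power2_eq_square)
  define s where "s x = max 0 (1 - (x \<bullet> x) / R\<^sup>2)" for x :: "real^'d"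
  define phi where "phi x = (s x)\<^sup>2" for x
  define Dphi where "Dphi x = (- 4 / R\<^sup>2 * s x) *\<^sub>R x" for x
  have s: "0 \<le> s x" "s x \<le> 1" for x
    using R by (auto simp: s_def)
  have phi: "0 \<le> phi x" "phi x \<le> 1" for x
    using s[of x] by (auto simp: phi_def power_le_one)
  have phi_low: "1 - phi x \<le> 2 * (norm x)\<^sup>2 / R\<^sup>2" for x
  proof -
    have "1 - (norm x)\<^sup>2 / R\<^sup>2 \<le> s x" by (simp add: s_def power2_norm_eq_inner)
    moreover have "1 - 2 * (1 - s x) \<le> phi x"
      using zero_le_power2[of "s x - 1"] unfolding phi_def by (simp add: power2_eq_square algebra_simps)
    ultimately show ?thesis by (simp add: field_simps)
  qed
  have s_0: "s x = 0" if "norm x \<ge> R" for x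
    using that R power_mono[of R "norm x" 2]
    by (auto simp: s_def power2_norm_eq_inner field_simps max_def)
  have Dphi_le: "norm (Dphi x) \<le> 4 / R" for x
  proof (cases "norm x \<ge> R")
    case True
    then show ?thesis using R by (simp add: Dphi_def s_0)
  next
    case False
    have "norm (Dphi x) = 4 / R\<^sup>2 * (s x * norm x)"
      using s[of x] by (simp add: Dphi_def abs_mult)
    also have "\<dots> \<le> 4 / R\<^sup>2 * (1 * R)"
      using s[of x] False R by (intro mult_left_mono mult_mono) auto
    also have "\<dots> = 4 / R" by (simp add: power2_eq_square)
    finally show ?thesis .
  qed
  have D_phi: "(phi has_derivative (\<lambda>k. Dphi x \<bullet> k)) (at x)" for x
  proof -
    have "((\<lambda>x. 1 - (x \<bullet> x) / R\<^sup>2) has_derivative (\<lambda>k. - (2 * (x \<bullet> k)) / R\<^sup>2)) (at x)"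
      using R by (auto intro!: derivative_eq_intros
          simp: inner_commute fun_eq_iff field_simps power2_eq_square power4_eq_xxxx)
    from has_derivative_compose[OF this
        has_derivative_max_0_power2[unfolded has_field_derivative_def]]
    have "(phi has_derivative (\<lambda>k. 2 * s x * (- (2 * (x \<bullet> k)) / R\<^sup>2))) (at x)"
      by (simp add: phi_def[abs_def] s_def mult.commute)
    then show ?thesis
      by (rule has_derivative_eq_rhs) (simp add: Dphi_def fun_eq_iff)
  qed
  let ?E = "\<lambda>x. phi x *\<^sub>R ?D x + ?h x *\<^sub>R Dphi x"
  have D_prod: "((\<lambda>x. phi x * ?h x) has_derivative (\<lambda>k. ?E x \<bullet> k)) (at x)" for x
    using has_derivative_mult[OF D_phi has_derivative_pderiv_at[OF c1b_differentiable[of h x]]]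
    by (simp add: inner_add_left algebra_simps)
  \<comment> \<open>Values and partial derivatives of \<open>h\<close> go through the same
    dichotomy: beyond \<open>R0\<close> the number \<open>w\<close> is small, and within
    \<open>R0\<close> the factor \<open>1 - phi x\<close> is.\<close>
  have split_le: "\<bar>(1 - phi x) * w\<bar> \<le> e/4" if "\<bar>w\<bar> \<le> ?B" "R0 \<le> norm x \<Longrightarrow> \<bar>w\<bar> \<le> e/4" for x w
  proof (cases "R0 \<le> norm x")
    case True
    have "(1 - phi x) * \<bar>w\<bar> \<le> 1 * \<bar>w\<bar>"
      using phi[of x] by (intro mult_right_mono) auto
    then show ?thesis
      using that True phi[of x] by (simp add: abs_mult)
  next
    case False
    then have "(norm x)\<^sup>2 \<le> R0\<^sup>2"
      by (intro power_mono) auto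
    then have "1 - phi x \<le> 2 * R0\<^sup>2 / R\<^sup>2"
      using R by (intro order_trans[OF phi_low] divide_right_mono) auto
    also have "\<dots> \<le> 2 * R0\<^sup>2 / R"
      using R RR by (intro divide_left_mono) auto
    finally have "(1 - phi x) * \<bar>w\<bar> \<le> 2 * R0\<^sup>2 / R * ?B"
      using that phi[of x] R by (intro mult_mono) auto
    also have "\<dots> \<le> e / 4"
      using R by (simp add: field_simps)
    finally show ?thesis
      using phi[of x] by (simp add: abs_mult)
  qed
  have cont: "continuous_on UNIV ?E"
    using c1b_apply[of h] R unfolding C1_bounded_def phi_def Dphi_def s_def
    by (auto intro!: continuous_intros continuous_on_vec_lambda continuous_c1b_apply)
  have norm_D: "norm (?D x) \<le> real CARD('d) * ?B" for x
  proof -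
    have "norm (?D x) \<le> (\<Sum>i\<in>UNIV. \<bar>?D x $ i\<bar>)"
      by (rule norm_le_l1_cart)
    also have "\<dots> \<le> (\<Sum>i\<in>(UNIV::'d set). ?B)"
      using norm_c1b_bounds(2)[of _ h x] by (intro sum_mono) simp
    finally show ?thesis by simp
  qed
  have bdd: "bounded (range (\<lambda>x. phi x * ?h x))"
  proof (rule boundedI, clarify)
    fix x
    show "norm (phi x * ?h x) \<le> 1 * ?B"
      unfolding norm_mult using phi[of x] norm_c1b_bounds(1)[of h x] by (intro mult_mono) auto
  qed
  have bdd': "bounded (range ?E)"
  proof (rule boundedI, clarify)
    fix x
    show "norm (?E x) \<le> 1 * (real CARD('d) * ?B) + ?B * (4 / R)"
      using phi[of x] norm_c1b_bounds(1)[of h x] norm_D[of x] Dphi_le[of x]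
      by (intro norm_triangle_mono; unfold norm_scaleR; intro mult_mono; simp)
  qed
  note y = C1_boundedI[OF D_prod cont bdd bdd']
  define y where "y = Abs_c1b (\<lambda>x. phi x * ?h x)"
  have y_apply: "c1b_apply y = (\<lambda>x. phi x * ?h x)"
    unfolding y_def using y(1) by (rule Abs_c1b_inverse)
  have "norm (y - h) \<le> e / 2"
    unfolding norm_c1b_le_iff
  proof (intro conjI allI)
    fix x
    have "norm (c1b_apply (y - h) x) = \<bar>(1 - phi x) * ?h x\<bar>"
      by (simp add: c1b_apply_diff y_apply algebra_simps abs_minus_commute)
    also have "\<dots> \<le> e / 4"
      using norm_c1b_bounds(1)[of h x] R0(1)[of x] by (intro split_le) auto
    finally show "norm (c1b_apply (y - h) x) \<le> e / 2" using e by simp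
  next
    fix i x
    have "c1b_apply (y - h) = c1b_apply (y + (-1) *\<^sub>R h)" by simp
    then have "pderiv_at i (c1b_apply (y - h)) x = ?E x $ i - pderiv_at i ?h x"
      by (simp only: pderiv_at_c1b_add pderiv_at_c1b_scaleR y_apply y(2)) simp
    also have "\<dots> = - ((1 - phi x) * pderiv_at i ?h x) + ?h x * Dphi x $ i"
      by (simp add: algebra_simps)
    finally have "norm (pderiv_at i (c1b_apply (y - h)) x) \<le>
        \<bar>(1 - phi x) * pderiv_at i ?h x\<bar> + \<bar>?h x * Dphi x $ i\<bar>"
      by simp
    also have "\<bar>(1 - phi x) * pderiv_at i ?h x\<bar> \<le> e / 4"
      using norm_c1b_bounds(2)[of i h x] R0(2)[of x i] by (intro split_le) auto
    also have "\<bar>?h x * Dphi x $ i\<bar> \<le> ?B * (4 / R)"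
      unfolding abs_mult
      using norm_c1b_bounds(1)[of h x] order_trans[OF component_le_norm_cart Dphi_le, of x i]
      by (intro mult_mono) auto
    also have "\<dots> \<le> e / 4"
      using R by (simp add: field_simps)
    finally show "norm (pderiv_at i (c1b_apply (y - h)) x) \<le> e / 2" by simp
  qed
  then have "dist y h < e"
    using e by (simp add: dist_norm)
  moreover have "{x. c1b_apply y x \<noteq> 0} \<subseteq> ball 0 R"
    using s_0 by (force simp: y_apply phi_def not_le)
  then have "compact (closure {x. c1b_apply y x \<noteq> 0})"
    using bounded_subset[OF bounded_ball] by auto
  ultimately show "\<exists>y\<in>{h. compact (closure {x. c1b_apply h x \<noteq> 0})}. dist y h < e"
    by blast
qed

text \<open>Outside a ball that contains the support of an approximant \<open>g\<close>, the value
  and the partial derivatives of \<open>f\<close> are at most the \<open>C^1\<close> distance from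
  \<open>f\<close> to \<open>g\<close>.\<close>

lemma c10_vanishing:
  fixes f :: "'d::finite c10"
  shows "(c10_apply f \<longlongrightarrow> 0) at_infinity"
    and "(grad f \<longlongrightarrow> 0) at_infinity"
proof -
  let ?f = "c1b_of_c10 f"
  have *: "\<exists>b. \<forall>x. b \<le> norm x \<longrightarrow> \<bar>c1b_apply ?f x\<bar> < e \<and> (\<forall>i. \<bar>pderiv_at i (c1b_apply ?f) x\<bar> < e)"
    if e: "e > 0" for e
  proof -
    obtain g where g: "compact (closure {x. c1b_apply g x \<noteq> 0})" "norm (g - ?f) < e"
      using c1b_of_c10[of f] e unfolding C10_space_def closure_approachable dist_norm by blast
    then obtain b where b: "\<And>x. c1b_apply g x \<noteq> 0 \<Longrightarrow> norm x \<le> b"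
      unfolding compact_closure bounded_iff by blast
    have *: "c1b_apply ?f x = c1b_apply g x + c1b_apply ((-1) *\<^sub>R (g - ?f)) x" for x
      by (simp add: c1b_apply_scaleR c1b_apply_diff)
    \<comment> \<open>The margin \<open>1\<close> puts \<open>x\<close> into the open complement of
      the closed ball, so \<open>g\<close> is zero near \<open>x\<close> and its derivative at
      \<open>x\<close> is zero too.\<close>
    have "\<bar>c1b_apply ?f x\<bar> < e \<and> (\<forall>i. \<bar>pderiv_at i (c1b_apply ?f) x\<bar> < e)" if x: "b + 1 \<le> norm x" for x
    proof (intro conjI allI)
      have "c1b_apply g x = 0" using b[of x] x by auto
      then show "\<bar>c1b_apply ?f x\<bar> < e"
        using norm_c1b_bounds(1)[of "g - ?f" x] g(2) by (simp add: c1b_apply_diff)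
      fix i
      have "((\<lambda>x. 0) has_derivative (\<lambda>x. 0)) (at x)" by simp
      then have "(c1b_apply g has_derivative (\<lambda>x. 0)) (at x)"
        by (rule has_derivative_transform_within_open[where s = "- cball 0 b"])
          (use b x in \<open>auto simp: open_Compl\<close>)
      then have "pderiv_at i (c1b_apply g) x = 0"
        by (simp add: pderiv_at_def flip: frechet_derivative_at)
      moreover have "?f = g + (-1) *\<^sub>R (g - ?f)" by simp
      then have "pderiv_at i (c1b_apply ?f) x =
          pderiv_at i (c1b_apply g) x - pderiv_at i (c1b_apply (g - ?f)) x"
        using pderiv_at_c1b_add[of i g "(-1) *\<^sub>R (g - ?f)" x] pderiv_at_c1b_scaleR[of i "-1" "g - ?f" x]
        by simp
      ultimately show "\<bar>pderiv_at i (c1b_apply ?f) x\<bar> < e"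
        using norm_c1b_bounds(2)[of i "g - ?f" x] g(2) by simp
    qed
    then show ?thesis by blast
  qed
  show "(c10_apply f \<longlongrightarrow> 0) at_infinity"
    unfolding tendsto_iff eventually_at_infinity c10_apply_def using * by force
  show "(grad f \<longlongrightarrow> 0) at_infinity"
    by (intro vec_tendstoI)
      (unfold tendsto_iff eventually_at_infinity grad_def c10_apply_def, use * in force)
qed

section \<open>Pointwise bounds, linearity and measurability of \<open>C^1_0\<close> functions and
  their gradients\<close>

lemma abs_c10_apply_le: "\<bar>c10_apply f x\<bar> \<le> norm f"
  using norm_c1b_bounds(1)[of "c1b_of_c10 f" x] by (simp add: c10_apply_def norm_c10_def)

lemma grad_add: "grad (f + g) x = grad f x + grad g x"
  by (simp add: vec_eq_iff grad_def c10_apply_def c1b_of_c10_add pderiv_at_c1b_add)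

lemma grad_scaleR: "grad (c *\<^sub>R f) x = c *\<^sub>R grad f x"
  by (simp add: vec_eq_iff grad_def c10_apply_def c1b_of_c10_scaleR pderiv_at_c1b_scaleR)

lemma c10_apply_add: "c10_apply (f + g) x = c10_apply f x + c10_apply g x"
  by (simp add: c10_apply_def c1b_of_c10_add c1b_apply_add)

lemma c10_apply_scaleR: "c10_apply (c *\<^sub>R f) x = c * c10_apply f x"
  by (simp add: c10_apply_def c1b_of_c10_scaleR c1b_apply_scaleR)

lemma borel_measurable_c1b_apply [measurable]: "c1b_apply h \<in> borel_measurable borel"
  by (intro borel_measurable_continuous_onI continuous_c1b_apply)

lemma borel_measurable_c10_apply [measurable]: "c10_apply h \<in> borel_measurable borel"
  unfolding c10_apply_def by measurable

lemma borel_measurable_grad [measurable]: "grad f \<in> borel_measurable borel"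
  using c1b_apply[of "c1b_of_c10 f"] unfolding grad_def c10_apply_def
  by (intro borel_measurable_continuous_onI continuous_on_vec_lambda) (simp add: C1_bounded_def)

section \<open>Convolution with a dominated \<open>C\<^sup>1\<close> kernel\<close>

text \<open>Dominated convergence speaks of sequences; this brings the decay of convolutions at
  infinity into its reach. If the limit fails at level \<open>e\<close>, points \<open>X n\<close>
  of norm at least \<open>n\<close> witness it.\<close>

lemma tendsto_at_infinity_sequentiallyI:
  fixes f :: "'a::real_normed_vector \<Rightarrow> 'b::metric_space"
  assumes "\<And>X. filterlim X at_infinity sequentially \<Longrightarrow> (\<lambda>n. f (X n)) \<longlonglongrightarrow> l"
  shows "(f \<longlongrightarrow> l) at_infinity"
proof (rule ccontr)
  assume "\<not> (f \<longlongrightarrow> l) at_infinity"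
  then obtain e where e: "e > 0" "\<And>b. \<exists>x. b \<le> norm x \<and> e \<le> dist (f x) l"
    unfolding tendsto_iff eventually_at_infinity by (auto simp: not_less)
  then have "\<forall>n::nat. \<exists>x. real n \<le> norm x \<and> e \<le> dist (f x) l" by blast
  then obtain X where X: "\<And>n::nat. real n \<le> norm (X n)" "\<And>n. e \<le> dist (f (X n)) l"
    unfolding choice_iff by blast
  have "filterlim X at_infinity sequentially"
    by (rule filterlim_norm_at_top_imp_at_infinity, rule filterlim_at_top_mono[OF filterlim_real_sequentially])
      (use X in auto)
  from tendstoD[OF assms[OF this] e(1)] have "\<exists>n. dist (f (X n)) l < e"
    using eventually_happens[of _ sequentially] by auto
  then show False using X(2) by (force simp: not_less[symmetric])
qed

lemma integrable_lborel_reflect_iff: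
  fixes f :: "'a::euclidean_space \<Rightarrow> 'b::{banach, second_countable_topology}"
  assumes "f \<in> borel_measurable borel"
  shows "integrable lborel (\<lambda>y. f (x - y)) \<longleftrightarrow> integrable lborel f"
    and "(LINT y|lborel. f (x - y)) = (LINT y|lborel. f y)"
proof -
  have eq: "lborel = distr lborel borel (\<lambda>y. x - y)"
    using lborel_affine[of "-1" x] by (simp add: density_1)
  show "integrable lborel (\<lambda>y. f (x - y)) \<longleftrightarrow> integrable lborel f"
    using assms by (subst (2) eq, subst integrable_distr_eq) auto
  show "(LINT y|lborel. f (x - y)) = (LINT y|lborel. f y)"
    using assms by (subst (2) eq, subst integral_distr) auto
qed

text \<open>If \<open>f\<close> is not integrable, its integral is \<open>0\<close> by convention,
  and the right side is nonnegative because \<open>g\<close> dominates a norm.\<close>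

lemma norm_integral_le_integral:
  fixes f :: "'a \<Rightarrow> 'b::{banach, second_countable_topology}"
  assumes "integrable N g" and le: "\<And>x. norm (f x) \<le> g x"
  shows "norm (integral\<^sup>L N f) \<le> integral\<^sup>L N g"
proof (cases "integrable N f")
  case True
  have "norm (integral\<^sup>L N f) \<le> (LINT x|N. norm (f x))" by (rule integral_norm_bound)
  also have "\<dots> \<le> integral\<^sup>L N g" using True assms by (intro integral_mono) auto
  finally show ?thesis .
next
  case False
  have "0 \<le> g x" for x using order_trans[OF norm_ge_zero le] .
  then show ?thesis using False by (simp add: not_integrable_integral_eq)
qed

text \<open>The bound \<open>Mmax\<close> makes \<open>M\<close> times an integrable
  \<open>\<bar>u\<bar> powr r\<close> integrable, and \<open>M_lim\<close> makes the convolution of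
  the two decay. Increments are limited to norm \<open>1\<close> because a decaying
  \<open>M z\<close> cannot control \<open>K\<close> at a point \<open>z + h\<close> that is allowed
  to return to the origin from far away.\<close>

locale C1_kernel =
  fixes K :: "real^'d::finite \<Rightarrow> real" and gK :: "real^'d \<Rightarrow> real^'d"
    and M :: "real^'d \<Rightarrow> real" and Mmax :: real
  assumes measurable_K [measurable]: "K \<in> borel_measurable borel"
    and measurable_gK [measurable]: "gK \<in> borel_measurable borel"
    and measurable_M [measurable]: "M \<in> borel_measurable borel"
    and M_nonneg: "0 \<le> M z" and M_le: "M z \<le> Mmax"
    and integrable_M: "integrable lborel M" and M_lim: "(M \<longlongrightarrow> 0) at_infinity"
    and K_le: "\<bar>K z\<bar> \<le> M z" and gK_le: "norm (gK z) \<le> M z"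
    and K_Taylor: "norm h \<le> 1 \<Longrightarrow> \<bar>K (z + h) - K z - gK z \<bullet> h\<bar> \<le> (norm h)\<^sup>2 * M z"
    and gK_Lipschitz: "norm h \<le> 1 \<Longrightarrow> norm (gK (z + h) - gK z) \<le> norm h * M z"
begin

definition mass :: "(real^'d \<Rightarrow> real) \<Rightarrow> real^'d \<Rightarrow> real" where
  "mass g x = (LINT y|lborel. M (x - y) * \<bar>g y\<bar>)"

text \<open>A common domain for \<open>L^r\<close> functions and for bounded functions that vanish
  at infinity. The bound on \<open>mass g\<close> yields membership of the convolution in
  \<open>C1_bounded\<close>, its decay yields \<open>C10_space\<close>.\<close>

definition conv_dom :: "(real^'d \<Rightarrow> real) set" where
  "conv_dom = {g \<in> borel_measurable borel. (\<forall>x. integrable lborel (\<lambda>y. M (x - y) * \<bar>g y\<bar>))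
     \<and> bdd_above (range (mass g)) \<and> (mass g \<longlongrightarrow> 0) at_infinity}"

definition smoothing :: "(real^'d \<Rightarrow> real) \<Rightarrow> 'd c10" where
  "smoothing g = to_c10 (K \<star> g)"

lemma M_shift: "integrable lborel (\<lambda>y. M (x - y))" "(LINT y|lborel. M (x - y)) = integral\<^sup>L lborel M"
  by (simp_all add: integrable_lborel_reflect_iff integrable_M)

lemma mass_nonneg: "0 \<le> mass g x"
  unfolding mass_def by (intro integral_nonneg_AE) (simp add: M_nonneg)

lemma conv_dom_measurable [measurable_dest]: "g \<in> conv_dom \<Longrightarrow> g \<in> borel_measurable borel"
  by (simp add: conv_dom_def)

lemma integrable_conv_dom: "g \<in> conv_dom \<Longrightarrow> integrable lborel (\<lambda>y. M (x - y) * \<bar>g y\<bar>)"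
  by (simp add: conv_dom_def)

lemma mass_le_SUP: "g \<in> conv_dom \<Longrightarrow> mass g x \<le> (SUP x. mass g x)"
  by (intro cSUP_upper) (auto simp: conv_dom_def)

text \<open>The class is solid, so products with bounded factors inherit membership from a pointwise
  estimate. Sums are handled through \<open>\<bar>g y\<bar> + \<bar>k y\<bar>\<close>, whose mass is
  exactly additive.\<close>

lemma conv_dom_dominated:
  assumes g: "g \<in> conv_dom" and k [measurable]: "k \<in> borel_measurable borel"
    and le: "\<And>y. \<bar>k y\<bar> \<le> c * \<bar>g y\<bar>"
  shows "k \<in> conv_dom" and "mass k x \<le> c * mass g x"
proof -
  note [measurable] = conv_dom_measurable[OF g]
  have le': "M z * \<bar>k y\<bar> \<le> c * (M z * \<bar>g y\<bar>)" for y z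
    using mult_left_mono[OF le M_nonneg, of z y] by (simp add: mult_ac)
  have int: "integrable lborel (\<lambda>y. M (x - y) * \<bar>k y\<bar>)" for x
    by (rule Bochner_Integration.integrable_bound[OF
          integrable_mult_right[OF integrable_conv_dom[OF g], of c x]])
      (use le' M_nonneg in \<open>auto intro!: AE_I2 order_trans[OF le'] mult_right_mono abs_ge_self simp: abs_mult\<close>)
  have mass: "mass k x \<le> c * mass g x" for x
  proof -
    have "mass k x \<le> (LINT y|lborel. c * (M (x - y) * \<bar>g y\<bar>))"
      unfolding mass_def by (intro integral_mono int integrable_mult_right integrable_conv_dom g le')
    then show ?thesis by (simp add: mass_def)
  qed
  obtain B where B: "\<And>x. mass g x \<le> B"
    using mass_le_SUP[OF g] by blast
  have "mass k x \<le> \<bar>c\<bar> * B" for x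
    using mass[of x] B[of x] mass_nonneg[of g x]
    by (smt (verit) mult_mono abs_ge_self abs_ge_zero)
  moreover have "(mass k \<longlongrightarrow> 0) at_infinity"
  proof (rule Lim_null_comparison)
    show "\<forall>\<^sub>F x in at_infinity. norm (mass k x) \<le> c * mass g x"
      using mass mass_nonneg by (auto intro!: always_eventually)
    show "((\<lambda>x. c * mass g x) \<longlongrightarrow> 0) at_infinity"
      using g tendsto_mult_right_zero by (auto simp: conv_dom_def)
  qed
  ultimately show "k \<in> conv_dom"
    using int by (auto simp: conv_dom_def bdd_above_def)
  show "mass k x \<le> c * mass g x" by (rule mass)
qed

lemma conv_dom_add:
  assumes g: "g \<in> conv_dom" and k: "k \<in> conv_dom"
  shows "(\<lambda>y. \<bar>g y\<bar> + \<bar>k y\<bar>) \<in> conv_dom" and "mass (\<lambda>y. \<bar>g y\<bar> + \<bar>k y\<bar>) x = mass g x + mass k x"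
    and "(\<lambda>y. g y + k y) \<in> conv_dom"
proof -
  note [measurable] = conv_dom_measurable[OF g] conv_dom_measurable[OF k]
  have eq: "mass (\<lambda>y. \<bar>g y\<bar> + \<bar>k y\<bar>) x = mass g x + mass k x" for x
    using integrable_conv_dom[OF g, of x] integrable_conv_dom[OF k, of x]
    by (simp add: mass_def distrib_left)
  obtain B B' where "\<And>x. mass g x \<le> B" "\<And>x. mass k x \<le> B'"
    using mass_le_SUP g k by meson
  then have "mass g x + mass k x \<le> B + B'" for x
    by (simp add: add_mono)
  moreover have "((\<lambda>x. mass g x + mass k x) \<longlongrightarrow> 0 + 0) at_infinity"
    using g k by (intro tendsto_add) (auto simp: conv_dom_def)
  ultimately show dom: "(\<lambda>y. \<bar>g y\<bar> + \<bar>k y\<bar>) \<in> conv_dom"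
    using integrable_conv_dom[OF g] integrable_conv_dom[OF k]
    by (auto simp: conv_dom_def eq[abs_def] bdd_above_def distrib_left)
  show "(\<lambda>y. g y + k y) \<in> conv_dom"
    by (rule conv_dom_dominated(1)[OF dom, where c = 1]) auto
  show "mass (\<lambda>y. \<bar>g y\<bar> + \<bar>k y\<bar>) x = mass g x + mass k x" by (rule eq)
qed

lemma conv_dom_mult_bounded:
  assumes "g \<in> conv_dom" "a \<in> borel_measurable borel" "\<And>y. \<bar>a y\<bar> \<le> c"
  shows "(\<lambda>y. a y * g y) \<in> conv_dom"
  using assms by (intro conv_dom_dominated(1)[OF assms(1), where c = c])
    (auto simp: abs_mult intro: mult_right_mono)

lemma conv_dom_diff: "g \<in> conv_dom \<Longrightarrow> k \<in> conv_dom \<Longrightarrow> (\<lambda>y. g y - k y) \<in> conv_dom"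
  using conv_dom_add(3)[OF _ conv_dom_mult_bounded[of k "\<lambda>_. -1" 1], of g] by simp

lemma conv_dom_scale: "g \<in> conv_dom \<Longrightarrow> (\<lambda>y. c * g y) \<in> conv_dom"
  using conv_dom_mult_bounded[of g "\<lambda>_. c" "\<bar>c\<bar>"] by simp

text \<open>Reflection moves \<open>x\<close> from the kernel into \<open>g\<close>. The integrand
  is then dominated by the fixed function \<open>b * M z\<close> and tends to \<open>0\<close>
  pointwise as \<open>x\<close> escapes to infinity.\<close>

lemma conv_dom_if_bounded_vanishing:
  assumes g [measurable]: "g \<in> borel_measurable borel"
    and b: "\<And>y. \<bar>g y\<bar> \<le> b" and lim: "(g \<longlongrightarrow> 0) at_infinity"
  shows "g \<in> conv_dom" and "mass g x \<le> b * integral\<^sup>L lborel M"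
proof -
  have le: "M z * \<bar>g y\<bar> \<le> b * M z" for z y
    using mult_left_mono[OF b M_nonneg] by (simp add: mult.commute)
  have int: "integrable lborel (\<lambda>y. M (x - y) * \<bar>g y\<bar>)" for x
    by (rule Bochner_Integration.integrable_bound[OF integrable_mult_right[OF M_shift(1)[of x], of b]])
      (use M_nonneg in \<open>auto intro!: AE_I2 order_trans[OF le] mult_right_mono abs_ge_self simp: abs_mult\<close>)
  have mass_le: "mass g x \<le> b * integral\<^sup>L lborel M" for x
    using integral_mono[OF int integrable_mult_right[OF M_shift(1)[of x], of b] le] M_shift(2)
    by (simp add: mass_def)
  have mass_eq: "mass g x = (LINT z|lborel. M z * \<bar>g (x - z)\<bar>)" for x
    using integrable_lborel_reflect_iff(2)[of "\<lambda>z. M z * \<bar>g (x - z)\<bar>" x] by (simp add: mass_def)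
  have "(mass g \<longlongrightarrow> 0) at_infinity"
  proof (rule tendsto_at_infinity_sequentiallyI)
    fix X :: "nat \<Rightarrow> real^'d" assume X: "filterlim X at_infinity sequentially"
    have "(\<lambda>n. LINT z|lborel. M z * \<bar>g (X n - z)\<bar>) \<longlonglongrightarrow> (LINT z::real^'d|lborel. 0)"
    proof (rule integral_dominated_convergence)
      show "integrable lborel (\<lambda>z. b * M z)" by (simp add: integrable_M)
      show "AE z in lborel. norm (M z * \<bar>g (X n - z)\<bar>) \<le> b * M z" for n
        using le M_nonneg by (auto simp: abs_mult)
      show "AE z in lborel. (\<lambda>n. M z * \<bar>g (X n - z)\<bar>) \<longlonglongrightarrow> 0"
      proof (rule AE_I2)
        fix z
        have "filterlim (\<lambda>n. X n - z) at_infinity sequentially"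
          using tendsto_add_filterlim_at_infinity'[OF X tendsto_const, of "-z"] by simp
        from filterlim_compose[OF lim this]
        show "(\<lambda>n. M z * \<bar>g (X n - z)\<bar>) \<longlonglongrightarrow> 0"
          by (intro tendsto_mult_right_zero tendsto_rabs_zero)
      qed
    qed auto
    then show "(\<lambda>n. mass g (X n)) \<longlonglongrightarrow> 0" by (simp add: mass_eq)
  qed
  then show "g \<in> conv_dom"
    using int mass_le by (auto simp: conv_dom_def bdd_above_def)
  show "mass g x \<le> b * integral\<^sup>L lborel M" by (rule mass_le)
qed

section \<open>Regularity of the convolution and linearity of \<open>smoothing\<close>\<close>

lemma
  assumes g: "g \<in> conv_dom"
  shows integrable_K_mult: "integrable lborel (\<lambda>y. K (x - y) * g y)"
    and integrable_gK_scaleR: "integrable lborel (\<lambda>y. g y *\<^sub>R gK (x - y))"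
    and abs_convolve_le: "\<bar>(K \<star> g) x\<bar> \<le> mass g x"
    and norm_convolve_gK_le: "norm (LINT y|lborel. g y *\<^sub>R gK (x - y)) \<le> mass g x"
proof -
  note [measurable] = conv_dom_measurable[OF g]
  have le: "norm (K (x - y) * g y) \<le> M (x - y) * \<bar>g y\<bar>" for y
    using K_le[of "x - y"] by (simp add: abs_mult mult_right_mono)
  have le': "norm (g y *\<^sub>R gK (x - y)) \<le> M (x - y) * \<bar>g y\<bar>" for y
    using gK_le[of "x - y"] by (simp add: mult_left_mono mult.commute)
  show "integrable lborel (\<lambda>y. K (x - y) * g y)"
    by (rule Bochner_Integration.integrable_bound[OF integrable_conv_dom[OF g, of x]])
      (simp, rule AE_I2, rule order_trans[OF le], simp add: abs_mult M_nonneg)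
  show "integrable lborel (\<lambda>y. g y *\<^sub>R gK (x - y))"
    by (rule Bochner_Integration.integrable_bound[OF integrable_conv_dom[OF g, of x]])
      (simp, rule AE_I2, rule order_trans[OF le'], simp add: abs_mult M_nonneg)
  show "\<bar>(K \<star> g) x\<bar> \<le> mass g x"
    unfolding convolve_def mass_def
    by (subst real_norm_def[symmetric], rule norm_integral_le_integral) (fact integrable_conv_dom[OF g] le)+
  show "norm (LINT y|lborel. g y *\<^sub>R gK (x - y)) \<le> mass g x"
    unfolding mass_def by (rule norm_integral_le_integral) (fact integrable_conv_dom[OF g] le')+
qed

text \<open>Differentiation under the integral takes the form of integrating the pointwise kernel
  estimates at \<open>x - y\<close> against \<open>\<bar>g y\<bar>\<close>: the increment
  \<open>h\<close> moves only the argument of the kernel, so the majorant \<open>M (x - y)\<close>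
  is the same for every \<open>h\<close> of norm at most \<open>1\<close>.\<close>

lemma
  assumes g: "g \<in> conv_dom" and h: "norm h \<le> 1"
  shows convolve_Taylor: "\<bar>(K \<star> g) (x + h) - (K \<star> g) x - (LINT y|lborel. g y *\<^sub>R gK (x - y)) \<bullet> h\<bar>
      \<le> (norm h)\<^sup>2 * mass g x"
    and convolve_gK_Lipschitz: "norm ((LINT y|lborel. g y *\<^sub>R gK (x + h - y)) - (LINT y|lborel. g y *\<^sub>R gK (x - y)))
      \<le> norm h * mass g x"
proof -
  note [measurable] = conv_dom_measurable[OF g]
  note int = integrable_conv_dom[OF g, of x]
  note int_K = integrable_K_mult[OF g] and int_gK = integrable_gK_scaleR[OF g]
  let ?e = "\<lambda>y. (K (x - y + h) - K (x - y) - gK (x - y) \<bullet> h) * g y"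
  have "?e = (\<lambda>y. K (x + h - y) * g y - K (x - y) * g y - (g y *\<^sub>R gK (x - y)) \<bullet> h)"
    by (auto simp: algebra_simps)
  moreover note integrable_inner_left[OF int_gK[of x], of h] integral_inner_left[OF int_gK[of x], of h]
  ultimately have "integrable lborel ?e" and "(K \<star> g) (x + h) - (K \<star> g) x - (LINT y|lborel. g y *\<^sub>R gK (x - y)) \<bullet> h
      = (LINT y|lborel. ?e y)"
    using int_K[of "x + h"] int_K[of x] int_gK[of x] by (simp_all add: convolve_def del: inner_scaleR_left)
  moreover have "norm (?e y) \<le> (norm h)\<^sup>2 * (M (x - y) * \<bar>g y\<bar>)" for y
    using mult_right_mono[OF K_Taylor[OF h, of "x - y"], of "\<bar>g y\<bar>"] by (simp add: abs_mult mult_ac)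
  ultimately have "norm (LINT y|lborel. ?e y) \<le> (LINT y|lborel. (norm h)\<^sup>2 * (M (x - y) * \<bar>g y\<bar>))"
    using int by (intro norm_integral_le_integral) auto
  then show "\<bar>(K \<star> g) (x + h) - (K \<star> g) x - (LINT y|lborel. g y *\<^sub>R gK (x - y)) \<bullet> h\<bar>
      \<le> (norm h)\<^sup>2 * mass g x"
    by (simp add: \<open>_ = (LINT y|lborel. ?e y)\<close> mass_def)
  let ?d = "\<lambda>y. g y *\<^sub>R (gK (x - y + h) - gK (x - y))"
  have "?d = (\<lambda>y. g y *\<^sub>R gK (x + h - y) - g y *\<^sub>R gK (x - y))"
    by (auto simp: algebra_simps)
  then have "integrable lborel ?d" and "(LINT y|lborel. g y *\<^sub>R gK (x + h - y)) - (LINT y|lborel. g y *\<^sub>R gK (x - y))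
      = (LINT y|lborel. ?d y)"
    using int_gK[of "x + h"] int_gK[of x] by simp_all
  moreover have "norm (?d y) \<le> norm h * (M (x - y) * \<bar>g y\<bar>)" for y
    using mult_left_mono[OF gK_Lipschitz[OF h, of "x - y"], of "\<bar>g y\<bar>"] by (simp add: mult_ac)
  ultimately have "norm (LINT y|lborel. ?d y) \<le> (LINT y|lborel. norm h * (M (x - y) * \<bar>g y\<bar>))"
    using int by (intro norm_integral_le_integral) auto
  then show "norm ((LINT y|lborel. g y *\<^sub>R gK (x + h - y)) - (LINT y|lborel. g y *\<^sub>R gK (x - y)))
      \<le> norm h * mass g x"
    by (simp add: \<open>_ = (LINT y|lborel. ?d y)\<close> mass_def)
qed

text \<open>Ensures that \<open>to_c10\<close> is applied to a genuine element of
  \<open>C^1_0\<close>. The Taylor estimate identifies the gradient, the Lipschitz estimate makes it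
  continuous, and \<open>mass g\<close> dominates the function and its partial derivatives, which
  gives boundedness, decay and the norm bound together.\<close>

lemma
  assumes g: "g \<in> conv_dom"
  shows c10_apply_smoothing: "c10_apply (smoothing g) = K \<star> g"
    and norm_smoothing_le: "(\<And>x. mass g x \<le> b) \<Longrightarrow> norm (smoothing g) \<le> b"
proof -
  let ?F = "K \<star> g" and ?D = "\<lambda>x. LINT y|lborel. g y *\<^sub>R gK (x - y)"
  obtain B where B: "\<And>x. mass g x \<le> B"
    using mass_le_SUP[OF g] by blast
  have deriv: "(?F has_derivative (\<lambda>h. ?D x \<bullet> h)) (at x)" for x
    unfolding has_derivative_at_alt
  proof (intro conjI allI impI)
    fix e :: real assume e: "e > 0"
    \<comment> \<open>The entry \<open>1\<close> is the range of the kernel estimates; the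
      \<open>1\<close> added to the mass keeps the denominator positive.\<close>
    let ?d = "min 1 (e / (mass g x + 1))"
    have "norm (?F y - ?F x - ?D x \<bullet> (y - x)) \<le> e * norm (y - x)" if "norm (y - x) < ?d" for y
    proof -
      have "norm (?F y - ?F x - ?D x \<bullet> (y - x)) \<le> norm (y - x) * (norm (y - x) * (mass g x + 1))"
        using convolve_Taylor[OF g, of "y - x" x] that
        by (simp add: power2_eq_square distrib_left mult.assoc add_increasing2)
      also have "\<dots> \<le> norm (y - x) * e"
        using that mass_nonneg[of g x] by (intro mult_left_mono) (auto simp: field_simps)
      finally show ?thesis by (simp add: mult.commute)
    qed
    moreover have "?d > 0" using e mass_nonneg[of g x] by simp
    ultimately show "\<exists>d>0. \<forall>y. norm (y - x) < d \<longrightarrow>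
        norm (?F y - ?F x - ?D x \<bullet> (y - x)) \<le> e * norm (y - x)" by blast
  qed (rule bounded_linear_inner_right)
  have "isCont ?D x" for x
    unfolding continuous_at_eps_delta dist_norm
  proof (intro allI impI)
    fix e :: real assume e: "e > 0"
    let ?d = "min 1 (e / (mass g x + 1))"
    have "norm (?D y - ?D x) < e" if "norm (y - x) < ?d" for y
    proof -
      have "norm (?D y - ?D x) \<le> norm (y - x) * mass g x"
        using convolve_gK_Lipschitz[OF g, of "y - x" x] that by simp
      also have "\<dots> \<le> norm (y - x) * (mass g x + 1)"
        by (intro mult_left_mono) auto
      also have "\<dots> < e"
        using that mass_nonneg[of g x] by (auto simp: field_simps)
      finally show ?thesis .
    qed
    moreover have "?d > 0" using e mass_nonneg[of g x] by simp
    ultimately show "\<exists>d>0. \<forall>y. norm (y - x) < d \<longrightarrow> norm (?D y - ?D x) < e" by blast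
  qed
  then have cont: "continuous_on UNIV ?D" by (simp add: continuous_at_imp_continuous_on)
  have "bounded (range ?F)" "bounded (range ?D)"
    using order_trans[OF abs_convolve_le[OF g] B] order_trans[OF norm_convolve_gK_le[OF g] B]
    by (auto intro!: boundedI)
  note C1 = C1_boundedI[OF deriv cont this]
  define h where "h = Abs_c1b ?F"
  have h: "c1b_apply h = ?F" unfolding h_def using C1(1) by (rule Abs_c1b_inverse)
  have pd: "\<bar>pderiv_at i (c1b_apply h) x\<bar> \<le> mass g x" for i x
    unfolding h C1(2) by (rule order_trans[OF component_le_norm_cart norm_convolve_gK_le[OF g]])
  have lim: "(mass g \<longlongrightarrow> 0) at_infinity" using g by (simp add: conv_dom_def)
  have "h \<in> C10_space"
    by (intro C10_space_if_vanishing; rule Lim_null_comparison[OF _ lim])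
      (use abs_convolve_le[OF g] pd in \<open>auto simp: h intro!: always_eventually\<close>)
  then have eq: "c1b_of_c10 (smoothing g) = h"
    by (simp add: smoothing_def to_c10_def Abs_c10_inverse flip: h_def)
  then show "c10_apply (smoothing g) = ?F"
    by (simp add: c10_apply_def h)
  show "norm (smoothing g) \<le> b" if "\<And>x. mass g x \<le> b"
    using order_trans[OF abs_convolve_le[OF g] that] order_trans[OF pd that]
    by (simp add: norm_c10_def eq norm_c1b_le_iff h[symmetric])
qed

lemma c10_eqI: "(\<And>x. c10_apply f x = c10_apply g x) \<Longrightarrow> f = g"
  by (metis ext to_c10_apply)

lemma smoothing_add:
  assumes "g \<in> conv_dom" "k \<in> conv_dom"
  shows "smoothing (\<lambda>y. g y + k y) = smoothing g + smoothing k"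
  using integrable_K_mult[OF assms(1)] integrable_K_mult[OF assms(2)]
  by (intro c10_eqI)
    (simp add: c10_apply_add c10_apply_smoothing conv_dom_add assms convolve_def distrib_left)

lemma smoothing_scale:
  assumes "g \<in> conv_dom"
  shows "smoothing (\<lambda>y. c * g y) = c *\<^sub>R smoothing g"
  by (intro c10_eqI)
    (simp add: c10_apply_scaleR c10_apply_smoothing conv_dom_scale assms convolve_def mult.left_commute)

lemma smoothing_diff:
  assumes "g \<in> conv_dom" "k \<in> conv_dom"
  shows "smoothing (\<lambda>y. g y - k y) = smoothing g - smoothing k"
  using smoothing_add[OF assms(1) conv_dom_scale[OF assms(2), of "-1"]] smoothing_scale[OF assms(2), of "-1"]
  by simp

text \<open>Fits the densities below, which split into a multiple of a control \<open>w\<close> and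
  a bounded part. Constants do not decay, so the bounded part has no majorant of its own kind in
  \<open>conv_dom\<close>; it enters through the integral of \<open>M\<close>, which is the same for
  every translate.\<close>

lemma norm_smoothing_dominated:
  assumes w: "w \<in> conv_dom" and k: "k \<in> conv_dom" and b: "0 \<le> b" "0 \<le> c"
    and le: "\<And>y. \<bar>k y\<bar> \<le> c * \<bar>w y\<bar> + b"
  shows "norm (smoothing k) \<le> c * (SUP x. mass w x) + b * integral\<^sup>L lborel M"
proof (rule norm_smoothing_le[OF k])
  fix x
  note [measurable] = conv_dom_measurable[OF k]
  have "M (x - y) * \<bar>k y\<bar> \<le> c * (M (x - y) * \<bar>w y\<bar>) + b * M (x - y)" for y
    using mult_left_mono[OF le M_nonneg, of "x - y" y] by (simp add: algebra_simps)
  then have "mass k x \<le> (LINT y|lborel. c * (M (x - y) * \<bar>w y\<bar>) + b * M (x - y))"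
    unfolding mass_def
    by (intro integral_mono integrable_conv_dom k) (simp_all add: integrable_conv_dom w M_shift)
  also have "\<dots> = c * mass w x + b * integral\<^sup>L lborel M"
    by (simp add: integrable_conv_dom w M_shift mass_def)
  also have "\<dots> \<le> c * (SUP x. mass w x) + b * integral\<^sup>L lborel M"
    using b mass_le_SUP[OF w, of x] by (intro add_right_mono mult_left_mono) auto
  finally show "mass k x \<le> c * (SUP x. mass w x) + b * integral\<^sup>L lborel M" .
qed

text \<open>Instead of Hoelder's inequality we integrate \<open>a \<le> t + t\<^sup>1\<^sup>-\<^sup>r a\<^sup>r\<close> and let \<open>t\<close> decrease to the
  norm of \<open>u\<close>; this includes norm \<open>0\<close> and yields decay at infinity by letting \<open>t\<close> tend to \<open>0\<close>.\<close>

lemma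
  assumes u: "u \<in> Lr_space r" and r: "1 < r"
  shows conv_dom_if_Lr: "u \<in> conv_dom"
    and mass_le_Lr_norm: "mass u x \<le> (integral\<^sup>L lborel M + Mmax) * Lr_norm r u"
proof -
  have [measurable]: "u \<in> borel_measurable borel" and int_P: "integrable lborel (\<lambda>y. \<bar>u y\<bar> powr r)"
    using u by (auto simp: Lr_space_def)
  let ?P = "\<lambda>y. \<bar>u y\<bar> powr r" and ?m = "integral\<^sup>L lborel M"
  define q where "q x = (LINT y|lborel. M (x - y) * ?P y)" for x
  have Mmax: "0 \<le> Mmax" using order_trans[OF M_nonneg M_le] .
  have le_P: "M z * ?P y \<le> Mmax * ?P y" for z y
    by (intro mult_right_mono M_le) simp
  have int_MP: "integrable lborel (\<lambda>y. M (x - y) * ?P y)" for x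
    by (rule Bochner_Integration.integrable_bound[OF integrable_mult_right[OF int_P, of Mmax]])
      (simp, rule AE_I2, use le_P M_nonneg Mmax in \<open>simp add: abs_mult\<close>)
  have q_le: "q x \<le> Mmax * (LINT y|lborel. ?P y)" for x
    using integral_mono[OF int_MP integrable_mult_right[OF int_P, of Mmax] le_P] by (simp add: q_def)
  have "(q \<longlongrightarrow> 0) at_infinity"
  proof (rule tendsto_at_infinity_sequentiallyI)
    fix X :: "nat \<Rightarrow> real^'d" assume X: "filterlim X at_infinity sequentially"
    have "(\<lambda>n. LINT y|lborel. M (X n - y) * ?P y) \<longlonglongrightarrow> (LINT y::real^'d|lborel. 0)"
    proof (rule integral_dominated_convergence)
      show "integrable lborel (\<lambda>y. Mmax * ?P y)" using int_P by simp
      show "AE y in lborel. norm (M (X n - y) * ?P y) \<le> Mmax * ?P y" for n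
        using le_P M_nonneg by (auto simp: abs_mult)
      show "AE y in lborel. (\<lambda>n. M (X n - y) * ?P y) \<longlonglongrightarrow> 0"
      proof (rule AE_I2)
        fix y
        have "filterlim (\<lambda>n. X n - y) at_infinity sequentially"
          using tendsto_add_filterlim_at_infinity'[OF X tendsto_const, of "-y"] by simp
        from filterlim_compose[OF M_lim this]
        show "(\<lambda>n. M (X n - y) * ?P y) \<longlonglongrightarrow> 0"
          by (rule tendsto_mult_left_zero)
      qed
    qed auto
    then show "(\<lambda>n. q (X n)) \<longlonglongrightarrow> 0" by (simp add: q_def)
  qed
  have pointwise: "a \<le> t + t powr (1 - r) * a powr r" if "0 < t" "0 \<le> a" for a t :: real
  proof (cases "a \<le> t")
    case False
    then have "1 \<le> (a / t) powr (r - 1)"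
      using that r by (intro ge_one_powr_ge_zero) auto
    then have "a \<le> a * (a / t) powr (r - 1)"
      using that by (simp add: mult_le_cancel_left1)
    also have "\<dots> = t powr (1 - r) * a powr r"
      using that False by (simp add: powr_divide powr_diff field_simps)
    finally show ?thesis using that by simp
  qed (use that in \<open>simp add: add_increasing2\<close>)
  have le: "M z * \<bar>u y\<bar> \<le> t * M z + t powr (1 - r) * (M z * ?P y)" if "0 < t" for z y t
    using mult_left_mono[OF pointwise[OF that, of "\<bar>u y\<bar>"] M_nonneg[of z]] by (simp add: algebra_simps)
  have int: "integrable lborel (\<lambda>y. M (x - y) * \<bar>u y\<bar>)" for x
    by (rule Bochner_Integration.integrable_bound[of _ "\<lambda>y. 1 * M (x - y) + 1 powr (1 - r) * (M (x - y) * ?P y)"])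
      (use M_shift(1) int_MP le[of 1] M_nonneg in \<open>auto simp: abs_mult\<close>)
  have mass_le: "mass u x \<le> t * ?m + t powr (1 - r) * q x" if "0 < t" for t x
  proof -
    have "mass u x \<le> (LINT y|lborel. t * M (x - y) + t powr (1 - r) * (M (x - y) * ?P y))"
      unfolding mass_def using le[OF that] int by (intro integral_mono) (auto simp: M_shift int_MP)
    then show ?thesis by (simp add: M_shift int_MP q_def)
  qed
  have m: "0 \<le> ?m" by (simp add: M_nonneg)
  have "(mass u \<longlongrightarrow> 0) at_infinity"
  proof (rule tendstoI)
    fix e :: real assume e: "e > 0"
    \<comment> \<open>This \<open>t\<close> puts the first term of \<open>mass_le\<close> below
      \<open>e / 2\<close> for all \<open>x\<close>; with \<open>t\<close> fixed, the second term
      tends to \<open>0\<close> along with \<open>q\<close>.\<close>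
    define t where "t = e / (2 * (?m + 1))"
    have t: "t > 0" "t * ?m < e / 2" using e m by (auto simp: t_def field_simps)
    have "((\<lambda>x. t powr (1 - r) * q x) \<longlongrightarrow> 0) at_infinity"
      using \<open>(q \<longlongrightarrow> 0) at_infinity\<close> by (rule tendsto_mult_right_zero)
    then have "\<forall>\<^sub>F x in at_infinity. dist (t powr (1 - r) * q x) 0 < e / 2"
      by (rule tendstoD) (use e in simp)
    then show "\<forall>\<^sub>F x in at_infinity. dist (mass u x) 0 < e"
    proof eventually_elim
      case (elim x)
      then have "t powr (1 - r) * q x < e / 2" by (simp add: abs_less_iff)
      then show ?case using mass_le[OF t(1), of x] t(2) mass_nonneg[of u x] by simp
    qed
  qed
  moreover have "mass u x \<le> ?m + Mmax * (LINT y|lborel. ?P y)" for x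
    using mass_le[of 1 x] q_le[of x] by simp
  ultimately show "u \<in> conv_dom"
    using int by (auto simp: conv_dom_def bdd_above_def)
  define N where "N = Lr_norm r u"
  have N: "0 \<le> N" "N powr r = (LINT y|lborel. ?P y)"
    using r by (simp_all add: N_def Lr_norm_def powr_powr)
  show "mass u x \<le> (?m + Mmax) * Lr_norm r u"
  proof (rule field_le_epsilon)
    fix e :: real assume e: "e > 0"
    \<comment> \<open>The slack keeps \<open>t\<close> positive when the norm \<open>N\<close> is
      \<open>0\<close>, and it costs at most \<open>e\<close> after multiplication by
      \<open>?m + Mmax\<close>.\<close>
    define t where "t = N + e / (?m + Mmax + 1)"
    have t: "t > 0" "N \<le> t" using e m Mmax N by (auto simp: t_def add_nonneg_pos)
    have "mass u x \<le> t * ?m + t powr (1 - r) * q x" by (rule mass_le[OF t(1)])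
    also have "\<dots> \<le> t * ?m + t powr (1 - r) * (Mmax * t powr r)"
      using q_le[of x] powr_mono2[OF _ N(1) t(2), of r] r Mmax N(2)
      by (intro add_left_mono mult_left_mono order_trans[OF q_le] mult_left_mono) auto
    also have "\<dots> = (?m + Mmax) * t"
      using t by (simp add: powr_diff field_simps)
    also have "\<dots> \<le> (?m + Mmax) * N + e"
      using e m Mmax by (simp add: t_def field_simps)
    finally show "mass u x \<le> (?m + Mmax) * Lr_norm r u + e" by (simp add: N_def)
  qed
qed

end

section \<open>The Gaussian kernel\<close>

text \<open>The integrand factors over the coordinates into one-dimensional Gaussians, each a
  multiple of the normal density with variance \<open>1 / (2 * c)\<close>.\<close>

lemma integrable_exp_neg_norm_power2:
  fixes c :: real
  assumes c: "0 < c"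
  shows "integrable lborel (\<lambda>x::'a::euclidean_space. exp (- (c * (norm x)\<^sup>2)))"
proof -
  have 1: "integrable lborel (\<lambda>x::real. exp (- (c * x\<^sup>2)))"
  proof -
    have "integrable lborel (\<lambda>x. sqrt (2 * pi * (sqrt (1 / (2 * c)))\<^sup>2) * normal_density 0 (sqrt (1 / (2 * c))) x)"
      using c by (intro integrable_mult_right integrable_normal_density) simp
    moreover have "sqrt (2 * pi * (sqrt (1 / (2 * c)))\<^sup>2) * normal_density 0 (sqrt (1 / (2 * c))) x = exp (- (c * x\<^sup>2))" for x
      using c by (simp add: normal_density_def mult.commute)
    ultimately show ?thesis by simp
  qed
  have prod: "exp (- (c * (norm (\<Sum>b\<in>Basis. f b *\<^sub>R b :: 'a))\<^sup>2)) = (\<Prod>b\<in>Basis. exp (- (c * (f b)\<^sup>2)))"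
    for f :: "'a \<Rightarrow> real"
  proof -
    have "(norm (\<Sum>b\<in>Basis. f b *\<^sub>R b :: 'a))\<^sup>2 = (\<Sum>b\<in>Basis. (f b)\<^sup>2)"
      unfolding power2_norm_eq_inner by (subst euclidean_inner) (simp add: power2_eq_square)
    then show ?thesis
      by (simp only: sum_distrib_left flip: sum_negf exp_sum[OF finite_Basis])
  qed
  interpret product_sigma_finite "\<lambda>_::'a. lborel :: real measure" by standard
  show ?thesis
    unfolding lborel_eq[where 'a='a]
    using product_integrable_prod[OF finite_Basis, of "\<lambda>_ x. exp (- (c * x\<^sup>2))"] 1
    by (subst integrable_distr_eq) (simp_all add: prod)
qed

text \<open>Gradient and Hessian are polynomials times the Gaussian. Half of the rate
  \<open>c\<close> absorbs the polynomial (\<open>lin_exp\<close>), and half of the remaining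
  \<open>c / 2\<close> pays for passing from \<open>w\<close> to a point \<open>z\<close> within
  distance \<open>1\<close>: \<open>(norm z)^2 \<le> 2 * (norm w)^2 + 2\<close> costs the factor
  \<open>exp (c / 2)\<close>. This gives the rate \<open>c / 4\<close>. In \<open>4 + 8 * c\<close>
  the \<open>8 * c\<close> is what the Hessian requires; the same number also covers the value and
  the gradient.\<close>

lemma C1_kernel_gaussian:
  fixes A c :: real
  assumes A: "0 < A" and c: "0 < c"
  defines "B \<equiv> A * (4 + 8 * c) * exp (c / 2)"
  shows "C1_kernel (\<lambda>z::real^'d::finite. A * exp (- (c * (norm z)\<^sup>2)))
    (\<lambda>z. - (2 * c * (A * exp (- (c * (norm z)\<^sup>2)))) *\<^sub>R z)
    (\<lambda>z. B * exp (- (c / 4 * (norm z)\<^sup>2))) B"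
proof -
  let ?E = "\<lambda>z::real^'d. A * exp (- (c * (norm z)\<^sup>2))"
  let ?g = "\<lambda>z::real^'d. - (2 * c * ?E z) *\<^sub>R z"
  let ?M = "\<lambda>z::real^'d. B * exp (- (c / 4 * (norm z)\<^sup>2))"
  have B: "0 < B" using A c by (simp add: B_def add_pos_pos)
  have lin_exp: "(1 + 2 * t) * exp (- t) \<le> 4 * exp (- (t / 2))" for t :: real
  proof -
    have "1 + 2 * t \<le> 4 * exp (t / 2)" using exp_ge_add_one_self[of "t / 2"] exp_ge_zero[of "t / 2"] by linarith
    then have "(1 + 2 * t) * exp (- t) \<le> 4 * exp (t / 2) * exp (- t)" by (intro mult_right_mono) auto
    also have "\<dots> = 4 * exp (t / 2 + - t)" unfolding exp_add by simp
    finally show ?thesis by simp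
  qed
  have le_M: "A * (4 + 8 * c) * exp (- (c / 2 * (norm w)\<^sup>2)) \<le> ?M z" if "norm (w - z) \<le> 1" for w z :: "real^'d"
  proof -
    have "(norm z)\<^sup>2 \<le> (norm w + norm (w - z))\<^sup>2"
      using norm_triangle_ineq4[of w "w - z"] by (intro power_mono) auto
    also have "\<dots> \<le> 2 * (norm w)\<^sup>2 + 2 * (norm (w - z))\<^sup>2"
      using sum_squares_bound[of "norm w" "norm (w - z)"] by (simp add: power2_sum)
    also have "\<dots> \<le> 2 * (norm w)\<^sup>2 + 2"
      using that by (simp add: power_le_one)
    finally have "c * (norm z)\<^sup>2 \<le> c * (2 * (norm w)\<^sup>2 + 2)"
      using c by (intro mult_left_mono) auto
    then have "- (c / 2 * (norm w)\<^sup>2) \<le> c / 2 + - (c / 4 * (norm z)\<^sup>2)" by (simp add: field_simps)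
    then have "exp (- (c / 2 * (norm w)\<^sup>2)) \<le> exp (c / 2) * exp (- (c / 4 * (norm z)\<^sup>2))"
      by (simp flip: exp_add)
    then show ?thesis
      using A c unfolding B_def by (simp add: mult.assoc mult_left_mono add_nonneg_nonneg)
  qed
  \<comment> \<open>The Hessian of \<open>?E\<close> at \<open>w\<close>, applied to
    \<open>h\<close>.\<close>
  define Dg where "Dg w h = - (2 * c * ?E w) *\<^sub>R h + (4 * c\<^sup>2 * ?E w * (w \<bullet> h)) *\<^sub>R w" for w h
  have D_E: "(?E has_derivative (\<lambda>h. ?g w \<bullet> h)) (at w)" for w
    unfolding power2_norm_eq_inner
    by (auto intro!: derivative_eq_intros simp: inner_commute algebra_simps)
  have D_g: "(?g has_derivative Dg w) (at w)" for w
  proof -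
    have "((\<lambda>w. - (2 * c * ?E w)) has_derivative (\<lambda>h. - (2 * c * (?g w \<bullet> h)))) (at w)"
      by (intro has_derivative_minus has_derivative_mult_right D_E)
    from has_derivative_scaleR[OF this has_derivative_ident]
    show ?thesis
      by (rule has_derivative_eq_rhs) (simp add: Dg_def power2_eq_square fun_eq_iff)
  qed
  have Dg_le: "norm (Dg w h) \<le> norm h * ?M z" if "norm (w - z) \<le> 1" for w z h
  proof -
    let ?t = "c * (norm w)\<^sup>2"
    have "norm (Dg w h) \<le> 2 * c * ?E w * norm h + 4 * c\<^sup>2 * ?E w * (norm w * norm h) * norm w"
      unfolding Dg_def using A c Cauchy_Schwarz_ineq2[of w h]
      by (intro norm_triangle_mono) (auto simp: abs_mult mult.assoc[symmetric] intro!: mult_right_mono mult_left_mono)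
    also have "\<dots> = norm h * (A * (2 * c) * ((1 + 2 * ?t) * exp (- ?t)))"
      by (simp add: power2_eq_square algebra_simps)
    also have "\<dots> \<le> norm h * (A * (2 * c) * (4 * exp (- (?t / 2))))"
      using A c by (intro mult_left_mono lin_exp) auto
    also have "\<dots> \<le> norm h * (A * (4 + 8 * c) * exp (- (c / 2 * (norm w)\<^sup>2)))"
      using A c by (intro mult_left_mono) (auto simp: field_simps)
    also have "\<dots> \<le> norm h * ?M z"
      by (intro mult_left_mono le_M that) auto
    finally show ?thesis .
  qed
  have M_nonneg: "0 \<le> ?M z" for z using B by simp
  have Lip: "norm (?g (z + h) - ?g z) \<le> norm h * ?M z" if h: "norm h \<le> 1" for z h
  proof (rule differentiable_bound_segment[where G = UNIV and f' = Dg])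
    fix t :: real assume "t \<in> {0..1}"
    then have "norm (z + t *\<^sub>R h - z) \<le> 1"
      using h mult_mono[of t 1 "norm h" 1] by auto
    then show "onorm (Dg (z + t *\<^sub>R h)) \<le> ?M z"
      using Dg_le[of "z + t *\<^sub>R h" z] M_nonneg by (intro onorm_bound) (auto simp: mult.commute)
  next
    show "(?g has_derivative Dg w) (at w within UNIV)" for w by (rule D_g)
  qed simp
  have K_Taylor: "\<bar>?E (z + h) - ?E z - ?g z \<bullet> h\<bar> \<le> (norm h)\<^sup>2 * ?M z" if h: "norm h \<le> 1" for z h
  proof -
    \<comment> \<open>Mean value inequality for \<open>?E\<close> minus its linear part at
      \<open>z\<close>. The derivative along the segment is \<open>?g w - ?g z\<close>, and
      \<open>Lip\<close> supplies the second factor \<open>norm h\<close>.\<close>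
    have "norm ((?E (z + h) - ?g z \<bullet> (z + h)) - (?E z - ?g z \<bullet> z)) \<le> norm h * (norm h * ?M z)"
    proof (rule differentiable_bound_segment[where G = UNIV and f' = "\<lambda>w k. ?g w \<bullet> k - ?g z \<bullet> k"])
      fix t :: real assume t: "t \<in> {0..1}"
      then have th: "norm (t *\<^sub>R h) \<le> norm h" by (simp add: mult_left_le_one_le)
      have "norm (?g (z + t *\<^sub>R h) - ?g z) \<le> norm (t *\<^sub>R h) * ?M z"
        using th h by (intro Lip) auto
      also have "\<dots> \<le> norm h * ?M z" using th M_nonneg by (rule mult_right_mono)
      finally have "norm (?g (z + t *\<^sub>R h) - ?g z) \<le> norm h * ?M z" .
      then have "norm ((?g (z + t *\<^sub>R h) - ?g z) \<bullet> k) \<le> norm h * ?M z * norm k" for k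
        unfolding real_norm_def by (rule order_trans[OF Cauchy_Schwarz_ineq2 mult_right_mono]) (rule norm_ge_zero)
      then show "onorm (\<lambda>k. ?g (z + t *\<^sub>R h) \<bullet> k - ?g z \<bullet> k) \<le> norm h * ?M z"
        unfolding inner_diff_left using M_nonneg[of z] by (intro onorm_bound mult_nonneg_nonneg[OF norm_ge_zero])
    next
      fix w
      show "((\<lambda>w. ?E w - ?g z \<bullet> w) has_derivative (\<lambda>k. ?g w \<bullet> k - ?g z \<bullet> k)) (at w within UNIV)"
        by (intro has_derivative_diff D_E bounded_linear_imp_has_derivative bounded_linear_inner_right)
    qed auto
    then show ?thesis by (simp add: inner_add_right power2_eq_square algebra_simps)
  qed
  show ?thesis
  proof
    fix z h :: "real^'d"
    let ?t = "c * (norm z)\<^sup>2"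
    show "0 \<le> ?M z" by (rule M_nonneg)
    show "?M z \<le> B" using B c by (simp add: mult_le_cancel_left2)
    show "integrable lborel ?M" using c by (intro integrable_mult_right integrable_exp_neg_norm_power2) auto
    have "filterlim (\<lambda>z::real^'d. c / 4 * (norm z)\<^sup>2) at_top at_infinity"
      using c by (intro filterlim_tendsto_pos_mult_at_top[OF tendsto_const] filterlim_pow_at_top filterlim_norm_at_top) auto
    then have "((\<lambda>z::real^'d. exp (- (c / 4 * (norm z)\<^sup>2))) \<longlongrightarrow> 0) at_infinity"
      by (intro filterlim_compose[OF exp_at_bot] filterlim_uminus_at_bot_at_top[THEN filterlim_compose])
    then show "(?M \<longlongrightarrow> 0) at_infinity" by (rule tendsto_mult_right_zero)
    have "?E z \<le> A * exp (- (c / 2 * (norm z)\<^sup>2))"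
      using A c by (simp add: mult_right_mono)
    also have "\<dots> \<le> A * (4 + 8 * c) * exp (- (c / 2 * (norm z)\<^sup>2))"
      using A c by (simp add: algebra_simps)
    also have "\<dots> \<le> ?M z" by (rule le_M) simp
    finally show "\<bar>?E z\<bar> \<le> ?M z" using A by simp
    have "norm (?g z) = A * (2 * c * norm z) * exp (- ?t)" using A c by simp
    \<comment> \<open>From \<open>2 * norm z \<le> 1 + (norm z)^2\<close> one gets
      \<open>2 * c * norm z \<le> c + ?t\<close>; the bound is spread over two copies of
      \<open>1 + 2 * ?t\<close> so that \<open>lin_exp\<close> applies to each.\<close>
    also have "\<dots> \<le> A * (c * ((1 + 2 * ?t) * exp (- ?t)) + (1 + 2 * ?t) * exp (- ?t)) "
    proof -
      have "2 * norm z \<le> 1 + (norm z)\<^sup>2" using sum_squares_bound[of 1 "norm z"] by simp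
      then have "c * (2 * norm z) \<le> c * (1 + (norm z)\<^sup>2)" using c by (intro mult_left_mono) auto
      then have "2 * c * norm z \<le> c + ?t" by (simp add: algebra_simps)
      also have "\<dots> \<le> c * (1 + 2 * ?t) + (1 + 2 * ?t)" using c by (simp add: algebra_simps)
      finally have "A * (2 * c * norm z) * exp (- ?t) \<le> A * (c * (1 + 2 * ?t) + (1 + 2 * ?t)) * exp (- ?t)"
        using A by (intro mult_right_mono mult_left_mono) auto
      then show ?thesis by (simp add: algebra_simps)
    qed
    also have "\<dots> \<le> A * (c * (4 * exp (- (?t / 2))) + 4 * exp (- (?t / 2)))"
      using A c by (intro mult_left_mono add_mono lin_exp) auto
    also have "\<dots> \<le> A * (4 + 8 * c) * exp (- (c / 2 * (norm z)\<^sup>2))"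
      using A c by (simp add: algebra_simps)
    also have "\<dots> \<le> ?M z" by (rule le_M) simp
    finally show "norm (?g z) \<le> ?M z" .
    show "norm h \<le> 1 \<Longrightarrow> \<bar>?E (z + h) - ?E z - ?g z \<bullet> h\<bar> \<le> (norm h)\<^sup>2 * ?M z" by (rule K_Taylor)
    show "norm h \<le> 1 \<Longrightarrow> norm (?g (z + h) - ?g z) \<le> norm h * ?M z" by (rule Lip)
  qed measurable
qed

section \<open>Calculus of Frechet derivatives on a carrier\<close>

lemma has_frechet_derivative_onD:
  assumes "has_frechet_derivative_on F D x X N" and "0 < e"
  obtains d where "0 < d" "\<And>h. h \<in> X \<Longrightarrow> N h < d \<Longrightarrow> \<bar>F (x + h) - F x - D h\<bar> \<le> e * N h"
  using assms unfolding has_frechet_derivative_on_def by meson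

text \<open>Agreement is asked only in directions from \<open>X\<close>. In
  \<open>multiplier_stationary\<close> a derivative is known to vanish on exactly these.\<close>

lemma has_frechet_derivative_on_cong:
  assumes "has_frechet_derivative_on F D x X N" and "subspace X"
    and "\<And>h. h \<in> X \<Longrightarrow> D' h = D h" and "\<And>h. h \<in> X \<Longrightarrow> F' (x + h) = F (x + h)"
  shows "has_frechet_derivative_on F' D' x X N"
proof -
  have "F' x = F x" using assms(4)[of 0] subspace_0[OF assms(2)] by simp
  then show ?thesis
    using assms unfolding has_frechet_derivative_on_def
    by (simp add: subspace_add subspace_scale cong: ball_cong)
qed

lemma has_frechet_derivative_on_const:
  assumes "\<And>h. 0 \<le> N h"
  shows "has_frechet_derivative_on (\<lambda>_. c) (\<lambda>_. 0) x X N"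
  unfolding has_frechet_derivative_on_def using assms by (auto intro!: exI[of _ 1])

lemma has_frechet_derivative_on_add:
  assumes F: "has_frechet_derivative_on F D x X N" and G: "has_frechet_derivative_on G E x X N"
  shows "has_frechet_derivative_on (\<lambda>y. F y + G y) (\<lambda>h. D h + E h) x X N"
  unfolding has_frechet_derivative_on_def
proof (intro conjI allI impI ballI)
  obtain B C where B: "\<And>h. h \<in> X \<Longrightarrow> \<bar>D h\<bar> \<le> B * N h" and C: "\<And>h. h \<in> X \<Longrightarrow> \<bar>E h\<bar> \<le> C * N h"
    using F G unfolding has_frechet_derivative_on_def by meson
  have "\<bar>D h + E h\<bar> \<le> (B + C) * N h" if "h \<in> X" for h
    using B[OF that] C[OF that] by (simp add: distrib_right)
  then show "\<exists>B. \<forall>h\<in>X. \<bar>D h + E h\<bar> \<le> B * N h" by blast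
next
  fix e :: real assume "0 < e"
  then have e: "0 < e / 2" by simp
  obtain d where d: "0 < d" "\<And>h. h \<in> X \<Longrightarrow> N h < d \<Longrightarrow> \<bar>F (x + h) - F x - D h\<bar> \<le> e / 2 * N h"
    using has_frechet_derivative_onD[OF F e] by metis
  obtain d' where d': "0 < d'" "\<And>h. h \<in> X \<Longrightarrow> N h < d' \<Longrightarrow> \<bar>G (x + h) - G x - E h\<bar> \<le> e / 2 * N h"
    using has_frechet_derivative_onD[OF G e] by metis
  have "\<bar>F (x + h) + G (x + h) - (F x + G x) - (D h + E h)\<bar> \<le> e * N h" if "h \<in> X" "N h < min d d'" for h
  proof -
    have "\<bar>F (x + h) - F x - D h\<bar> \<le> e / 2 * N h" "\<bar>G (x + h) - G x - E h\<bar> \<le> e / 2 * N h"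
      using d(2)[OF that(1)] d'(2)[OF that(1)] that(2) by simp_all
    then show ?thesis by linarith
  qed
  then show "\<exists>d>0. \<forall>h\<in>X. N h < d \<longrightarrow> \<bar>F (x + h) + G (x + h) - (F x + G x) - (D h + E h)\<bar> \<le> e * N h"
    using d(1) d'(1) by (intro exI[of _ "min d d'"]) auto
qed (use F G in \<open>auto simp: has_frechet_derivative_on_def algebra_simps\<close>)

lemma has_frechet_derivative_on_sum:
  assumes "finite S" and "\<And>h. 0 \<le> N h"
    and "\<And>i. i \<in> S \<Longrightarrow> has_frechet_derivative_on (F i) (D i) x X N"
  shows "has_frechet_derivative_on (\<lambda>y. \<Sum>i\<in>S. F i y) (\<lambda>h. \<Sum>i\<in>S. D i h) x X N"
  using assms(1,3)
  by (induction rule: finite_induct)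
    (simp_all add: has_frechet_derivative_on_const has_frechet_derivative_on_add assms(2))

lemma has_frechet_derivative_on_compose_real:
  assumes phi: "(phi has_real_derivative c) (at (F x))"
    and F: "has_frechet_derivative_on F D x X N" and N: "\<And>h. 0 \<le> N h"
  shows "has_frechet_derivative_on (\<lambda>y. phi (F y)) (\<lambda>h. c * D h) x X N"
  unfolding has_frechet_derivative_on_def
proof (intro conjI allI impI ballI)
  obtain B' where "\<And>h. h \<in> X \<Longrightarrow> \<bar>D h\<bar> \<le> B' * N h"
    using F unfolding has_frechet_derivative_on_def by meson
  then have B: "\<bar>D h\<bar> \<le> \<bar>B'\<bar> * N h" if "h \<in> X" for h
    using that N[of h] by (meson abs_ge_self mult_right_mono order_trans)
  define B where "B = \<bar>B'\<bar>"
  note B = B[folded B_def]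
  have B0: "0 \<le> B" by (simp add: B_def)
  have "\<bar>c * D h\<bar> \<le> \<bar>c\<bar> * B * N h" if "h \<in> X" for h
    using mult_left_mono[OF B[OF that], of "\<bar>c\<bar>"] by (simp add: abs_mult mult.assoc)
  then show "\<exists>B. \<forall>h\<in>X. \<bar>c * D h\<bar> \<le> B * N h" by blast
  fix e :: real assume e: "0 < e"
  \<comment> \<open>\<open>e1\<close> pays for the remainder of \<open>phi\<close>, where the
    increment of \<open>F\<close> is at most \<open>(B + 1) * N h\<close>; \<open>e2\<close> pays
    for the remainder of \<open>F\<close> multiplied by \<open>c\<close>. The cap
    \<open>e2 \<le> 1\<close> is the source of the \<open>1\<close> in \<open>B + 1\<close>.\<close>
  define e1 where "e1 = e / 2 / (B + 1)"
  define e2 where "e2 = min 1 (e / 2 / (\<bar>c\<bar> + 1))"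
  have e1: "0 < e1" using e B0 by (simp add: e1_def)
  have e1B: "e1 * (B + 1) = e / 2"
    using B0 by (intro nonzero_divide_eq_eq[THEN iffD1, OF _ e1_def[symmetric], symmetric]) auto
  have e2: "0 < e2" "e2 \<le> 1" using e by (auto simp: e2_def)
  have "e2 * (\<bar>c\<bar> + 1) \<le> e / 2"
    by (rule pos_le_divide_eq[THEN iffD1]) (auto simp: e2_def)
  then have ce2: "\<bar>c\<bar> * e2 \<le> e / 2"
    using e2(1) by (simp add: distrib_left mult.commute)
  obtain d1 where d1: "0 < d1" "\<And>s. \<bar>s - F x\<bar> < d1 \<Longrightarrow> \<bar>phi s - phi (F x) - c * (s - F x)\<bar> \<le> e1 * \<bar>s - F x\<bar>"
    using phi e1 unfolding has_field_derivative_def has_derivative_at_alt by force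
  obtain d2 where d2: "0 < d2" "\<And>h. h \<in> X \<Longrightarrow> N h < d2 \<Longrightarrow> \<bar>F (x + h) - F x - D h\<bar> \<le> e2 * N h"
    using has_frechet_derivative_onD[OF F e2(1)] by metis
  let ?d = "min d2 (d1 / (B + 1))"
  have "\<bar>phi (F (x + h)) - phi (F x) - c * D h\<bar> \<le> e * N h" if h: "h \<in> X" "N h < ?d" for h
  proof -
    let ?s = "F (x + h)"
    have r: "\<bar>?s - F x - D h\<bar> \<le> e2 * N h" using d2(2) h by simp
    also have "\<dots> \<le> 1 * N h" using e2 N by (intro mult_right_mono) auto
    finally have s: "\<bar>?s - F x\<bar> \<le> (B + 1) * N h"
      using B[OF h(1)] by (simp add: distrib_right)
    also have "\<dots> < d1" using h(2) B0 by (simp add: field_simps)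
    finally have "\<bar>phi ?s - phi (F x) - c * (?s - F x)\<bar> \<le> e1 * \<bar>?s - F x\<bar>" by (rule d1(2))
    also have "\<dots> \<le> e1 * ((B + 1) * N h)" using s e1 by (intro mult_left_mono) auto
    also have "\<dots> = e / 2 * N h" using e1B by (simp only: mult.assoc[symmetric])
    finally have 1: "\<bar>phi ?s - phi (F x) - c * (?s - F x)\<bar> \<le> e / 2 * N h" .
    have "\<bar>c * (?s - F x - D h)\<bar> \<le> \<bar>c\<bar> * (e2 * N h)"
      unfolding abs_mult using r by (intro mult_left_mono) auto
    also have "\<dots> \<le> e / 2 * N h"
      using mult_right_mono[OF ce2 N[of h]] by (simp only: mult.assoc)
    finally have 2: "\<bar>c * (?s - F x) - c * D h\<bar> \<le> e / 2 * N h" by (simp add: algebra_simps)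
    show ?thesis using 1 2 by linarith
  qed
  moreover have "0 < ?d" using d1 d2 B0 by simp
  ultimately show "\<exists>d>0. \<forall>h\<in>X. N h < d \<longrightarrow> \<bar>phi (F (x + h)) - phi (F x) - c * D h\<bar> \<le> e * N h" by blast
qed (use F in \<open>auto simp: has_frechet_derivative_on_def algebra_simps\<close>)

text \<open>The inner map enters through the equation \<open>F (x + h) = psi (y + B h)\<close>, so
  its derivative between the two carriers is just \<open>B\<close>. This fits \<open>G\<close>,
  which is affine in each control, and the projections of tuples.\<close>

lemma has_frechet_derivative_on_compose_linear:
  assumes psi: "has_frechet_derivative_on psi D y Y M" and X: "subspace X"
    and B: "\<And>h. h \<in> X \<Longrightarrow> B h \<in> Y" "\<And>h k. h \<in> X \<Longrightarrow> k \<in> X \<Longrightarrow> B (h + k) = B h + B k"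
      "\<And>c h. h \<in> X \<Longrightarrow> B (c *\<^sub>R h) = c *\<^sub>R B h" "\<And>h. h \<in> X \<Longrightarrow> M (B h) \<le> C * N h"
    and N: "\<And>h. 0 \<le> N h" and M: "\<And>h. 0 \<le> M h"
    and F: "\<And>h. h \<in> X \<Longrightarrow> F (x + h) = psi (y + B h)"
  shows "has_frechet_derivative_on F (\<lambda>h. D (B h)) x X N"
  unfolding has_frechet_derivative_on_def
proof (intro conjI allI impI ballI)
  have "B 0 = 0" using B(3)[OF subspace_0[OF X], of 0] by simp
  then have Fx: "F x = psi y" using F[OF subspace_0[OF X]] by simp
  define C' where "C' = \<bar>C\<bar>"
  have C': "0 \<le> C'" by (simp add: C'_def)
  have MB: "M (B h) \<le> C' * N h" if "h \<in> X" for h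
    unfolding C'_def using B(4)[OF that] N[of h] by (meson abs_ge_self mult_right_mono order_trans)
  obtain A where A: "\<And>k. k \<in> Y \<Longrightarrow> \<bar>D k\<bar> \<le> A * M k"
    using psi unfolding has_frechet_derivative_on_def by meson
  have "\<bar>D (B h)\<bar> \<le> \<bar>A\<bar> * C' * N h" if "h \<in> X" for h
  proof -
    have "\<bar>D (B h)\<bar> \<le> \<bar>A\<bar> * M (B h)"
      using A[OF B(1)[OF that]] M by (meson abs_ge_self mult_right_mono order_trans)
    also have "\<dots> \<le> \<bar>A\<bar> * (C' * N h)" by (intro mult_left_mono MB that) simp
    finally show ?thesis by (simp add: mult.assoc)
  qed
  then show "\<exists>A. \<forall>h\<in>X. \<bar>D (B h)\<bar> \<le> A * N h" by blast
  fix e :: real assume e: "0 < e"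
  define e' where "e' = e / (C' + 1)"
  have e': "0 < e'" "e' * (C' + 1) = e" using e C' by (simp_all add: e'_def)
  obtain d where d: "0 < d" "\<And>k. k \<in> Y \<Longrightarrow> M k < d \<Longrightarrow> \<bar>psi (y + k) - psi y - D k\<bar> \<le> e' * M k"
    using has_frechet_derivative_onD[OF psi e'(1)] by metis
  have "\<bar>F (x + h) - F x - D (B h)\<bar> \<le> e * N h" if h: "h \<in> X" "N h < d / (C' + 1)" for h
  proof -
    have MB': "M (B h) \<le> (C' + 1) * N h" using MB[OF h(1)] N[of h] by (simp add: distrib_right)
    also have "\<dots> < d" using h(2) C' by (simp add: field_simps)
    finally have "\<bar>F (x + h) - F x - D (B h)\<bar> \<le> e' * M (B h)"
      unfolding Fx F[OF h(1)] by (intro d(2) B(1) h)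
    also have "\<dots> \<le> e' * ((C' + 1) * N h)" using e' MB' by (intro mult_left_mono) auto
    also have "\<dots> = e * N h" using e'(2) by (simp only: mult.assoc[symmetric])
    finally show ?thesis .
  qed
  moreover have "0 < d / (C' + 1)" using d C' by simp
  ultimately show "\<exists>d>0. \<forall>h\<in>X. N h < d \<longrightarrow> \<bar>F (x + h) - F x - D (B h)\<bar> \<le> e * N h" by blast
qed (use psi B in \<open>auto simp: has_frechet_derivative_on_def\<close>)

text \<open>A step \<open>s *\<^sub>R h\<close> that is short for \<open>N\<close> shows, after
  division by \<open>s\<close>, that \<open>D h\<close> is at least \<open>- e\<close>; the
  direction \<open>- h\<close> gives the opposite sign.\<close>

lemma has_frechet_derivative_on_minimum:
  assumes F: "has_frechet_derivative_on F D x X N" and X: "subspace X"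
    and N: "\<And>h. 0 \<le> N h" "\<And>c h. h \<in> X \<Longrightarrow> N (c *\<^sub>R h) = \<bar>c\<bar> * N h"
    and min: "\<And>h. h \<in> X \<Longrightarrow> F x \<le> F (x + h)" and h: "h \<in> X"
  shows "D h = 0"
proof -
  have D: "D (c *\<^sub>R h) = c * D h" if "h \<in> X" for c h
    using F that by (auto simp: has_frechet_derivative_on_def)
  have "0 \<le> D h" if h: "h \<in> X" for h
  proof (rule field_le_epsilon)
    fix e :: real assume e: "0 < e"
    define e' where "e' = e / (N h + 1)"
    have e': "0 < e'" "e' * (N h + 1) = e" using e N(1)[of h] by (simp_all add: e'_def add_nonneg_pos)
    obtain d where d: "0 < d" "\<And>k. k \<in> X \<Longrightarrow> N k < d \<Longrightarrow> \<bar>F (x + k) - F x - D k\<bar> \<le> e' * N k"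
      using has_frechet_derivative_onD[OF F e'(1)] by metis
    define s where "s = d / 2 / (N h + 1)"
    have s: "0 < s" using d N(1)[of h] by (simp add: s_def add_nonneg_pos)
    have "s * (N h + 1) = d / 2"
      using N(1)[of h] by (intro nonzero_divide_eq_eq[THEN iffD1, OF _ s_def[symmetric], symmetric]) auto
    then have "s * N h < d" using s d(1) by (simp add: distrib_left)
    then have "\<bar>F (x + s *\<^sub>R h) - F x - D (s *\<^sub>R h)\<bar> \<le> e' * N (s *\<^sub>R h)"
      using s h by (intro d(2) subspace_scale X) (simp_all add: N(2))
    then have "- (e' * (s * N h)) \<le> s * D h"
      using min[OF subspace_scale[OF X h, of s]] s by (simp add: D[OF h] N(2)[OF h])
    then have "s * (- (e' * N h)) \<le> s * D h" by (simp add: mult_ac)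
    then have "- (e' * N h) \<le> D h" using s by (simp only: mult_le_cancel_left_pos)
    moreover have "e' * N h \<le> e" using e' by (simp add: distrib_left)
    ultimately show "0 \<le> D h + e" by simp
  qed
  from this[OF h] this[OF subspace_scale[OF X h, of "-1"]] show ?thesis
    using D[OF h, of "-1"] by simp
qed

text \<open>Away from \<open>0\<close> this is the chain rule with the Hilbert norm; at
  \<open>0\<close> the power \<open>p > 1\<close> is superlinear, so the derivative is
  \<open>0\<close>.\<close>

lemma has_derivative_norm_powr:
  fixes v :: "'v::real_inner"
  assumes p: "1 < p"
  shows "\<exists>D. ((\<lambda>v. norm v powr p) has_derivative D) (at v)"
proof (cases "v = 0")
  case True
  have "((\<lambda>v::'v. norm v powr p) has_derivative (\<lambda>_. 0)) (at 0)"
    unfolding has_derivative_at_alt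
  proof (intro conjI allI impI)
    fix e :: real assume e: "0 < e"
    define d where "d = e powr (1 / (p - 1))"
    have d: "0 < d" "d powr (p - 1) = e" using e p by (simp_all add: d_def powr_powr)
    have le: "norm (norm y powr p - norm (0::'v) powr p - 0) \<le> e * norm (y - 0)" if "norm (y - 0) < d" for y :: 'v
    proof (cases "y = 0")
      case False
      have "norm y powr p = norm y powr (p - 1) * norm y" using False by (simp add: powr_diff)
      also have "\<dots> \<le> d powr (p - 1) * norm y" using that p by (intro mult_right_mono powr_mono2) auto
      finally show ?thesis using p by (simp add: d)
    qed (use p in simp)
    show "\<exists>d>0. \<forall>y::'v. norm (y - 0) < d \<longrightarrow> norm (norm y powr p - norm (0::'v) powr p - 0) \<le> e * norm (y - 0)"
      by (intro exI[of _ d] conjI allI impI d(1) le)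
  qed simp
  then show ?thesis using True by blast
next
  case False
  from has_derivative_compose[OF has_derivative_norm[OF False]
      has_real_derivative_powr[of "norm v" p, unfolded has_field_derivative_def]] False
  show ?thesis by auto
qed

section \<open>The nonlinearities\<close>

lemma chi_pos: "0 < psi \<Longrightarrow> 0 < chi psi z"
  by (simp add: chi_def add_nonneg_pos)

lemma chi_ge: "0 < psi \<Longrightarrow> psi \<le> chi psi z"
  unfolding chi_def by (rule real_le_rsqrt) simp

lemma norm_le_chi: "norm z \<le> chi psi z"
  unfolding chi_def by (rule real_le_rsqrt) simp

lemma chi_le: "0 < psi \<Longrightarrow> chi psi z \<le> norm z + psi"
  unfolding chi_def by (intro real_le_lsqrt) (auto simp: power2_sum)

lemma chi_power2: "(chi psi z)\<^sup>2 = (norm z)\<^sup>2 + psi\<^sup>2"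
  by (simp add: chi_def)

lemma borel_measurable_chi [measurable]: "chi psi \<in> borel_measurable borel"
  unfolding chi_def by measurable

text \<open>\<open>chi psi a\<close> is the Euclidean norm of the pair \<open>(a, psi)\<close>.
  Cauchy-Schwarz for the pairs at \<open>a\<close> and \<open>a + b\<close> gives the lower bound
  (convexity), \<open>2 * ?c * ?c' \<le> ?c^2 + ?c'^2\<close> the upper one, and division by
  \<open>?c \<ge> psi\<close> finishes.\<close>

lemma chi_Taylor:
  assumes psi: "0 < psi"
  shows "\<bar>chi psi (a + b) - chi psi a - (a \<bullet> b) / chi psi a\<bar> \<le> (norm b)\<^sup>2 / (2 * psi)"
proof -
  let ?c = "chi psi a" and ?c' = "chi psi (a + b)"
  have c: "0 < ?c" "0 < ?c'" using psi by (simp_all add: chi_pos)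
  have sq: "?c'\<^sup>2 = ?c\<^sup>2 + 2 * (a \<bullet> b) + (norm b)\<^sup>2"
    by (simp add: chi_power2 power2_norm_eq_inner inner_add_left inner_add_right inner_commute)
  have upper: "?c * ?c' - ?c\<^sup>2 - a \<bullet> b \<le> (norm b)\<^sup>2 / 2"
    using sum_squares_bound[of ?c ?c'] sq by simp
  have "?c\<^sup>2 + a \<bullet> b \<le> ?c * ?c'"
  proof (rule power2_le_imp_le)
    have "?c\<^sup>2 + a \<bullet> b = (a, psi) \<bullet> (a + b, psi)"
      unfolding chi_power2
      by (simp add: inner_prod_def power2_norm_eq_inner inner_add_right power2_eq_square[of psi])
    then have "\<bar>?c\<^sup>2 + a \<bullet> b\<bar> \<le> norm (a, psi) * norm (a + b, psi)"
      using Cauchy_Schwarz_ineq2 by metis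
    also have "\<dots> = ?c * ?c'"
      by (simp add: norm_prod_def chi_def)
    finally show "(?c\<^sup>2 + a \<bullet> b)\<^sup>2 \<le> (?c * ?c')\<^sup>2"
      by (simp add: abs_le_square_iff[symmetric] c less_imp_le)
    show "0 \<le> ?c * ?c'" using c by simp
  qed
  with upper have "\<bar>?c * ?c' - ?c\<^sup>2 - a \<bullet> b\<bar> \<le> (norm b)\<^sup>2 / 2" by simp
  moreover have "?c' - ?c - (a \<bullet> b) / ?c = (?c * ?c' - ?c\<^sup>2 - a \<bullet> b) / ?c"
    using c by (simp add: field_simps power2_eq_square)
  ultimately have "\<bar>?c' - ?c - (a \<bullet> b) / ?c\<bar> \<le> (norm b)\<^sup>2 / 2 / ?c"
    by (simp only: abs_divide abs_of_pos[OF c(1)] divide_right_mono less_imp_le[OF c(1)])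
  also have "\<dots> \<le> (norm b)\<^sup>2 / 2 / psi"
    using psi chi_ge[OF psi] by (intro divide_left_mono) (auto simp: chi_pos)
  finally show ?thesis by simp
qed

section \<open>The truncated polynomial \<open>I_fun\<close> and its quadratic remainder\<close>

definition I_deriv :: "real \<Rightarrow> real \<Rightarrow> real" where
  "I_deriv W x = W * (x * (x - 1) * (5 * x\<^sup>2 - 5 * x + 1)) * indicator {0..1} x"

lemma borel_measurable_I_fun [measurable]: "I_fun W \<in> borel_measurable borel"
  unfolding I_fun_def by measurable

lemma borel_measurable_I_deriv [measurable]: "I_deriv W \<in> borel_measurable borel"
  unfolding I_deriv_def by measurable

context
  fixes x :: real
  assumes x: "0 \<le> x" "x \<le> 1"
begin

lemma abs_I_fun_unit_le: "\<bar>x\<^sup>2 * (x - 1)\<^sup>2 * (x - 1/2)\<bar> \<le> (x * (1 - x))\<^sup>2"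
proof -
  have "\<bar>x\<^sup>2 * (x - 1)\<^sup>2 * (x - 1/2)\<bar> = (x * (1 - x))\<^sup>2 * \<bar>x - 1/2\<bar>"
    by (simp add: abs_mult power_mult_distrib power2_commute)
  also have "\<dots> \<le> (x * (1 - x))\<^sup>2 * 1" using x by (intro mult_left_mono) auto
  finally show ?thesis by simp
qed

lemma abs_I_deriv_unit_le: "\<bar>x * (x - 1) * (5 * x\<^sup>2 - 5 * x + 1)\<bar> \<le> x * (1 - x)"
proof -
  have "\<bar>5 * x\<^sup>2 - 5 * x + 1\<bar> \<le> 1"
  proof -
    have "5 * x\<^sup>2 - 5 * x + 1 = 5 * (x - 1/2)\<^sup>2 - 1/4" by (simp add: power2_eq_square algebra_simps)
    moreover have "x\<^sup>2 \<le> x" using x by (simp add: power2_eq_square mult_left_le)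
    ultimately show ?thesis
      using zero_le_power2[of "x - 1/2"] unfolding abs_le_iff by linarith
  qed
  then have "x * (1 - x) * \<bar>5 * x\<^sup>2 - 5 * x + 1\<bar> \<le> x * (1 - x) * 1"
    using x by (intro mult_left_mono) auto
  then show ?thesis using x by (simp add: abs_mult)
qed

end

lemma abs_I_deriv_le:
  assumes "0 < W"
  shows "\<bar>I_deriv W x\<bar> \<le> W"
proof (cases "0 \<le> x \<and> x \<le> 1")
  case True
  have "x * (1 - x) \<le> 1 * 1" using True by (intro mult_mono) auto
  then have "W * \<bar>x * (x - 1) * (5 * x\<^sup>2 - 5 * x + 1)\<bar> \<le> W * 1"
    using assms True abs_I_deriv_unit_le[of x] by (intro mult_left_mono) auto
  then show ?thesis using True assms by (simp add: I_deriv_def abs_mult)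
qed (use assms in \<open>auto simp: I_deriv_def\<close>)

lemma abs_I_fun_le:
  assumes "0 < W"
  shows "\<bar>I_fun W x\<bar> \<le> W * \<bar>x\<bar>"
proof (cases "0 \<le> x \<and> x \<le> 1")
  case True
  have "(x * (1 - x))\<^sup>2 = x * (x * (1 - x)\<^sup>2)" by (simp add: power2_eq_square)
  also have "\<dots> \<le> x * (1 * 1)" using True by (intro mult_left_mono mult_mono) (auto simp: power_le_one)
  finally have "W * \<bar>x\<^sup>2 * (x - 1)\<^sup>2 * (x - 1/2)\<bar> \<le> W * x"
    using assms True abs_I_fun_unit_le[of x] by (intro mult_left_mono) auto
  then show ?thesis using True assms by (simp add: I_fun_def abs_mult mult.assoc)
qed (use assms in \<open>auto simp: I_fun_def\<close>)

text \<open>If both points lie in the unit interval, the remainder of the polynomial is divisible by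
  \<open>h^2\<close>. If just one does, an endpoint separates them, so \<open>z * (1 - z)\<close> at
  the inner point \<open>z\<close> is at most \<open>\<bar>h\<bar>\<close>; the double zeros of the
  polynomial and the simple zeros of its derivative then leave only terms of order
  \<open>h^2\<close>.\<close>

lemma I_fun_Taylor:
  assumes W: "0 < W"
  shows "\<bar>I_fun W (x + h) - I_fun W x - I_deriv W x * h\<bar> \<le> 32 * W * h\<^sup>2"
proof -
  let ?q = "\<lambda>x::real. x\<^sup>2 * (x - 1)\<^sup>2 * (x - 1/2)" and ?d = "\<lambda>x::real. x * (x - 1) * (5 * x\<^sup>2 - 5 * x + 1)"
  define y where "y = x + h"
  have h: "h = y - x" by (simp add: y_def)
  let ?J = "\<lambda>x::real. 0 \<le> x \<and> x \<le> 1"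
  have boundary: "z * (1 - z) \<le> \<bar>z - w\<bar>" if "?J z" "\<not> ?J w" for z w :: real
  proof -
    have "z * (1 - z) \<le> z" "z * (1 - z) \<le> 1 - z"
      using that by (simp_all add: mult_left_le mult_left_le_one_le)
    then show ?thesis using that by auto
  qed
  have sq: "(z * (1 - z))\<^sup>2 \<le> (z - w)\<^sup>2" if "?J z" "\<not> ?J w" for z w :: real
    using power_mono[OF boundary[OF that], of 2] that by simp
  consider "?J x" "?J y" | "?J x" "\<not> ?J y" | "\<not> ?J x" "?J y" | "\<not> ?J x" "\<not> ?J y" by blast
  then have "\<bar>?q y * indicator {0..1} y - ?q x * indicator {0..1} x - ?d x * indicator {0..1} x * h\<bar> \<le> 32 * h\<^sup>2"
  proof cases
    case 1
    \<comment> \<open>The quotient of the Taylor remainder of \<open>?q\<close> by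
      \<open>(y - x)^2\<close>. The absolute values of its coefficients sum to \<open>63/2\<close>,
      and all monomials lie between \<open>0\<close> and \<open>1\<close>; hence the constant
      \<open>32\<close>.\<close>
    let ?R = "(y^3 + 2*(x*y^2) + 3*(x^2*y) + 4*x^3) - 5/2 * (y^2 + 2*(x*y) + 3*x^2) + 2 * (y + 2*x) - 1/2"
    have eq: "?q y - ?q x - ?d x * h = h\<^sup>2 * ?R"
      unfolding h by (simp add: field_simps power2_eq_square power3_eq_cube)
    have mono: "0 \<le> x^a * y^b" "x^a * y^b \<le> 1" for a b
      using 1 by (auto intro!: mult_le_one power_le_one)
    note mono = mono(1)[of 0 3] mono(1)[of 1 2] mono(1)[of 2 1] mono(1)[of 3 0] mono(1)[of 0 2]
      mono(1)[of 1 1] mono(1)[of 2 0] mono(1)[of 0 1] mono(1)[of 1 0]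
      mono(2)[of 0 3] mono(2)[of 1 2] mono(2)[of 2 1] mono(2)[of 3 0] mono(2)[of 0 2]
      mono(2)[of 1 1] mono(2)[of 2 0] mono(2)[of 0 1] mono(2)[of 1 0]
    have "?R \<le> 32" "- 32 \<le> ?R"
      using mono unfolding power_0 power_one_right mult_1_left mult_1_right ring_distribs by linarith+
    then have "\<bar>?R\<bar> \<le> 32" by (intro abs_leI) linarith+
    then have "h\<^sup>2 * \<bar>?R\<bar> \<le> h\<^sup>2 * 32" by (intro mult_left_mono) auto
    then show ?thesis using 1 eq by (simp add: abs_mult mult.commute)
  next
    case 2
    have "\<bar>?d x\<bar> \<le> \<bar>h\<bar>"
      using order_trans[OF abs_I_deriv_unit_le[of x] boundary[OF 2]] 2 by (simp add: h abs_minus_commute)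
    then have "\<bar>?d x * h\<bar> \<le> \<bar>h\<bar> * \<bar>h\<bar>"
      unfolding abs_mult[of "?d x" h] by (rule mult_right_mono) simp
    moreover have "\<bar>?q x\<bar> \<le> h\<^sup>2"
      using abs_I_fun_unit_le[of x] sq[OF 2] 2 by (simp add: h power2_commute)
    ultimately show ?thesis using 2 by (simp add: power2_eq_square)
  next
    case 3
    have "\<bar>?q y\<bar> \<le> h\<^sup>2"
      using abs_I_fun_unit_le[of y] sq[OF 3(2) 3(1)] 3 by (simp add: h)
    then show ?thesis using 3 by simp
  qed simp
  from mult_left_mono[OF this, of W] W
  have "\<bar>W * (?q y * indicator {0..1} y - ?q x * indicator {0..1} x - ?d x * indicator {0..1} x * h)\<bar> \<le> 32 * W * h\<^sup>2"
    by (simp add: abs_mult mult_ac)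
  then show ?thesis
    unfolding y_def by (simp add: I_fun_def I_deriv_def algebra_simps)
qed

section \<open>The norm of \<open>L\<^sup>r\<close>\<close>

text \<open>By homogeneity only \<open>a = 1\<close> has to be considered. The second derivative is not available,
  since \<open>r < 2\<close> is possible.\<close>

lemma abs_powr_Taylor:
  fixes r e :: real
  assumes r: "1 < r" and e: "0 < e"
  obtains C where "0 \<le> C"
    "\<And>a h. \<bar>\<bar>a + h\<bar> powr r - \<bar>a\<bar> powr r - r * sgn a * \<bar>a\<bar> powr (r - 1) * h\<bar>
        \<le> e * (\<bar>a\<bar> powr (r - 1) * \<bar>h\<bar>) + C * \<bar>h\<bar> powr r"
proof -
  let ?R = "\<lambda>k::real. \<bar>1 + k\<bar> powr r - 1 - r * k"
  have "((\<lambda>x. x powr r) has_real_derivative r) (at 1)"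
    using has_real_derivative_powr[of 1 r] by simp
  then obtain d where d: "d > 0" "\<And>y. \<bar>y - 1\<bar> < d \<Longrightarrow> \<bar>y powr r - 1 - r * (y - 1)\<bar> \<le> e * \<bar>y - 1\<bar>"
    using e unfolding has_field_derivative_def has_derivative_at_alt by force
  let ?d = "min d 1"
  define w where "w = 1 / ?d"
  \<comment> \<open>For \<open>\<bar>k\<bar> \<ge> ?d\<close> one has
    \<open>1 \<le> w * \<bar>k\<bar>\<close>, so each of \<open>\<bar>1 + k\<bar> powr r\<close>,
    \<open>1\<close> and \<open>r * \<bar>k\<bar>\<close> is a multiple of
    \<open>\<bar>k\<bar> powr r\<close>; \<open>C\<close> adds up these multiples. The last
    \<open>1\<close> provides \<open>C \<ge> 1\<close> for the case \<open>a = 0\<close>, where the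
    left side is \<open>\<bar>h\<bar> powr r\<close> itself.\<close>
  define C where "C = (1 + w) powr r + (w) powr r + r * (w) powr (r - 1) + 1"
  have C: "1 \<le> C" using r by (simp add: C_def)
  have dpos: "0 < ?d" using d by simp
  then have w: "0 < w" by (simp add: w_def)
  have R: "\<bar>?R k\<bar> \<le> e * \<bar>k\<bar> + C * \<bar>k\<bar> powr r" for k
  proof (cases "\<bar>k\<bar> < ?d")
    case True
    then have "\<bar>1 + k\<bar> = 1 + k" by auto
    with True have "\<bar>?R k\<bar> \<le> e * \<bar>k\<bar>" using d(2)[of "1 + k"] by simp
    then show ?thesis using C by (simp add: add_increasing2)
  next
    case False
    then have k: "?d \<le> \<bar>k\<bar>" "0 < \<bar>k\<bar>" using dpos by auto
    have one: "1 \<le> w * \<bar>k\<bar>" using k dpos by (simp add: w_def field_simps)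
    have "\<bar>1 + k\<bar> powr r \<le> ((1 + w) * \<bar>k\<bar>) powr r"
      using r one by (intro powr_mono2) (auto simp: algebra_simps)
    moreover have "1 powr r \<le> (w * \<bar>k\<bar>) powr r"
      using r one by (intro powr_mono2) auto
    moreover have "1 powr (r - 1) \<le> (w * \<bar>k\<bar>) powr (r - 1)"
      using r one by (intro powr_mono2) auto
    then have "r * \<bar>k\<bar> * 1 \<le> r * \<bar>k\<bar> * (w * \<bar>k\<bar>) powr (r - 1)"
      using r by (intro mult_left_mono) auto
    moreover have "\<bar>?R k\<bar> \<le> \<bar>1 + k\<bar> powr r + 1 + r * \<bar>k\<bar>"
      using r abs_triangle_ineq4[of "\<bar>1 + k\<bar> powr r - 1" "r * k"] abs_triangle_ineq4[of "\<bar>1 + k\<bar> powr r" 1]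
      by (simp add: abs_mult)
    ultimately have "\<bar>?R k\<bar> \<le> ((1 + w) * \<bar>k\<bar>) powr r + (w * \<bar>k\<bar>) powr r + r * \<bar>k\<bar> * (w * \<bar>k\<bar>) powr (r - 1)"
      by simp
    also have "\<dots> = (C - 1) * \<bar>k\<bar> powr r"
    proof -
      have kk: "\<bar>k\<bar> * \<bar>k\<bar> powr (r - 1) = \<bar>k\<bar> powr r" using k by (simp add: powr_diff)
      have "r * \<bar>k\<bar> * (w powr (r - 1) * \<bar>k\<bar> powr (r - 1)) = r * w powr (r - 1) * (\<bar>k\<bar> * \<bar>k\<bar> powr (r - 1))"
        by (simp only: mult_ac)
      then have *: "r * \<bar>k\<bar> * (w powr (r - 1) * \<bar>k\<bar> powr (r - 1)) = r * w powr (r - 1) * \<bar>k\<bar> powr r"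
        by (simp only: kk)
      have "((1 + w) * \<bar>k\<bar>) powr q = (1 + w) powr q * \<bar>k\<bar> powr q"
        "(w * \<bar>k\<bar>) powr q = w powr q * \<bar>k\<bar> powr q" for q
        using w by (simp_all add: powr_mult)
      then show ?thesis
        by (simp only: * C_def distrib_right add_diff_cancel_right')
    qed
    also have "\<dots> \<le> C * \<bar>k\<bar> powr r" by (intro mult_right_mono) auto
    finally show ?thesis using e by (simp add: add_increasing)
  qed
  show ?thesis
  proof
    show "0 \<le> C" using C by simp
    fix a h :: real
    show "\<bar>\<bar>a + h\<bar> powr r - \<bar>a\<bar> powr r - r * sgn a * \<bar>a\<bar> powr (r - 1) * h\<bar>
        \<le> e * (\<bar>a\<bar> powr (r - 1) * \<bar>h\<bar>) + C * \<bar>h\<bar> powr r"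
    proof (cases "a = 0")
      case True
      then show ?thesis using mult_right_mono[OF C, of "\<bar>h\<bar> powr r"] r by simp
    next
      case False
      define k where "k = h / a"
      have h: "h = a * k" using False by (simp add: k_def)
      have pow: "\<bar>a\<bar> powr r = \<bar>a\<bar> powr (r - 1) * \<bar>a\<bar>" using False by (simp add: powr_diff)
      have "\<bar>a + h\<bar> = \<bar>a\<bar> * \<bar>1 + k\<bar>" unfolding h by (simp add: distrib_left flip: abs_mult)
      then have "\<bar>a + h\<bar> powr r = \<bar>a\<bar> powr r * \<bar>1 + k\<bar> powr r" by (simp add: powr_mult)
      moreover have "sgn a * \<bar>a\<bar> powr (r - 1) * h = \<bar>a\<bar> powr r * k"
      proof -
        have "sgn a * \<bar>a\<bar> powr (r - 1) * (a * k) = \<bar>a\<bar> powr (r - 1) * (a * sgn a) * k"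
          by (simp only: mult_ac)
        then show ?thesis unfolding h pow by (simp only: abs_sgn[symmetric])
      qed
      ultimately have "\<bar>a + h\<bar> powr r - \<bar>a\<bar> powr r - r * sgn a * \<bar>a\<bar> powr (r - 1) * h = \<bar>a\<bar> powr r * ?R k"
        by (simp add: algebra_simps)
      then have "\<bar>\<bar>a + h\<bar> powr r - \<bar>a\<bar> powr r - r * sgn a * \<bar>a\<bar> powr (r - 1) * h\<bar> = \<bar>a\<bar> powr r * \<bar>?R k\<bar>"
        by (simp only: abs_mult) simp
      also have "\<dots> \<le> \<bar>a\<bar> powr r * (e * \<bar>k\<bar> + C * \<bar>k\<bar> powr r)"
        by (intro mult_left_mono R) simp
      also have "\<dots> = e * (\<bar>a\<bar> powr (r - 1) * \<bar>h\<bar>) + C * \<bar>h\<bar> powr r"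
        unfolding h abs_mult powr_mult by (simp add: pow algebra_simps)
      finally show ?thesis .
    qed
  qed
qed

text \<open>A Young inequality with a free parameter: after the scaling \<open>b = t * c\<close>,
  the product \<open>a powr (r - 1) * c\<close> is at most the \<open>r\<close>-th power of the
  larger of \<open>a\<close> and \<open>c\<close>.\<close>

lemma powr_mult_le:
  fixes a b r t :: real
  assumes "0 \<le> a" "0 \<le> b" "0 < t" "1 < r"
  shows "a powr (r - 1) * b \<le> t * a powr r + t powr (1 - r) * b powr r"
proof (cases "b = 0 \<or> a = 0")
  case False
  define c where "c = b / t"
  have b: "b = t * c" and c: "0 < c" using assms False by (auto simp: c_def)
  have tr: "t powr (1 - r) * t powr r = t" using assms by (simp flip: powr_add)
  have "a powr (r - 1) * c \<le> a powr r + c powr r"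
  proof (cases "a \<le> c")
    case True
    have "a powr (r - 1) * c \<le> c powr (r - 1) * c" using True assms c by (intro mult_right_mono powr_mono2) auto
    also have "\<dots> = c powr r" using c by (simp add: powr_diff)
    finally show ?thesis by (simp add: add_increasing)
  next
    case f: False
    have "a powr (r - 1) * c \<le> a powr (r - 1) * a" using f by (intro mult_left_mono) auto
    also have "\<dots> = a powr r" using False assms by (simp add: powr_diff)
    finally show ?thesis by (simp add: add_increasing2)
  qed
  from mult_left_mono[OF this, of t] assms
  have "a powr (r - 1) * b \<le> t * a powr r + t * c powr r" by (simp add: b algebra_simps)
  also have "t * c powr r = t powr (1 - r) * b powr r"
    using assms c tr by (simp add: b powr_mult flip: mult.assoc)
  finally show ?thesis .
qed (use assms in auto)

lemma abs_add_powr_le: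
  fixes a b r :: real
  assumes "0 < r"
  shows "\<bar>a + b\<bar> powr r \<le> 2 powr r * (\<bar>a\<bar> powr r + \<bar>b\<bar> powr r)"
proof -
  have "\<bar>a + b\<bar> powr r \<le> (2 * max \<bar>a\<bar> \<bar>b\<bar>) powr r"
    using assms by (intro powr_mono2) auto
  also have "\<dots> = 2 powr r * (max \<bar>a\<bar> \<bar>b\<bar>) powr r" by (simp add: powr_mult)
  also have "\<dots> \<le> 2 powr r * (\<bar>a\<bar> powr r + \<bar>b\<bar> powr r)"
    by (intro mult_left_mono) (auto simp: max_def)
  finally show ?thesis .
qed

section \<open>The seminormed space \<open>L^r\<close> and differentiability of powers of its
  norm\<close>

context
  fixes r :: real
  assumes r: "1 < r"
begin

lemma Lr_spaceD:
  assumes "u \<in> Lr_space r"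
  shows "u \<in> borel_measurable borel" "integrable lborel (\<lambda>x. \<bar>u x\<bar> powr r)"
  using assms by (auto simp: Lr_space_def)

lemma Lr_norm_nonneg: "0 \<le> Lr_norm r u"
  by (simp add: Lr_norm_def)

lemma Lr_norm_powr: "Lr_norm r u powr q = (LINT x|lborel. \<bar>u x\<bar> powr r) powr (q / r)"
  using r by (simp add: Lr_norm_def powr_powr)

lemma Lr_norm_powr_r: "Lr_norm r u powr r = (LINT x|lborel. \<bar>u x\<bar> powr r)"
  using r by (simp add: Lr_norm_powr)

lemma Lr_space_add:
  assumes u: "u \<in> Lr_space r" and v: "v \<in> Lr_space r"
  shows "u + v \<in> Lr_space r"
    and "(LINT x|lborel. \<bar>(u + v) x\<bar> powr r)
      \<le> 2 powr r * ((LINT x|lborel. \<bar>u x\<bar> powr r) + (LINT x|lborel. \<bar>v x\<bar> powr r))"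
proof -
  note [measurable] = Lr_spaceD(1)[OF u] Lr_spaceD(1)[OF v]
  have le: "\<bar>(u + v) x\<bar> powr r \<le> 2 powr r * (\<bar>u x\<bar> powr r + \<bar>v x\<bar> powr r)" for x
    using r abs_add_powr_le[of r "u x" "v x"] by simp
  have int: "integrable lborel (\<lambda>x. 2 powr r * (\<bar>u x\<bar> powr r + \<bar>v x\<bar> powr r))"
    using Lr_spaceD(2)[OF u] Lr_spaceD(2)[OF v] by simp
  have int': "integrable lborel (\<lambda>x. \<bar>(u + v) x\<bar> powr r)"
    by (rule Bochner_Integration.integrable_bound[OF int]) (use le in \<open>auto simp: plus_fun_def\<close>)
  then show "u + v \<in> Lr_space r"
    by (auto simp: Lr_space_def plus_fun_def)
  show "(LINT x|lborel. \<bar>(u + v) x\<bar> powr r)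
      \<le> 2 powr r * ((LINT x|lborel. \<bar>u x\<bar> powr r) + (LINT x|lborel. \<bar>v x\<bar> powr r))"
    using integral_mono[OF int' int le] Lr_spaceD(2)[OF u] Lr_spaceD(2)[OF v] by simp
qed

lemma Lr_space_scaleR:
  assumes u: "u \<in> Lr_space r"
  shows "c *\<^sub>R u \<in> Lr_space r" and "Lr_norm r (c *\<^sub>R u) = \<bar>c\<bar> * Lr_norm r u"
  using Lr_spaceD[OF u] r
  by (auto simp: Lr_space_def Lr_norm_def scaleR_fun_def abs_mult powr_mult powr_powr)

lemma zero_in_Lr_space: "0 \<in> Lr_space r"
  by (auto simp: Lr_space_def zero_fun_def)

text \<open>The derivative at \<open>u\<close>, in direction \<open>h\<close>, of the integral of
  \<open>\<bar>u x\<bar> powr r\<close>.\<close>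

definition Lr_pairing :: "(real^'d::finite \<Rightarrow> real) \<Rightarrow> (real^'d \<Rightarrow> real) \<Rightarrow> real" where
  "Lr_pairing u h = (LINT x|lborel. r * sgn (u x) * \<bar>u x\<bar> powr (r - 1) * h x)"

text \<open>With \<open>A\<close> the integral of \<open>\<bar>u x\<bar> powr r\<close>, integrating
  \<open>powr_mult_le\<close> with \<open>t\<close> slightly above the norm of \<open>h\<close>
  gives \<open>t * A + t powr (1 - r) * t powr r = (A + 1) * t\<close>. The constant is cruder than
  in Hoelder's inequality, but it suffices to bound \<open>Lr_pairing\<close>.\<close>

lemma Hoelder_powr:
  assumes u: "u \<in> Lr_space r" and h: "h \<in> Lr_space r"
  shows "integrable lborel (\<lambda>x. \<bar>u x\<bar> powr (r - 1) * \<bar>h x\<bar>)"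
    and "(LINT x|lborel. \<bar>u x\<bar> powr (r - 1) * \<bar>h x\<bar>)
      \<le> ((LINT x|lborel. \<bar>u x\<bar> powr r) + 1) * Lr_norm r h"
proof -
  note [measurable] = Lr_spaceD(1)[OF u] Lr_spaceD(1)[OF h]
  let ?A = "LINT x|lborel. \<bar>u x\<bar> powr r"
  have A: "0 \<le> ?A" by simp
  have le: "\<bar>u x\<bar> powr (r - 1) * \<bar>h x\<bar> \<le> t * \<bar>u x\<bar> powr r + t powr (1 - r) * \<bar>h x\<bar> powr r"
    if "0 < t" for t x
    using that r by (intro powr_mult_le) auto
  have int_t: "integrable lborel (\<lambda>x. t * \<bar>u x\<bar> powr r + t powr (1 - r) * \<bar>h x\<bar> powr r)" for t
    using Lr_spaceD(2)[OF u] Lr_spaceD(2)[OF h] by simp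
  show int: "integrable lborel (\<lambda>x. \<bar>u x\<bar> powr (r - 1) * \<bar>h x\<bar>)"
    by (rule Bochner_Integration.integrable_bound[OF int_t[of 1]]) (use le[of 1] in auto)
  show "(LINT x|lborel. \<bar>u x\<bar> powr (r - 1) * \<bar>h x\<bar>) \<le> (?A + 1) * Lr_norm r h"
  proof (rule field_le_epsilon)
    fix e :: real assume e: "0 < e"
    define t where "t = Lr_norm r h + e / (?A + 1)"
    have t: "0 < t" "Lr_norm r h \<le> t"
      using e A Lr_norm_nonneg[of h] by (auto simp: t_def add_nonneg_pos)
    have "(LINT x|lborel. \<bar>u x\<bar> powr (r - 1) * \<bar>h x\<bar>) \<le>
        (LINT x|lborel. t * \<bar>u x\<bar> powr r + t powr (1 - r) * \<bar>h x\<bar> powr r)"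
      using le[OF t(1)] by (intro integral_mono int int_t)
    also have "\<dots> = t * ?A + t powr (1 - r) * Lr_norm r h powr r"
      using Lr_spaceD(2)[OF u] Lr_spaceD(2)[OF h] by (simp add: Lr_norm_powr_r)
    also have "\<dots> \<le> t * ?A + t powr (1 - r) * t powr r"
      using t r Lr_norm_nonneg by (intro add_left_mono mult_left_mono powr_mono2) auto
    also have "\<dots> = (?A + 1) * t"
      using t(1) by (simp add: algebra_simps flip: powr_add)
    also have "\<dots> = (?A + 1) * Lr_norm r h + e"
    proof -
      have "?A + 1 \<noteq> 0" using A by linarith
      then show ?thesis by (simp add: t_def distrib_left)
    qed
    finally show "(LINT x|lborel. \<bar>u x\<bar> powr (r - 1) * \<bar>h x\<bar>) \<le> (?A + 1) * Lr_norm r h + e" .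
  qed
qed

text \<open>\<open>abs_powr_Taylor\<close> is integrated. Its first error term is \<open>e1\<close>
  times an integral bounded by \<open>Hoelder_powr\<close>; the second becomes
  \<open>C * Lr_norm r h powr r\<close>, which is superlinear since \<open>r > 1\<close>: the radius
  \<open>d\<close> satisfies \<open>d powr (r - 1) = e2\<close>.\<close>

lemma has_frechet_derivative_integral_powr:
  fixes u :: "real^'d::finite \<Rightarrow> real"
  assumes u: "u \<in> Lr_space r"
  shows "has_frechet_derivative_on (\<lambda>u. LINT x|lborel. \<bar>u x\<bar> powr r) (Lr_pairing u) u (Lr_space r) (Lr_norm r)"
proof -
  let ?A = "LINT x|lborel. \<bar>u x\<bar> powr r"
  have A: "0 \<le> ?A" by simp
  note [measurable] = Lr_spaceD(1)[OF u]
  have abs_le: "\<bar>r * sgn (u x) * \<bar>u x\<bar> powr (r - 1) * h\<bar> \<le> r * (\<bar>u x\<bar> powr (r - 1) * \<bar>h\<bar>)" for x and h :: real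
    using r by (simp add: abs_mult abs_sgn_eq)
  have int: "integrable lborel (\<lambda>x. r * sgn (u x) * \<bar>u x\<bar> powr (r - 1) * h x)" if h: "h \<in> Lr_space r" for h :: "real^'d \<Rightarrow> real"
  proof -
    note [measurable] = Lr_spaceD(1)[OF h]
    show ?thesis
      by (rule Bochner_Integration.integrable_bound[OF integrable_mult_right[OF Hoelder_powr(1)[OF u h], of r]])
        (use abs_le r in \<open>auto simp: abs_mult abs_sgn_eq\<close>)
  qed
  show ?thesis
    unfolding has_frechet_derivative_on_def
  proof (intro conjI ballI allI impI)
    fix h k :: "real^'d \<Rightarrow> real" assume "h \<in> Lr_space r" "k \<in> Lr_space r"
    then show "Lr_pairing u (h + k) = Lr_pairing u h + Lr_pairing u k"
      using int[of h] int[of k] by (simp add: Lr_pairing_def distrib_left)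
  next
    fix c h
    show "Lr_pairing u (c *\<^sub>R h) = c * Lr_pairing u h"
      by (simp add: Lr_pairing_def scaleR_fun_def mult.left_commute)
  next
    have "\<bar>Lr_pairing u h\<bar> \<le> r * (?A + 1) * Lr_norm r h" if h: "h \<in> Lr_space r" for h :: "real^'d \<Rightarrow> real"
    proof -
      have "norm (Lr_pairing u h) \<le> (LINT x|lborel. r * (\<bar>u x\<bar> powr (r - 1) * \<bar>h x\<bar>))"
        unfolding Lr_pairing_def using abs_le
        by (intro norm_integral_le_integral integrable_mult_right Hoelder_powr(1) u h) auto
      also have "\<dots> = r * (LINT x|lborel. \<bar>u x\<bar> powr (r - 1) * \<bar>h x\<bar>)" by simp
      also have "\<dots> \<le> r * ((?A + 1) * Lr_norm r h)"
        using r by (intro mult_left_mono Hoelder_powr(2) u h) simp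
      finally show ?thesis by (simp add: mult.assoc)
    qed
    then show "\<exists>B. \<forall>h\<in>Lr_space r. \<bar>Lr_pairing u h\<bar> \<le> B * Lr_norm r h" by blast
  next
    fix e :: real assume e: "0 < e"
    define A1 where "A1 = ?A + 1"
    have "0 < A1" using A unfolding A1_def by linarith
    define e1 where "e1 = e / (2 * A1)"
    have e1: "0 < e1" "e1 * (?A + 1) = e / 2"
      unfolding A1_def[symmetric] using e \<open>0 < A1\<close> by (simp_all add: e1_def)
    from abs_powr_Taylor[OF r e1(1)] obtain C where C: "0 \<le> C"
      "\<And>a h. \<bar>\<bar>a + h\<bar> powr r - \<bar>a\<bar> powr r - r * sgn a * \<bar>a\<bar> powr (r - 1) * h\<bar>
        \<le> e1 * (\<bar>a\<bar> powr (r - 1) * \<bar>h\<bar>) + C * \<bar>h\<bar> powr r" by metis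
    define e2 where "e2 = e / (2 * (C + 1))"
    have e2: "0 < e2" "C * e2 \<le> e / 2"
      using e C by (simp_all add: e2_def field_simps)
    define d where "d = e2 powr (1 / (r - 1))"
    have d: "0 < d" "d powr (r - 1) = e2"
      using e2 r by (simp_all add: d_def powr_powr)
    show "\<exists>d>0. \<forall>h\<in>Lr_space r. Lr_norm r h < d \<longrightarrow>
        \<bar>(LINT x|lborel. \<bar>(u + h) x\<bar> powr r) - ?A - Lr_pairing u h\<bar> \<le> e * Lr_norm r h"
    proof (intro exI conjI ballI impI)
      show "0 < d" by fact
      fix h :: "real^'d \<Rightarrow> real" assume h: "h \<in> Lr_space r" and N: "Lr_norm r h < d"
      let ?N = "Lr_norm r h"
      let ?f = "\<lambda>x. \<bar>u x + h x\<bar> powr r - \<bar>u x\<bar> powr r - r * sgn (u x) * \<bar>u x\<bar> powr (r - 1) * h x"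
      have eq: "(LINT x|lborel. \<bar>(u + h) x\<bar> powr r) - ?A - Lr_pairing u h = integral\<^sup>L lborel ?f"
        using int[OF h] Lr_spaceD(2)[OF u] Lr_spaceD(2)[OF Lr_space_add(1)[OF u h]]
        by (simp add: Lr_pairing_def)
      have "norm (integral\<^sup>L lborel ?f) \<le> (LINT x|lborel. e1 * (\<bar>u x\<bar> powr (r - 1) * \<bar>h x\<bar>) + C * \<bar>h x\<bar> powr r)"
        using C(2) Hoelder_powr(1)[OF u h] Lr_spaceD(2)[OF h]
        by (intro norm_integral_le_integral) auto
      also have "\<dots> = e1 * (LINT x|lborel. \<bar>u x\<bar> powr (r - 1) * \<bar>h x\<bar>) + C * ?N powr r"
        using Hoelder_powr(1)[OF u h] Lr_spaceD(2)[OF h] by (simp add: Lr_norm_powr_r)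
      also have "\<dots> \<le> e1 * ((?A + 1) * ?N) + C * (?N * e2)"
      proof (intro add_mono mult_left_mono Hoelder_powr u h C)
        have "?N powr r = ?N * ?N powr (r - 1)"
          using Lr_norm_nonneg[of h] by (cases "?N = 0") (simp_all add: powr_diff)
        also have "\<dots> \<le> ?N * d powr (r - 1)"
          using N r Lr_norm_nonneg by (intro mult_left_mono powr_mono2) auto
        finally show "?N powr r \<le> ?N * e2" by (simp add: d)
      qed (use e1 in simp)
      also have "\<dots> \<le> e / 2 * ?N + e / 2 * ?N"
      proof (rule add_mono)
        show "e1 * ((?A + 1) * ?N) \<le> e / 2 * ?N" using e1(2) by (simp only: mult.assoc[symmetric])
        show "C * (?N * e2) \<le> e / 2 * ?N"
          using mult_right_mono[OF e2(2) Lr_norm_nonneg[of h]] by (simp only: mult_ac)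
      qed
      finally show "\<bar>(LINT x|lborel. \<bar>(u + h) x\<bar> powr r) - ?A - Lr_pairing u h\<bar> \<le> e * ?N" unfolding eq by simp
    qed
  qed
qed

end

lemma subspace_Lr_space: "1 < r \<Longrightarrow> subspace (Lr_space r)"
  by (intro subspaceI zero_in_Lr_space Lr_space_add(1) Lr_space_scaleR(1))

text \<open>The outer function \<open>s powr (p / r)\<close> may fail to be differentiable at
  \<open>0\<close>, as \<open>p < r\<close> is possible, so functions of norm \<open>0\<close> are
  treated by hand: there \<open>Lr_norm r (u + h)\<close> is at most \<open>2 * Lr_norm r h\<close>,
  and \<open>p > 1\<close> gives derivative \<open>0\<close>. The distinction is on the integral
  rather than on \<open>u = 0\<close> because \<open>u\<close> is a representative.\<close>

lemma has_frechet_derivative_Lr_norm_powr: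
  fixes u :: "real^'d::finite \<Rightarrow> real"
  assumes r: "1 < r" and p: "1 < p" and u: "u \<in> Lr_space r"
  shows "\<exists>D. has_frechet_derivative_on (\<lambda>u. Lr_norm r u powr p) D u (Lr_space r) (Lr_norm r)"
proof (cases "(LINT x|lborel. \<bar>u x\<bar> powr r) = 0")
  case False
  then have "0 < (LINT x|lborel. \<bar>u x\<bar> powr r)"
    by (simp add: less_le)
  from has_frechet_derivative_on_compose_real[OF has_real_derivative_powr[OF this, of "p / r"]
      has_frechet_derivative_integral_powr[OF r u] Lr_norm_nonneg[OF r]]
  show ?thesis unfolding Lr_norm_powr[OF r] by blast
next
  case True
  then have N0: "Lr_norm r u = 0" by (simp add: Lr_norm_def)
  have N_le: "Lr_norm r (u + h) \<le> 2 * Lr_norm r h" if h: "h \<in> Lr_space r" for h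
  proof -
    have "Lr_norm r (u + h) \<le> (2 powr r * (LINT x|lborel. \<bar>h x\<bar> powr r)) powr (1 / r)"
      using Lr_space_add(2)[OF r u h] True r unfolding Lr_norm_def by (intro powr_mono2) auto
    also have "\<dots> = 2 * Lr_norm r h"
      using r by (simp add: Lr_norm_def powr_mult powr_powr)
    finally show ?thesis .
  qed
  have "has_frechet_derivative_on (\<lambda>u. Lr_norm r u powr p) (\<lambda>_. 0) u (Lr_space r) (Lr_norm r)"
    unfolding has_frechet_derivative_on_def
  proof (intro conjI allI ballI impI)
    show "\<exists>B. \<forall>h\<in>Lr_space r. \<bar>0::real\<bar> \<le> B * Lr_norm r (h :: real^'d \<Rightarrow> real)"
      by (intro exI[of _ 0]) simp
    fix e :: real assume e: "0 < e"
    define d where "d = (e / 2 powr p) powr (1 / (p - 1))"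
    have d: "0 < d" "2 powr p * d powr (p - 1) = e" using e p by (simp_all add: d_def powr_powr)
    have "\<bar>Lr_norm r (u + h) powr p - Lr_norm r u powr p - 0\<bar> \<le> e * Lr_norm r h"
      if h: "h \<in> Lr_space r" "Lr_norm r h < d" for h
    proof -
      have "Lr_norm r (u + h) powr p \<le> (2 * Lr_norm r h) powr p"
        using p Lr_norm_nonneg[OF r] by (intro powr_mono2 N_le h) auto
      also have "\<dots> = 2 powr p * (Lr_norm r h powr (p - 1) * Lr_norm r h)"
        using Lr_norm_nonneg[OF r, of h] by (cases "Lr_norm r h = 0") (simp_all add: powr_mult powr_diff)
      also have "\<dots> \<le> 2 powr p * (d powr (p - 1) * Lr_norm r h)"
        using h(2) p Lr_norm_nonneg[OF r, of h] by (intro mult_left_mono mult_right_mono powr_mono2) auto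
      also have "\<dots> = e * Lr_norm r h" using d(2) by (simp only: mult.assoc[symmetric])
      finally show ?thesis by (simp add: N0)
    qed
    with d(1) show "\<exists>d>0. \<forall>h\<in>Lr_space r. Lr_norm r h < d \<longrightarrow>
        \<bar>Lr_norm r (u + h) powr p - Lr_norm r u powr p - 0\<bar> \<le> e * Lr_norm r h" by blast
  qed simp_all
  then show ?thesis by blast
qed

section \<open>One step of the recursion\<close>

context C1_kernel
begin

definition source :: "real \<Rightarrow> real \<Rightarrow> 'd c10 \<Rightarrow> (real^'d \<Rightarrow> real) \<Rightarrow> ('d, real^'d) c1b \<Rightarrow> real^'d \<Rightarrow> real" where
  "source W psi f u w y = chi psi (grad f y) * u y - grad f y \<bullet> c1b_apply w y + I_fun W (c10_apply f y)"

text \<open>The two convolutions in \<open>G_map\<close> are merged into one density, so that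
  linearity of \<open>smoothing\<close> turns a difference of steps into one smoothed difference of
  densities.\<close>

definition step :: "real \<Rightarrow> real \<Rightarrow> 'd c10 \<Rightarrow> (real^'d \<Rightarrow> real) \<Rightarrow> ('d, real^'d) c1b \<Rightarrow> 'd c10" where
  "step W psi f u w = smoothing (\<lambda>y. c10_apply f y + source W psi f u w y)"

text \<open>Formal derivative in direction \<open>h\<close> of the density in \<open>step\<close>;
  the gradient of \<open>chi psi\<close> at \<open>z\<close> is \<open>z\<close> divided by
  \<open>chi psi z\<close>.\<close>

definition step_deriv ::
    "real \<Rightarrow> real \<Rightarrow> 'd c10 \<Rightarrow> (real^'d \<Rightarrow> real) \<Rightarrow> ('d, real^'d) c1b \<Rightarrow> 'd c10 \<Rightarrow> real^'d \<Rightarrow> real" where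
  "step_deriv W psi f u w h y = c10_apply h y + ((grad f y \<bullet> grad h y) / chi psi (grad f y) * u y
     - grad h y \<bullet> c1b_apply w y + I_deriv W (c10_apply f y) * c10_apply h y)"

lemma mass_SUP_nonneg: "g \<in> conv_dom \<Longrightarrow> 0 \<le> (SUP x. mass g x)"
  using order_trans[OF mass_nonneg mass_le_SUP] by blast

lemma M_integral_nonneg: "0 \<le> integral\<^sup>L lborel M"
  by (simp add: M_nonneg)

lemma conv_dom_c10: "c10_apply f \<in> conv_dom"
  by (rule conv_dom_if_bounded_vanishing[OF borel_measurable_c10_apply abs_c10_apply_le c10_vanishing(1)])

lemma abs_grad_inner_le: "\<bar>grad f y \<bullet> c1b_apply w y\<bar> \<le> real CARD('d) * norm f * norm w"
  for f :: "'d c10" and w :: "('d, real^'d) c1b"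
  by (rule order_trans[OF Cauchy_Schwarz_ineq2 mult_mono[OF norm_grad_le norm_c1b_bounds(1)]]) simp_all

text \<open>The vector field is merely bounded; the decay that \<open>conv_dom\<close> requires
  comes from \<open>grad f\<close>.\<close>

lemma conv_dom_grad_inner: "(\<lambda>y. grad f y \<bullet> c1b_apply w y) \<in> conv_dom"
  for w :: "('d, real^'d) c1b"
proof (rule conv_dom_if_bounded_vanishing(1)[OF _ abs_grad_inner_le])
  show "((\<lambda>y. grad f y \<bullet> c1b_apply w y) \<longlongrightarrow> 0) at_infinity"
  proof (rule Lim_null_comparison)
    have "norm (grad f y \<bullet> c1b_apply w y) \<le> norm (grad f y) * norm w" for y
      using order_trans[OF Cauchy_Schwarz_ineq2 mult_left_mono[OF norm_c1b_bounds(1)[of w y]]] by simp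
    then show "\<forall>\<^sub>F y in at_infinity. norm (grad f y \<bullet> c1b_apply w y) \<le> norm (grad f y) * norm w"
      by simp
    show "((\<lambda>y. norm (grad f y) * norm w) \<longlongrightarrow> 0) at_infinity"
      by (intro tendsto_mult_left_zero tendsto_norm_zero c10_vanishing)
  qed
qed measurable

lemma
  fixes f :: "'d c10"
  assumes psi: "0 < psi" and u: "u \<in> conv_dom"
  shows chi_grad_le: "\<bar>chi psi (grad f y) * u y\<bar> \<le> (real CARD('d) * norm f + psi) * \<bar>u y\<bar>"
    and conv_dom_chi_mult: "(\<lambda>y. chi psi (grad f y) * u y) \<in> conv_dom"
proof -
  have chi: "\<bar>chi psi (grad f y)\<bar> \<le> real CARD('d) * norm f + psi" for y
    using chi_le[OF psi, of "grad f y"] norm_grad_le[of f y] chi_pos[OF psi, of "grad f y"] by simp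
  then show "\<bar>chi psi (grad f y) * u y\<bar> \<le> (real CARD('d) * norm f + psi) * \<bar>u y\<bar>"
    unfolding abs_mult by (rule mult_right_mono) simp
  show "(\<lambda>y. chi psi (grad f y) * u y) \<in> conv_dom"
    by (rule conv_dom_mult_bounded[OF u _ chi]) measurable
qed

lemma conv_dom_I_fun: "0 < W \<Longrightarrow> (\<lambda>y. I_fun W (c10_apply f y)) \<in> conv_dom"
  by (rule conv_dom_dominated(1)[OF conv_dom_c10[of f] _ abs_I_fun_le]) measurable

context
  fixes W psi :: real
  assumes W: "0 < W" and psi: "0 < psi"
begin

lemma conv_dom_source:
  assumes u: "u \<in> conv_dom"
  shows "source W psi f u w \<in> conv_dom"
  unfolding source_def[abs_def]
  by (intro conv_dom_add(3) conv_dom_diff conv_dom_chi_mult conv_dom_grad_inner conv_dom_I_fun W psi u)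

lemma conv_dom_step_arg:
  "u \<in> conv_dom \<Longrightarrow> (\<lambda>y. c10_apply f y + source W psi f u w y) \<in> conv_dom"
  by (intro conv_dom_add(3) conv_dom_source conv_dom_c10)

lemma abs_grad_inner_div_chi_le:
  "\<bar>(grad f y \<bullet> grad h y) / chi psi (grad f y)\<bar> \<le> real CARD('d) * norm h" for f h :: "'d c10"
proof -
  have "\<bar>grad f y \<bullet> grad h y\<bar> \<le> chi psi (grad f y) * (real CARD('d) * norm h)"
    by (rule order_trans[OF Cauchy_Schwarz_ineq2])
      (intro mult_mono norm_le_chi norm_grad_le; simp add: chi_pos psi less_imp_le)
  then show ?thesis by (simp add: abs_divide chi_pos psi abs_of_pos field_simps)
qed

lemma conv_dom_step_deriv:
  assumes u: "u \<in> conv_dom"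
  shows "step_deriv W psi f u w h \<in> conv_dom"
proof -
  note [measurable] = conv_dom_measurable[OF u]
  have "(\<lambda>y. (grad f y \<bullet> grad h y) / chi psi (grad f y) * u y) \<in> conv_dom"
    by (intro conv_dom_mult_bounded[OF u _ abs_grad_inner_div_chi_le]) auto
  moreover have "(\<lambda>y. I_deriv W (c10_apply f y) * c10_apply h y) \<in> conv_dom"
    by (intro conv_dom_mult_bounded[OF conv_dom_c10 _ abs_I_deriv_le[OF W]]) measurable
  ultimately show ?thesis
    unfolding step_deriv_def[abs_def]
    by (intro conv_dom_add(3) conv_dom_diff conv_dom_grad_inner conv_dom_c10)
qed

lemma abs_step_deriv_le:
  assumes u: "u \<in> conv_dom"
  shows "\<bar>step_deriv W psi f u w h y\<bar> \<le> real CARD('d) * norm h * \<bar>u y\<bar> + (1 + real CARD('d) * norm w + W) * norm h"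
proof -
  have 1: "\<bar>(grad f y \<bullet> grad h y) / chi psi (grad f y) * u y\<bar> \<le> real CARD('d) * norm h * \<bar>u y\<bar>"
    unfolding abs_mult[of _ "u y"] by (intro mult_right_mono abs_grad_inner_div_chi_le) simp
  have 2: "\<bar>I_deriv W (c10_apply f y) * c10_apply h y\<bar> \<le> W * norm h"
    unfolding abs_mult using W by (intro mult_mono abs_I_deriv_le abs_c10_apply_le) auto
  have 3: "\<bar>grad h y \<bullet> c1b_apply w y\<bar> \<le> real CARD('d) * norm w * norm h"
    using abs_grad_inner_le[of h y w] by (simp only: mult_ac)
  show ?thesis
    using 1 2 3 abs_c10_apply_le[of h y]
    unfolding step_deriv_def distrib_right by linarith
qed

text \<open>After subtraction of the linear part, the density is pointwise at most
  \<open>norm h ^ 2\<close> times a combination of \<open>\<bar>u y\<bar>\<close> and a constant.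
  \<open>norm_smoothing_dominated\<close> converts this into the quadratic bound
  \<open>C * (norm h)^2\<close> in the \<open>C^1\<close> norm.\<close>

lemma step_has_derivative:
  assumes u: "u \<in> conv_dom"
  shows "((\<lambda>f. step W psi f u w) has_derivative (\<lambda>h. smoothing (step_deriv W psi f u w h))) (at f)"
  unfolding has_derivative_at_alt
proof (intro conjI allI impI)
  let ?D = "\<lambda>h. smoothing (step_deriv W psi f u w h)"
  let ?S = "SUP x. mass u x" and ?m = "integral\<^sup>L lborel M" and ?n = "real CARD('d)"
  have S: "0 \<le> ?S" by (rule mass_SUP_nonneg[OF u])
  show "bounded_linear ?D"
  proof (rule bounded_linear_intro)
    fix h k
    have "step_deriv W psi f u w (h + k) = (\<lambda>y. step_deriv W psi f u w h y + step_deriv W psi f u w k y)"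
      by (auto simp: step_deriv_def c10_apply_add grad_add inner_add_left inner_add_right
          add_divide_distrib algebra_simps)
    then show "?D (h + k) = ?D h + ?D k" by (simp add: smoothing_add conv_dom_step_deriv u)
  next
    fix c h
    have "step_deriv W psi f u w (c *\<^sub>R h) = (\<lambda>y. c * step_deriv W psi f u w h y)"
      by (auto simp: step_deriv_def c10_apply_scaleR grad_scaleR algebra_simps)
    then show "?D (c *\<^sub>R h) = c *\<^sub>R ?D h" by (simp add: smoothing_scale conv_dom_step_deriv u)
  next
    fix h
    have "norm (?D h) \<le> ?n * norm h * ?S + (1 + ?n * norm w + W) * norm h * ?m"
      using W by (intro norm_smoothing_dominated u conv_dom_step_deriv abs_step_deriv_le) auto
    then show "norm (?D h) \<le> norm h * (?n * ?S + (1 + ?n * norm w + W) * ?m)"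
      by (simp add: algebra_simps)
  qed
  fix e :: real assume e: "0 < e"
  define C where "C = ?n\<^sup>2 / (2 * psi) * ?S + 32 * W * ?m"
  have C: "0 \<le> C" using S psi W M_integral_nonneg by (simp add: C_def)
  have rem: "norm (step W psi g u w - step W psi f u w - ?D (g - f)) \<le> C * (norm (g - f))\<^sup>2" for g
  proof -
    define h where "h = g - f"
    have g: "g = f + h" by (simp add: h_def)
    let ?R = "\<lambda>y. c10_apply g y + source W psi g u w y - (c10_apply f y + source W psi f u w y)
        - step_deriv W psi f u w h y"
    have "step W psi g u w - step W psi f u w - ?D h = smoothing ?R"
      unfolding step_def by (simp add: smoothing_diff conv_dom_diff conv_dom_step_arg conv_dom_step_deriv u)
    moreover have "\<bar>?R y\<bar> \<le> (?n * norm h)\<^sup>2 / (2 * psi) * \<bar>u y\<bar> + 32 * W * (norm h)\<^sup>2" for y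
    proof -
      let ?a = "grad f y" and ?b = "grad h y"
      \<comment> \<open>The terms linear in \<open>f\<close>, namely \<open>f\<close> itself and its
        gradient paired with the vector field, cancel; the remainders of \<open>chi psi\<close> and
        \<open>I_fun W\<close> are left.\<close>
      have eq: "?R y = (chi psi (?a + ?b) - chi psi ?a - (?a \<bullet> ?b) / chi psi ?a) * u y
          + (I_fun W (c10_apply f y + c10_apply h y) - I_fun W (c10_apply f y) - I_deriv W (c10_apply f y) * c10_apply h y)"
        by (simp add: g source_def step_deriv_def c10_apply_add grad_add inner_add_left algebra_simps)
      have "\<bar>?R y\<bar> \<le> \<bar>chi psi (?a + ?b) - chi psi ?a - (?a \<bullet> ?b) / chi psi ?a\<bar> * \<bar>u y\<bar>
          + \<bar>I_fun W (c10_apply f y + c10_apply h y) - I_fun W (c10_apply f y) - I_deriv W (c10_apply f y) * c10_apply h y\<bar>"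
        unfolding eq by (rule order_trans[OF abs_triangle_ineq]) (simp add: abs_mult)
      also have "\<dots> \<le> (?n * norm h)\<^sup>2 / (2 * psi) * \<bar>u y\<bar> + 32 * W * (norm h)\<^sup>2"
      proof (rule add_mono)
        have "(norm ?b)\<^sup>2 / (2 * psi) \<le> (?n * norm h)\<^sup>2 / (2 * psi)"
          using psi by (intro divide_right_mono power_mono norm_grad_le) auto
        then show "\<bar>chi psi (?a + ?b) - chi psi ?a - (?a \<bullet> ?b) / chi psi ?a\<bar> * \<bar>u y\<bar>
            \<le> (?n * norm h)\<^sup>2 / (2 * psi) * \<bar>u y\<bar>"
          by (intro mult_right_mono order_trans[OF chi_Taylor[OF psi]]) auto
        have "(c10_apply h y)\<^sup>2 \<le> (norm h)\<^sup>2"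
          using power_mono[OF abs_c10_apply_le[of h y], of 2] by simp
        then show "\<bar>I_fun W (c10_apply f y + c10_apply h y) - I_fun W (c10_apply f y) - I_deriv W (c10_apply f y) * c10_apply h y\<bar>
            \<le> 32 * W * (norm h)\<^sup>2"
          using W by (intro order_trans[OF I_fun_Taylor[OF W]] mult_left_mono) auto
      qed
      finally show ?thesis .
    qed
    then have "norm (smoothing ?R) \<le> (?n * norm h)\<^sup>2 / (2 * psi) * ?S + 32 * W * (norm h)\<^sup>2 * ?m"
      using W psi by (intro norm_smoothing_dominated conv_dom_diff conv_dom_step_arg conv_dom_step_deriv u) auto
    ultimately show ?thesis
      unfolding h_def[symmetric] by (simp add: C_def power_mult_distrib algebra_simps)
  qed
  have "norm (step W psi g u w - step W psi f u w - ?D (g - f)) \<le> e * norm (g - f)"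
    if "norm (g - f) < e / (C + 1)" for g
  proof -
    have "C * norm (g - f) \<le> (C + 1) * norm (g - f)" by (simp add: distrib_right)
    also have "\<dots> \<le> e" using that C by (simp add: field_simps)
    finally have "C * norm (g - f) * norm (g - f) \<le> e * norm (g - f)" by (rule mult_right_mono) simp
    with rem[of g] show ?thesis by (simp add: power2_eq_square mult.assoc)
  qed
  moreover have "0 < e / (C + 1)" using e C by simp
  ultimately show "\<exists>d>0. \<forall>g. norm (g - f) < d \<longrightarrow>
      norm (step W psi g u w - step W psi f u w - ?D (g - f)) \<le> e * norm (g - f)" by blast
qed

lemma step_add_control:
  assumes "u \<in> conv_dom" "h \<in> conv_dom"
  shows "step W psi f (u + h) w = step W psi f u w + smoothing (\<lambda>y. chi psi (grad f y) * h y)"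
proof -
  have "(\<lambda>y. c10_apply f y + source W psi f (u + h) w y) =
      (\<lambda>y. (c10_apply f y + source W psi f u w y) + chi psi (grad f y) * h y)"
    by (auto simp: source_def algebra_simps)
  then show ?thesis
    unfolding step_def by (simp add: smoothing_add conv_dom_step_arg conv_dom_chi_mult psi assms)
qed

lemma step_add_field:
  assumes "u \<in> conv_dom"
  shows "step W psi f u (w + k) = step W psi f u w - smoothing (\<lambda>y. grad f y \<bullet> c1b_apply k y)"
proof -
  have "(\<lambda>y. c10_apply f y + source W psi f u (w + k) y) =
      (\<lambda>y. (c10_apply f y + source W psi f u w y) - grad f y \<bullet> c1b_apply k y)"
    by (auto simp: source_def c1b_apply_add inner_add_right algebra_simps)
  then show ?thesis
    unfolding step_def by (simp add: smoothing_diff conv_dom_step_arg conv_dom_grad_inner assms)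
qed

end

lemma norm_smoothing_chi_le:
  fixes f :: "'d c10"
  assumes psi: "0 < psi" and r: "1 < r" and h: "h \<in> Lr_space r"
  shows "norm (smoothing (\<lambda>y. chi psi (grad f y) * h y))
    \<le> (real CARD('d) * norm f + psi) * (integral\<^sup>L lborel M + Mmax) * Lr_norm r h"
proof -
  note h' = conv_dom_if_Lr[OF h r]
  have "norm (smoothing (\<lambda>y. chi psi (grad f y) * h y))
      \<le> (real CARD('d) * norm f + psi) * (SUP x. mass h x) + 0 * integral\<^sup>L lborel M"
    using psi chi_grad_le[OF psi h'] by (intro norm_smoothing_dominated h' conv_dom_chi_mult psi) auto
  also have "\<dots> \<le> (real CARD('d) * norm f + psi) * ((integral\<^sup>L lborel M + Mmax) * Lr_norm r h) + 0 * integral\<^sup>L lborel M"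
    using psi by (intro add_right_mono mult_left_mono cSUP_least mass_le_Lr_norm[OF h r]) auto
  finally show ?thesis by (simp add: mult.assoc)
qed

lemma bounded_linear_smoothing_grad_inner:
  fixes f :: "'d c10"
  shows "bounded_linear (\<lambda>k :: ('d, real^'d) c1b. smoothing (\<lambda>y. grad f y \<bullet> c1b_apply k y))"
proof (rule bounded_linear_intro)
  fix k l :: "('d, real^'d) c1b" and c :: real
  show "smoothing (\<lambda>y. grad f y \<bullet> c1b_apply (k + l) y) =
      smoothing (\<lambda>y. grad f y \<bullet> c1b_apply k y) + smoothing (\<lambda>y. grad f y \<bullet> c1b_apply l y)"
    by (simp add: c1b_apply_add inner_add_right smoothing_add conv_dom_grad_inner)
  show "smoothing (\<lambda>y. grad f y \<bullet> c1b_apply (c *\<^sub>R k) y) = c *\<^sub>R smoothing (\<lambda>y. grad f y \<bullet> c1b_apply k y)"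
    by (simp add: c1b_apply_scaleR smoothing_scale conv_dom_grad_inner)
  \<comment> \<open>The density is bounded outright, so the dominating function carries the factor
    \<open>0\<close> and any member of \<open>conv_dom\<close> may stand there.\<close>
  have "norm (smoothing (\<lambda>y. grad f y \<bullet> c1b_apply k y)) \<le>
      0 * (SUP x. mass (c10_apply f) x) + real CARD('d) * norm f * norm k * integral\<^sup>L lborel M"
    using abs_grad_inner_le[of f _ k]
    by (intro norm_smoothing_dominated[OF conv_dom_c10] conv_dom_grad_inner) auto
  then show "norm (smoothing (\<lambda>y. grad f y \<bullet> c1b_apply k y)) \<le>
      norm k * (real CARD('d) * norm f * integral\<^sup>L lborel M)"
    by (simp add: mult_ac)
qed

end

lemma C1_kernel_gauss_kernel:
  assumes "0 < tau"
  obtains gK M B where "C1_kernel (gauss_kernel tau :: real^'d::finite \<Rightarrow> real) gK M B"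
proof -
  define A c where "A = 1 / ((2 * pi) powr (real CARD('d) / 2) * tau ^ CARD('d))" and "c = 1 / (2 * tau\<^sup>2)"
  have A: "0 < A" and c: "0 < c" using assms by (simp_all add: A_def c_def)
  have eq: "gauss_kernel tau = (\<lambda>z::real^'d. A * exp (- (c * (norm z)\<^sup>2)))"
    by (simp add: gauss_kernel_def[abs_def] A_def c_def)
  from C1_kernel_gaussian[OF A c, where 'd = 'd] show ?thesis
    unfolding eq[symmetric] by (rule that)
qed

text \<open>The argument of \<open>to_c10\<close> is a sum of plain functions; it is recognized as
  the function underlying a sum of two elements of \<open>C^1_0\<close>, where \<open>to_c10\<close>
  has its intended value.\<close>

lemma (in C1_kernel) to_c10_eq_step:
  assumes W: "0 < W" and psi: "0 < psi" and u: "u \<in> conv_dom"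
  shows "to_c10 (\<lambda>x. (K \<star> c10_apply f) x +
     (K \<star> (\<lambda>y. chi psi (grad f y) * u y - grad f y \<bullet> c1b_apply w y + I_fun W (c10_apply f y))) x)
     = step W psi f u w"
proof -
  note S = conv_dom_source[OF W psi u, of f w]
  have "(\<lambda>x. (K \<star> c10_apply f) x + (K \<star> source W psi f u w) x) = c10_apply (smoothing (c10_apply f) + smoothing (source W psi f u w))"
    by (simp add: fun_eq_iff c10_apply_add c10_apply_smoothing conv_dom_c10 S)
  then show ?thesis
    by (simp add: step_def smoothing_add conv_dom_c10 S to_c10_apply flip: source_def)
qed

section \<open>The adjoint recursion\<close>

text \<open>The first step is peeled off, matching the recursion for the value functions.
  \<open>flow_Suc_right\<close> gives the view from the last step, in which feasibility of a
  perturbed trajectory is checked.\<close>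

fun flow :: "(nat \<Rightarrow> 'x \<Rightarrow> 'x) \<Rightarrow> nat \<Rightarrow> nat \<Rightarrow> 'x \<Rightarrow> 'x" where
  "flow P m 0 x = x"
| "flow P m (Suc n) x = flow P (Suc m) n (P m x)"

fun costate :: "(nat \<Rightarrow> 'x::real_normed_vector \<Rightarrow>\<^sub>L 'x) \<Rightarrow> ('x \<Rightarrow>\<^sub>L 'y::real_normed_vector) \<Rightarrow> nat \<Rightarrow> nat \<Rightarrow> 'x \<Rightarrow>\<^sub>L 'y" where
  "costate A q m 0 = q"
| "costate A q m (Suc n) = costate A q (Suc m) n o\<^sub>L A m"

lemma flow_Suc_right: "flow P m (Suc n) x = P (m + n) (flow P m n x)"
  by (induction n arbitrary: m x) simp_all

lemma flow_trajectory:
  assumes "\<And>k. m \<le> k \<Longrightarrow> k < m + n \<Longrightarrow> f (Suc k) = P k (f k)"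
  shows "flow P m n (f m) = f (m + n)"
  using assms
proof (induction n arbitrary: m)
  case (Suc n)
  from Suc.prems[of m] Suc.IH[of "Suc m"] Suc.prems show ?case by simp
qed simp

text \<open>Each \<open>P k\<close> is differentiated only at the trajectory point
  \<open>f k\<close>: the induction hypothesis at \<open>Suc m\<close> has base point
  \<open>f (Suc m) = P m (f m)\<close>, just where the chain rule evaluates the outer
  derivative.\<close>

lemma flow_has_derivative:
  assumes "\<And>k. m \<le> k \<Longrightarrow> k < m + n \<Longrightarrow> (P k has_derivative blinfun_apply (A k)) (at (f k))"
    and "\<And>k. m \<le> k \<Longrightarrow> k < m + n \<Longrightarrow> f (Suc k) = P k (f k)"
    and "(U has_derivative blinfun_apply q) (at (f (m + n)))"
  shows "((\<lambda>x. U (flow P m n x)) has_derivative blinfun_apply (costate A q m n)) (at (f m))"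
  using assms
proof (induction n arbitrary: m)
  case (Suc n)
  have "((\<lambda>x. U (flow P (Suc m) n x)) has_derivative blinfun_apply (costate A q (Suc m) n)) (at (P m (f m)))"
    using Suc.IH[of "Suc m"] Suc.prems by simp
  with Suc.prems(1)[of m]
  have "((\<lambda>x. U (flow P (Suc m) n (P m x))) has_derivative (\<lambda>h. costate A q (Suc m) n (A m h))) (at (f m))"
    using has_derivative_compose by fastforce
  then show ?case
    by (simp add: blinfun_compose.rep_eq comp_def)
qed simp

section \<open>Differentiation in one component of a tuple and stationarity in one control\<close>

lemma subspace_tuples: "subspace X \<Longrightarrow> subspace (tuples n X)"
  by (rule subspaceI) (auto simp: tuples_def subspace_0 subspace_add subspace_scale scaleR_fun_def)

lemma tuple_norm_nonneg: "(\<And>h. 0 \<le> N h) \<Longrightarrow> 0 \<le> tuple_norm n N w"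
  by (simp add: tuple_norm_def sum_nonneg)

lemma norm_le_tuple_norm:
  assumes "\<And>h. 0 \<le> N h" and "k \<in> {1..n}"
  shows "N (w k) \<le> tuple_norm n N w"
  unfolding tuple_norm_def by (rule member_le_sum) (use assms in auto)

text \<open>The projection to a component is linear and, for the sum norm, bounded with constant
  \<open>1\<close>.\<close>

lemma has_frechet_derivative_on_component:
  assumes psi: "has_frechet_derivative_on psi D (x k) X N" and X: "subspace X"
    and N: "\<And>h. 0 \<le> N h" and k: "k \<in> {1..n}"
  shows "has_frechet_derivative_on (\<lambda>w. psi (w k)) (\<lambda>h. D (h k)) x (tuples n X) (tuple_norm n N)"
  by (rule has_frechet_derivative_on_compose_linear[OF psi subspace_tuples[OF X], where C = 1])
    (use k N in \<open>auto simp: tuples_def scaleR_fun_def norm_le_tuple_norm tuple_norm_nonneg\<close>)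

text \<open>Stationarity of the cost plus the value function in one control is the vanishing of
  the corresponding summand of the Lagrangian, because both have the same derivative.\<close>

lemma multiplier_stationary:
  fixes J :: "'x::real_normed_vector \<Rightarrow> real" and q :: "'x \<Rightarrow>\<^sub>L real" and B :: "'w::real_vector \<Rightarrow> 'x"
  assumes c: "has_frechet_derivative_on c D x X N" and J: "(J has_derivative blinfun_apply q) (at y)"
    and X: "subspace X"
    and B: "\<And>h k. h \<in> X \<Longrightarrow> k \<in> X \<Longrightarrow> B (h + k) = B h + B k"
      "\<And>a h. h \<in> X \<Longrightarrow> B (a *\<^sub>R h) = a *\<^sub>R B h" "\<And>h. h \<in> X \<Longrightarrow> norm (B h) \<le> C * N h"
    and N: "\<And>h. 0 \<le> N h" "\<And>a h. h \<in> X \<Longrightarrow> N (a *\<^sub>R h) = \<bar>a\<bar> * N h"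
    and G: "\<And>h. h \<in> X \<Longrightarrow> G (x + h) = y + B h"
    and min: "\<And>h. h \<in> X \<Longrightarrow> c x + J (G x) \<le> c (x + h) + J (G (x + h))"
  shows "has_frechet_derivative_on (\<lambda>w. c w + q (G w)) (\<lambda>_. 0) x X N"
proof -
  have compose: "has_frechet_derivative_on (\<lambda>w. phi (G w)) (\<lambda>h. E (B h)) x X N"
    if "has_frechet_derivative_on phi E y UNIV norm" for phi E
    by (rule has_frechet_derivative_on_compose_linear[OF that X, where B = B and C = C])
      (simp_all add: B G N)
  have 1: "has_frechet_derivative_on (\<lambda>w. J (G w)) (\<lambda>h. q (B h)) x X N"
    using J by (intro compose) (simp add: has_frechet_derivative_on_UNIV)
  have 2: "has_frechet_derivative_on (\<lambda>w. q (G w)) (\<lambda>h. q (B h)) x X N"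
    by (intro compose)
      (simp add: has_frechet_derivative_on_UNIV bounded_linear_imp_has_derivative blinfun.bounded_linear_right)
  have "D h + q (B h) = 0" if "h \<in> X" for h
    by (rule has_frechet_derivative_on_minimum[OF has_frechet_derivative_on_add[OF c 1] X N min that]) auto
  then show ?thesis
    by (intro has_frechet_derivative_on_cong[OF has_frechet_derivative_on_add[OF c 2] X]) auto
qed

text \<open>Pairing the constraint at time \<open>k + 1\<close> with the cost at time
  \<open>k\<close> makes every summand depend on the single control pair \<open>u k\<close>,
  \<open>v k\<close>, so stationarity in the controls can be checked summand by summand.\<close>

lemma lagrangian_eq:
  assumes "0 < T"
  shows "lagrangian p r Ctop W psi tau T f0 U emb f u v l =
     (\<Sum>k=1..T-1. 1 / real T * (Ctop * Lr_norm r (u k) powr p + norm (v k) powr p)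
        + (l (Suc k) (f (Suc k)) - l (Suc k) (G_map W psi tau emb (f k) (u k) (v k))))
     + (U (f T) + (l 1 (f 1) - l 1 (to_c10 (gauss_kernel tau \<star> f0))))"
proof -
  have "(\<Sum>k=2..T. l k (f k - G_map W psi tau emb (f (k-1)) (u (k-1)) (v (k-1)))) =
      (\<Sum>k=1..T-1. l (Suc k) (f (Suc k) - G_map W psi tau emb (f k) (u k) (v k)))"
    using assms sum.shift_bounds_cl_Suc_ivl[of "\<lambda>k. l k (f k - G_map W psi tau emb (f (k-1)) (u (k-1)) (v (k-1)))" 1 "T - 1"]
    by (simp add: numeral_2_eq_2)
  then show ?thesis
    by (simp add: lagrangian_def blinfun.diff_right sum.distrib sum_divide_distrib add_divide_distrib)
qed

theorem proposition2:
  fixes p r sigma W psi Ctop tau :: real and T :: nat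
    and f0 :: "real^'d::finite \<Rightarrow> real"
    and U :: "'d c10 \<Rightarrow> real"
    and emb :: "'v::{real_inner, complete_space} \<Rightarrow> ('d, real^'d) c1b"
    and f :: "nat \<Rightarrow> 'd c10" and u :: "nat \<Rightarrow> real^'d \<Rightarrow> real" and v :: "nat \<Rightarrow> 'v"
  assumes "2 < p" and "real CARD('d) * p / (p - 2) < r"
    and "0 < sigma" and "0 < W" and "0 < psi" and "0 < Ctop" and "0 < T"
    and "tau = sigma * sqrt (1 / real T)"
    and "bounded_linear emb" and "inj emb"
    and "f0 \<in> Lr_space (r / (r - 1))"
    and "continuously_differentiable U" and "bdd_below (range U)"
    and "constrained_minimizer p r Ctop W psi tau T f0 U emb f u v"
  shows "\<exists>l. critical_point r T (lagrangian p r Ctop W psi tau T f0 U emb) f u v l"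
proof -
  \<comment> \<open>\<open>p / (p - 2)\<close> exceeds \<open>1\<close>, and the dimension is at
    least \<open>1\<close>.\<close>
  have r: "1 < r"
  proof -
    have "1 < p / (p - 2)" using assms(1) by (simp add: field_simps)
    also have "\<dots> \<le> real CARD('d) * (p / (p - 2))"
      using assms(1) mult_right_mono[of 1 "real CARD('d)" "p / (p - 2)"] by (simp add: Suc_le_eq)
    also have "\<dots> < r" using assms(2) by simp
    finally show ?thesis .
  qed
  have p: "1 < p" using assms(1) by simp
  have tau: "0 < tau" using assms by simp
  note W = assms(4) and psi = assms(5) and T = assms(7)
  interpret emb: bounded_linear emb by fact
  obtain gK M B where "C1_kernel (gauss_kernel tau :: real^'d \<Rightarrow> real) gK M B"
    using C1_kernel_gauss_kernel[OF tau] by blast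
  then interpret C1_kernel "gauss_kernel tau :: real^'d \<Rightarrow> real" gK M B .
  let ?G = "G_map W psi tau emb"
  have Lr_dom: "a \<in> conv_dom" if "a \<in> Lr_space r" for a
    using that r by (rule conv_dom_if_Lr)
  have G_eq: "?G g a b = step W psi g a (emb b)" if "a \<in> Lr_space r" for g a b
    unfolding G_map_def by (rule to_c10_eq_step[OF W psi Lr_dom[OF that]])
  have feas: "feasible r W psi tau T f0 emb f u v"
    and min: "\<And>f' u' v'. feasible r W psi tau T f0 emb f' u' v' \<Longrightarrow>
        energy p r Ctop T U f u v \<le> energy p r Ctop T U f' u' v'"
    using assms(14) unfolding constrained_minimizer_def by blast+
  have f_Q: "f \<in> Q_space T" and u_U: "u \<in> U_space r T" and v_V: "v \<in> V_space T"
    and f_1: "f 1 = to_c10 (gauss_kernel tau \<star> f0)"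
    and f_Suc: "\<And>k. k \<in> {1..T-1} \<Longrightarrow> f (Suc k) = ?G (f k) (u k) (v k)"
    using feas by (auto simp: feasible_def)
  have u_Lr: "u k \<in> Lr_space r" if "k \<in> {1..T-1}" for k
    using u_U that by (simp add: U_space_def tuples_def)
  obtain q where q: "(U has_derivative blinfun_apply q) (at (f T))"
    using assms(12) unfolding continuously_differentiable_def by blast
  define P where "P k x = ?G x (u k) (v k)" for k x
  define A where "A k = Blinfun (\<lambda>h. smoothing (step_deriv W psi (f k) (u k) (emb (v k)) h))" for k
  have P: "(P k has_derivative blinfun_apply (A k)) (at (f k))" if k: "k \<in> {1..T-1}" for k
  proof -
    note D = step_has_derivative[OF W psi Lr_dom[OF u_Lr[OF k]], of "emb (v k)" "f k"]
    then show ?thesis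
      using has_derivative_bounded_linear[OF D]
      by (simp add: P_def[abs_def] G_eq[OF u_Lr[OF k]] A_def bounded_linear_Blinfun_apply)
  qed
  have f_P: "f (Suc k) = P k (f k)" if "k \<in> {1..T-1}" for k
    using f_Suc[OF that] by (simp add: P_def)
  define Q where "Q k = costate A q k (T - k)" for k
  \<comment> \<open>The entries outside \<open>{1..T}\<close> are \<open>0\<close> as
    \<open>tuples\<close> demands. The sign is forced at the final time, where \<open>l T\<close> is
    paired with \<open>+ f T\<close> and has to cancel the derivative of \<open>U\<close>.\<close>
  define l where "l k = (if k \<in> {1..T} then - Q k else 0)" for k
  have l_T: "l T = - q" using T by (simp add: l_def Q_def)
  \<comment> \<open>The adjoint recursion.\<close>
  have l_Suc: "blinfun_apply (l (Suc k)) (A k h) = l k h" if "k \<in> {1..T-1}" for k h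
  proof -
    have "T - k = Suc (T - Suc k)" using that by auto
    then have "Q k = Q (Suc k) o\<^sub>L A k" by (simp add: Q_def)
    then show ?thesis using that by (auto simp: l_def blinfun.minus_left)
  qed
  have Q_Suc: "((\<lambda>x. U (flow P (Suc j) (T - Suc j) x)) has_derivative blinfun_apply (Q (Suc j))) (at (f (Suc j)))"
    if "j \<in> {1..T-1}" for j
    unfolding Q_def using that q by (intro flow_has_derivative P f_P) auto
  define cost where "cost a b = 1 / real T * (Ctop * Lr_norm r a powr p + norm b powr p)"
    for a :: "real^'d \<Rightarrow> real" and b :: 'v
  have no_gain: "cost (u j) (v j) + U (flow P (Suc j) (T - Suc j) (f (Suc j)))
      \<le> cost a b + U (flow P (Suc j) (T - Suc j) (?G (f j) a b))"
    if j: "j \<in> {1..T-1}" and a: "a \<in> Lr_space r" for j a b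
  proof -
    \<comment> \<open>The control at time \<open>j\<close> first acts on the state at
      \<open>j + 1\<close>, so \<open>f'\<close> keeps \<open>f\<close> up to and including
      \<open>j\<close>; in particular the initial condition survives. The value \<open>0\<close>
      beyond \<open>T\<close> is required by \<open>Q_space\<close>.\<close>
    define f' where "f' k = (if k \<le> j then f k else if k \<le> T then flow P (Suc j) (k - Suc j) (?G (f j) a b) else 0)" for k
    have jT: "1 \<le> j" "Suc j \<le> T" using j T by auto
    let ?u = "u(j := a)" and ?v = "v(j := b)"
    have "f' (Suc k) = ?G (f' k) (?u k) (?v k)" if k: "k \<in> {1..T-1}" for k
    proof (cases k j rule: linorder_cases)
      case less
      then show ?thesis using f_Suc[OF k] by (simp add: f'_def)
    next
      case equal
      then show ?thesis using jT by (simp add: f'_def)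
    next
      case greater
      then obtain i where i: "k = Suc j + i" by (metis Suc_leI le_add_diff_inverse)
      have "flow P (Suc j) (Suc i) x = P k (flow P (Suc j) i x)" for x
        using flow_Suc_right[of P "Suc j" i x] i by simp
      moreover have "Suc k \<le> T" using k T by auto
      ultimately show ?thesis using i by (simp add: f'_def P_def del: flow.simps)
    qed
    moreover have "f' \<in> Q_space T"
      using f_Q j by (auto simp: f'_def Q_space_def tuples_def)
    moreover have "?u \<in> U_space r T" "?v \<in> V_space T"
      using u_U v_V a j by (auto simp: U_space_def V_space_def tuples_def)
    moreover have "f' 1 = f 1" using j by (simp add: f'_def)
    ultimately have "feasible r W psi tau T f0 emb f' ?u ?v"
      using f_1 by (simp add: feasible_def)
    from min[OF this]
    have "(\<Sum>k=1..T-1. cost (u k) (v k)) + U (f T) \<le> (\<Sum>k=1..T-1. cost (?u k) (?v k)) + U (f' T)"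
      by (simp add: energy_def cost_def sum_distrib_left)
    moreover have "(\<Sum>k=1..T-1. cost (w k) (z k)) = cost (w j) (z j) + (\<Sum>k\<in>{1..T-1}-{j}. cost (w k) (z k))" for w z
      using j by (intro sum.remove) auto
    moreover have "(\<Sum>k\<in>{1..T-1}-{j}. cost (?u k) (?v k)) = (\<Sum>k\<in>{1..T-1}-{j}. cost (u k) (v k))"
      by (intro sum.cong) auto
    moreover have "flow P (Suc j) (T - Suc j) (f (Suc j)) = f T"
      using j by (subst flow_trajectory) (auto intro: f_P)
    moreover have "f' T = flow P (Suc j) (T - Suc j) (?G (f j) a b)"
      using j by (auto simp: f'_def)
    ultimately show ?thesis by simp
  qed
  have U_component: "has_frechet_derivative_on
      (\<lambda>a. cost a (v j) - l (Suc j) (?G (f j) a (v j))) (\<lambda>_. 0) (u j) (Lr_space r) (Lr_norm r)"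
    if j: "j \<in> {1..T-1}" for j
  proof -
    obtain D where D: "has_frechet_derivative_on (\<lambda>a. Lr_norm r a powr p) D (u j) (Lr_space r) (Lr_norm r)"
      using has_frechet_derivative_Lr_norm_powr[OF r p u_Lr[OF j]] by blast
    have "((\<lambda>s. 1 / real T * (Ctop * s + norm (v j) powr p)) has_real_derivative 1 / real T * Ctop)
        (at (Lr_norm r (u j) powr p))"
      using T by (auto intro!: derivative_eq_intros)
    from has_frechet_derivative_on_compose_real[OF this D Lr_norm_nonneg[OF r]]
    have c: "has_frechet_derivative_on (\<lambda>a. cost a (v j)) (\<lambda>h. 1 / real T * Ctop * D h) (u j) (Lr_space r) (Lr_norm r)"
      by (simp add: cost_def)
    have "has_frechet_derivative_on (\<lambda>a. cost a (v j) + Q (Suc j) (?G (f j) a (v j))) (\<lambda>_. 0) (u j) (Lr_space r) (Lr_norm r)"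
    proof (rule multiplier_stationary[OF c Q_Suc[OF j] subspace_Lr_space[OF r],
          \<comment> \<open>The linear part of \<open>G\<close> in the first control, by
            \<open>step_add_control\<close>.\<close>
          where B = "\<lambda>h. smoothing (\<lambda>y. chi psi (grad (f j) y) * h y)"])
      fix h k :: "real^'d \<Rightarrow> real" and a :: real
      assume h: "h \<in> Lr_space r"
      let ?S = "\<lambda>h. smoothing (\<lambda>y. chi psi (grad (f j) y) * h y)"
      show "?S (h + k) = ?S h + ?S k" if "k \<in> Lr_space r"
        using h that by (simp add: distrib_left smoothing_add conv_dom_chi_mult psi Lr_dom)
      show "?S (a *\<^sub>R h) = a *\<^sub>R ?S h"
        using smoothing_scale[OF conv_dom_chi_mult[OF psi Lr_dom[OF h]], of a]
        by (simp add: scaleR_fun_def mult.left_commute)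
      show "norm (?S h) \<le> (real CARD('d) * norm (f j) + psi) * (integral\<^sup>L lborel M + B) * Lr_norm r h"
        by (rule norm_smoothing_chi_le[OF psi r h])
      show "Lr_norm r (a *\<^sub>R h) = \<bar>a\<bar> * Lr_norm r h" by (rule Lr_space_scaleR(2)[OF r h])
      have "u j + h \<in> Lr_space r" by (rule Lr_space_add(1)[OF r u_Lr[OF j] h])
      then show "?G (f j) (u j + h) (v j) = f (Suc j) + ?S h"
        using step_add_control[OF W psi Lr_dom[OF u_Lr[OF j]] Lr_dom[OF h]]
        by (simp add: G_eq u_Lr[OF j] f_Suc[OF j])
      from no_gain[OF j \<open>u j + h \<in> Lr_space r\<close>, of "v j"]
      show "cost (u j) (v j) + U (flow P (Suc j) (T - Suc j) (?G (f j) (u j) (v j))) \<le>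
          cost (u j + h) (v j) + U (flow P (Suc j) (T - Suc j) (?G (f j) (u j + h) (v j)))"
        by (simp add: f_Suc[OF j])
    qed (rule Lr_norm_nonneg[OF r])
    moreover have "l (Suc j) = - Q (Suc j)" using j by (auto simp: l_def)
    ultimately show ?thesis by (simp add: blinfun.minus_left)
  qed
  have V_component: "has_frechet_derivative_on
      (\<lambda>b. cost (u j) b - l (Suc j) (?G (f j) (u j) b)) (\<lambda>_. 0) (v j) UNIV norm"
    if j: "j \<in> {1..T-1}" for j
  proof -
    obtain D where D: "((\<lambda>b. norm b powr p) has_derivative D) (at (v j))"
      using has_derivative_norm_powr[OF p] by blast
    have c: "has_frechet_derivative_on (cost (u j)) (\<lambda>h. 1 / real T * D h) (v j) UNIV norm"
      unfolding has_frechet_derivative_on_UNIV cost_def[abs_def]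
      by (rule derivative_eq_intros D refl)+ simp
    interpret S: bounded_linear "\<lambda>k. smoothing (\<lambda>y. grad (f j) y \<bullet> c1b_apply (emb k) y)"
      by (rule bounded_linear_compose[OF bounded_linear_smoothing_grad_inner assms(9)])
    obtain C where C: "\<And>k. norm (smoothing (\<lambda>y. grad (f j) y \<bullet> c1b_apply (emb k) y)) \<le> norm k * C"
      using S.bounded by blast
    have "has_frechet_derivative_on (\<lambda>b. cost (u j) b + Q (Suc j) (?G (f j) (u j) b)) (\<lambda>_. 0) (v j) UNIV norm"
    proof (rule multiplier_stationary[OF c Q_Suc[OF j] subspace_UNIV,
          where B = "\<lambda>k. - smoothing (\<lambda>y. grad (f j) y \<bullet> c1b_apply (emb k) y)" and C = C])
      fix h k :: 'v and a :: real
      let ?S = "\<lambda>k. - smoothing (\<lambda>y. grad (f j) y \<bullet> c1b_apply (emb k) y)"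
      show "?S (h + k) = ?S h + ?S k" by (simp only: S.add minus_add_distrib)
      show "?S (a *\<^sub>R h) = a *\<^sub>R ?S h" by (simp only: S.scaleR scaleR_minus_right)
      show "norm (?S h) \<le> C * norm h" using C[of h] by (simp only: norm_minus_cancel mult.commute)
      show "?G (f j) (u j) (v j + h) = f (Suc j) + ?S h"
        using step_add_field[OF W psi Lr_dom[OF u_Lr[OF j]]]
        by (simp add: G_eq u_Lr[OF j] f_Suc[OF j] emb.add)
      from no_gain[OF j u_Lr[OF j], of "v j + h"]
      show "cost (u j) (v j) + U (flow P (Suc j) (T - Suc j) (?G (f j) (u j) (v j))) \<le>
          cost (u j) (v j + h) + U (flow P (Suc j) (T - Suc j) (?G (f j) (u j) (v j + h)))"
        by (simp add: f_Suc[OF j])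
    qed simp_all
    moreover have "l (Suc j) = - Q (Suc j)" using j by (auto simp: l_def)
    ultimately show ?thesis by (simp add: blinfun.minus_left)
  qed
  let ?L = "lagrangian p r Ctop W psi tau T f0 U emb"
  note L_eq = lagrangian_eq[OF T, of p r Ctop W psi tau f0 U emb, folded cost_def]
  have linear: "has_frechet_derivative_on (blinfun_apply m) (blinfun_apply m) x UNIV norm"
    for m :: "'d c10 \<Rightarrow>\<^sub>L real" and x
    unfolding has_frechet_derivative_on_UNIV
    by (rule bounded_linear_imp_has_derivative) (rule blinfun.bounded_linear_right)
  have F: "has_frechet_derivative_on (\<lambda>f'. ?L f' u v l) (\<lambda>_. 0) f (Q_space T) (tuple_norm T norm)"
    unfolding Q_space_def
  proof (rule has_frechet_derivative_on_cong[OF has_frechet_derivative_on_add[OF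
          has_frechet_derivative_on_sum[where S = "{1..T-1}"]] subspace_tuples[OF subspace_UNIV]])
    fix k assume k: "k \<in> {1..T-1}"
    have "((\<lambda>x. - l (Suc k) (P k x)) has_derivative (\<lambda>h. - l (Suc k) (A k h))) (at (f k))"
      by (intro has_derivative_minus bounded_linear.has_derivative[OF blinfun.bounded_linear_right] P k)
    \<comment> \<open>By \<open>l_Suc\<close>, the derivative of the \<open>k\<close>-th transition
      term is expressed through \<open>l k\<close>, which prepares the telescoping sum
      below.\<close>
    then have "has_frechet_derivative_on (\<lambda>x. - l (Suc k) (P k x)) (\<lambda>h. - l k h) (f k) UNIV norm"
      by (simp add: has_frechet_derivative_on_UNIV l_Suc[OF k])
    then show "has_frechet_derivative_on
        (\<lambda>f'. cost (u k) (v k) + (l (Suc k) (f' (Suc k)) + - l (Suc k) (P k (f' k))))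
        (\<lambda>h. 0 + (l (Suc k) (h (Suc k)) + - l k (h k))) f (tuples T UNIV) (tuple_norm T norm)"
      using k by (intro has_frechet_derivative_on_add has_frechet_derivative_on_const
          has_frechet_derivative_on_component[where psi = "blinfun_apply (l (Suc k))" and k = "Suc k"]
          has_frechet_derivative_on_component[where psi = "\<lambda>x. - l (Suc k) (P k x)" and k = k]
          linear tuple_norm_nonneg subspace_UNIV) auto
  next
    show "has_frechet_derivative_on
        (\<lambda>f'. U (f' T) + (l 1 (f' 1) + - l 1 (to_c10 (gauss_kernel tau \<star> f0))))
        (\<lambda>h. q (h T) + (l 1 (h 1) + 0)) f (tuples T UNIV) (tuple_norm T norm)"
      using T q by (intro has_frechet_derivative_on_add has_frechet_derivative_on_const
          has_frechet_derivative_on_component[where psi = U and k = T]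
          has_frechet_derivative_on_component[where psi = "blinfun_apply (l 1)" and k = 1]
          linear tuple_norm_nonneg subspace_UNIV) (auto simp: has_frechet_derivative_on_UNIV)
  next
    fix h :: "nat \<Rightarrow> 'd c10"
    \<comment> \<open>Of the telescoped sum, the end at \<open>T\<close> cancels against
      \<open>q\<close> because \<open>l T = - q\<close>, and the end at \<open>1\<close> against the
      term of the initial constraint.\<close>
    have "(\<Sum>k=1..T-1. l (Suc k) (h (Suc k)) - l k (h k)) = l T (h T) - l 1 (h 1)"
      using sum_Suc_diff[of 1 "T - 1" "\<lambda>k. l k (h k)"] T by simp
    then show "0 = (\<Sum>k=1..T-1. 0 + (l (Suc k) (h (Suc k)) + - l k (h k))) + (q (h T) + (l 1 (h 1) + 0))"
      by (simp add: l_T blinfun.minus_left)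
  next
    fix h :: "nat \<Rightarrow> 'd c10"
    show "?L (f + h) u v l =
        (\<Sum>k=1..T-1. cost (u k) (v k) + (l (Suc k) ((f + h) (Suc k)) + - l (Suc k) (P k ((f + h) k)))) +
        (U ((f + h) T) + (l 1 ((f + h) 1) + - l 1 (to_c10 (gauss_kernel tau \<star> f0))))"
      unfolding L_eq P_def by simp
  qed (auto intro: tuple_norm_nonneg)
  have Un: "has_frechet_derivative_on (\<lambda>u'. ?L f u' v l) (\<lambda>_. 0) u (U_space r T) (tuple_norm (T - 1) (Lr_norm r))"
    unfolding U_space_def
  proof (rule has_frechet_derivative_on_cong[OF has_frechet_derivative_on_add[OF
          has_frechet_derivative_on_sum[where S = "{1..T-1}"] has_frechet_derivative_on_const]
          subspace_tuples[OF subspace_Lr_space[OF r]]])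
    fix k assume k: "k \<in> {1..T-1}"
    show "has_frechet_derivative_on (\<lambda>u'. cost (u' k) (v k) - l (Suc k) (?G (f k) (u' k) (v k)))
        (\<lambda>_. 0) u (tuples (T - 1) (Lr_space r)) (tuple_norm (T - 1) (Lr_norm r))"
      using has_frechet_derivative_on_component[where x = u and k = k, OF U_component[OF k]] k
      by (simp add: subspace_Lr_space[OF r] Lr_norm_nonneg[OF r])
  next
    fix h :: "nat \<Rightarrow> real^'d \<Rightarrow> real"
    \<comment> \<open>The last bracket collects what does not depend on the first control, so its
      derivative is \<open>0\<close>.\<close>
    show "?L f (u + h) v l = (\<Sum>k=1..T-1. cost ((u + h) k) (v k) - l (Suc k) (?G (f k) ((u + h) k) (v k)))
        + ((\<Sum>k=1..T-1. l (Suc k) (f (Suc k))) + (U (f T) + (l 1 (f 1) - l 1 (to_c10 (gauss_kernel tau \<star> f0)))))"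
      unfolding L_eq by (simp add: sum.distrib sum_subtractf)
  qed (auto intro: tuple_norm_nonneg Lr_norm_nonneg[OF r])
  have Vn: "has_frechet_derivative_on (\<lambda>v'. ?L f u v' l) (\<lambda>_. 0) v (V_space T) (tuple_norm (T - 1) norm)"
    unfolding V_space_def
  proof (rule has_frechet_derivative_on_cong[OF has_frechet_derivative_on_add[OF
          has_frechet_derivative_on_sum[where S = "{1..T-1}"] has_frechet_derivative_on_const]
          subspace_tuples[OF subspace_UNIV]])
    fix k assume k: "k \<in> {1..T-1}"
    show "has_frechet_derivative_on (\<lambda>v'. cost (u k) (v' k) - l (Suc k) (?G (f k) (u k) (v' k)))
        (\<lambda>_. 0) v (tuples (T - 1) UNIV) (tuple_norm (T - 1) norm)"
      using has_frechet_derivative_on_component[where x = v and k = k, OF V_component[OF k]] k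
      by simp
  next
    fix h :: "nat \<Rightarrow> 'v"
    show "?L f u (v + h) l = (\<Sum>k=1..T-1. cost (u k) ((v + h) k) - l (Suc k) (?G (f k) (u k) ((v + h) k)))
        + ((\<Sum>k=1..T-1. l (Suc k) (f (Suc k))) + (U (f T) + (l 1 (f 1) - l 1 (to_c10 (gauss_kernel tau \<star> f0)))))"
      unfolding L_eq by (simp add: sum.distrib sum_subtractf)
  qed (auto intro: tuple_norm_nonneg)
  \<comment> \<open>On a feasible trajectory every constraint term is zero, so the Lagrangian does
    not vary with the multiplier.\<close>
  have "?L f u v l' = (\<Sum>k=1..T-1. cost (u k) (v k)) + U (f T)" for l'
  proof -
    have "(\<Sum>k=1..T-1. cost (u k) (v k) + (l' (Suc k) (f (Suc k)) - l' (Suc k) (?G (f k) (u k) (v k))))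
        = (\<Sum>k=1..T-1. cost (u k) (v k))"
      using f_Suc by (intro sum.cong) simp_all
    then show ?thesis unfolding L_eq f_1 by simp
  qed
  then have Ln: "has_frechet_derivative_on (\<lambda>l'. ?L f u v l') (\<lambda>_. 0) l (Q_dual_space T) (tuple_norm T norm)"
    by (simp add: has_frechet_derivative_on_const tuple_norm_nonneg)
  have "l \<in> Q_dual_space T" by (auto simp: Q_dual_space_def tuples_def l_def)
  with F Un Vn Ln f_Q u_U v_V have "critical_point r T ?L f u v l"
    by (simp add: critical_point_def)
  then show ?thesis by blast
qed

end
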